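(* Let $\{(p_n,\mathcal D_n,L_n)\}_{n\ge1}$ be a sequence of Hadamard triples on $\mathbb R$ (with $p_n>1$ integers, $0\in\mathcal D_n\subset\{0,1,2,\dots\}$) such that $\sup_n\max\{p_n^{-1}d:d\in\mathcal D_n\}<\infty$ and $\sup_n\#\mathcal D_n<\infty$. Suppose that for all sufficiently large $n$ we have $p_n=\#\mathcal D_n$ and $\gcd\{\gcd\mathcal D_j:j\ge n\}=1$. Then the Cantor-Moran measure $\mu_{\{p_n,\mathcal D_n\}}$ is absolutely continuous with respect to Lebesgue measure and is a spectral measure.
   Context: A Hadamard triple on $\mathbb R$ is a triple $(p,\mathcal D,L)$ with $p>1$ an integer, $\mathcal D,L\subset\mathbb Z$ finite with $\#\mathcal D=\#L$, such that the matrix $\frac{1}{\sqrt{\#\mathcal D}}\big[e^{2\pi i d\ell/p}\big]_{\ell\in L,d\in\mathcal D}$ is unitary. For finite $A\subset\mathbb R$, $\delta_A=\frac{1}{\#A}\sum_{a\in A}\delta_a$. The Cantor-Moran measure $\mu_{\{p_n,\mathcal D_n\}}=\delta_{p_1^{-1}\mathcal D_1}*\delta_{(p_1p_2)^{-1}\mathcal D_2}*\cdots$ is the weak limit of the finite convolutions $\delta_{p_1^{-1}\mathcal D_1}*\cdots*\delta_{(p_1\cdots p_n)^{-1}\mathcal D_n}$. A probability measure $\mu$ is spectral if there is a countable $\Lambda\subset\mathbb R$ with $\{e^{2\pi i\lambda x}\}_{\lambda\in\Lambda}$ an orthogonal basis of $L^2(\mu)$. *)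

theory Defs
  imports "HOL-Probability.Probability"
begin

text \<open>Hadamard triple (p, D, L) on the real line: p > 1 integer, D, L finite sets of
  integers with the same cardinality N, and the matrix
  N^(-1/2) [exp(2 pi i d l / p)]_(l in L, d in D) is unitary, i.e. M M^* = I.\<close>
definition hadamard_triple :: "int \<Rightarrow> int set \<Rightarrow> int set \<Rightarrow> bool" where
  "hadamard_triple p D L \<longleftrightarrow> p > 1 \<and> finite D \<and> finite L \<and> card D = card L \<and>
     (\<forall>l\<in>L. \<forall>l'\<in>L.
        (\<Sum>d\<in>D. (exp (2 * pi * \<i> * of_int (d * l) / of_int p) / sqrt (card D))
                 * cnj (exp (2 * pi * \<i> * of_int (d * l') / of_int p) / sqrt (card D)))
        = (if l = l' then 1 else 0))"

definition delta_set :: "real set \<Rightarrow> real measure" where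
  "delta_set A = distr (measure_pmf (pmf_of_set A)) borel (\<lambda>x. x)"

text \<open>Finite convolutions delta_(p1^-1 D1) * ... * delta_((p1...pn)^-1 Dn);
  sequences are indexed from 1, index 0 gives delta_0.\<close>
fun moran_partial :: "(nat \<Rightarrow> int) \<Rightarrow> (nat \<Rightarrow> int set) \<Rightarrow> nat \<Rightarrow> real measure" where
  "moran_partial p D 0 = return borel 0"
| "moran_partial p D (Suc n) =
     convolution (moran_partial p D n)
       (delta_set ((\<lambda>d. real_of_int d / (\<Prod>k=1..Suc n. real_of_int (p k))) ` D (Suc n)))"

text \<open>Spectral measure: some countable Lambda such that the exponentials
  e_lambda(x) = exp(2 pi i lambda x) form an orthogonal basis of L^2(mu)
  (pairwise orthogonal and complete).\<close>
definition spectral_measure :: "real measure \<Rightarrow> bool" where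
  "spectral_measure \<mu> \<longleftrightarrow> (\<exists>\<Lambda>::real set. countable \<Lambda> \<and>
     (\<forall>a\<in>\<Lambda>. \<forall>b\<in>\<Lambda>. a \<noteq> b \<longrightarrow>
        (LINT x|\<mu>. exp (2 * pi * \<i> * of_real (a * x)) * cnj (exp (2 * pi * \<i> * of_real (b * x)))) = 0) \<and>
     (\<forall>f :: real \<Rightarrow> complex. f \<in> borel_measurable \<mu> \<and> integrable \<mu> (\<lambda>x. (cmod (f x))\<^sup>2) \<and>
        (\<forall>a\<in>\<Lambda>. (LINT x|\<mu>. f x * cnj (exp (2 * pi * \<i> * of_real (a * x)))) = 0)
        \<longrightarrow> (AE x in \<mu>. f x = 0)))"

end

theory Submission
  imports Defs
begin

text \<open>
  From some level N on, D n is a complete residue system modulo p n. Hence the tail measure after N digits has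
  vanishing Fourier coefficients at all nonzero integers: it projects to Lebesgue measure on the circle, so it is
  absolutely continuous. It has the integers as a spectrum as soon as its density does not overlap with its own
  integer translates, since then the tail measure lives on a set on which the projection to the circle is injective.

  Overlaps are measured by the numbers h n k, the integrals of f(x) f(x + k) for the density f of the n-th tail. They
  form a probability law in k, and h n is obtained from h (n + 1) by one step of a Markov chain of carries. In terms
  of g n, the cosine polynomial with coefficients h n, this is a transfer operator with weights the squared moduli of
  the digit masks, so the minima of g n decrease to some limit; suppose it is less than 1. Among the limit points of
  the sequence h choose one whose minimum set S has the largest cardinality. Preimages of distinct minimum points are
  distinct minimum points of the next level, so by maximality no branching occurs on S. By compactness the same holds
  on all c-point sets of rationals with a fixed denominator on which g n is close to the limit, c being the
  cardinality of S; without branching g n keeps its value, so that such a set can be followed through all later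
  levels. A point followed for ever without branching is a rational whose denominator divides all later digits.
  The gcd condition makes it 0, where g n equals 1: contradiction. Thus h n is the Dirac mass at 0.

  Finally, a spectrum of the tail after n + 1 digits is turned into one of the tail after n digits by the Hadamard
  triple, for n = N - 1, ..., 0.
\<close>

section \<open>Tail measures\<close>

text \<open>Moduli and digit sets vary with n, so there is no single transfer operator whose fixed
  functions could be studied. Compactness replaces stationarity: all \<open>h n\<close> are laws on
  one window of integers, because every tail lives in [0, 2C], and only finitely many pairs of
  modulus and digit set occur. A minimum point of an actual \<open>g n\<close> need not have minimum
  points as preimages, since the minima may still decrease; only for limit laws is the same bound
  valid and attained on both sides of a step, and there the counting of preimages works. The gcd
  condition, on the other hand, concerns the actual digits and is not inherited by limits, from
  which rarely occurring digits may disappear. Hence the return to actual levels. It needs the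
  candidate point sets to range over a finite family, and this is where the fixed denominator comes
  from: at a point \<eta> of full mask d \<eta> is an integer for every digit d, and some digit lies
  between 1 and B, so the denominator of \<eta> divides B!.\<close>

lemma suminf_eq_head_add:
  fixes f :: "nat \<Rightarrow> real"
  shows "summable f \<Longrightarrow> suminf f = f 0 + (\<Sum>i. f (Suc i))"
  by (simp add: suminf_split_head)

locale digit_system =
  fixes p :: "nat \<Rightarrow> int" and D :: "nat \<Rightarrow> int set" and C :: real
  assumes p_ge: "n \<ge> 1 \<Longrightarrow> p n \<ge> 2"
    and fin: "n \<ge> 1 \<Longrightarrow> finite (D n)"
    and ne: "n \<ge> 1 \<Longrightarrow> D n \<noteq> {}"
    and nonneg: "n \<ge> 1 \<Longrightarrow> d \<in> D n \<Longrightarrow> d \<ge> 0"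
    and bound: "n \<ge> 1 \<Longrightarrow> d \<in> D n \<Longrightarrow> real_of_int d \<le> C * real_of_int (p n)"
begin

abbreviation digit_measure :: "nat \<Rightarrow> int measure" where
  "digit_measure j \<equiv> measure_pmf (pmf_of_set (D j))"

text \<open>Replacing non-digits by 0 makes the digit series converge for every sequence, not only almost every one.\<close>
definition digit :: "nat \<Rightarrow> int \<Rightarrow> int" where
  "digit j x = (if x \<in> D j then x else 0)"

definition tail_sum :: "nat \<Rightarrow> (nat \<Rightarrow> int) \<Rightarrow> real" where
  "tail_sum n \<omega> = (\<Sum>i. of_int (digit (Suc n + i) (\<omega> (Suc n + i))) / (\<Prod>k=Suc n..Suc n + i. of_int (p k)))"

definition tail :: "nat \<Rightarrow> real measure" where
  "tail n = distr (PiM {n<..} digit_measure) borel (tail_sum n)"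

lemma C_nonneg: "C \<ge> 0"
proof -
  obtain d where d: "d \<in> D 1" using ne[of 1] by auto
  have "0 \<le> C * real_of_int (p 1)"
    using nonneg[OF _ d] bound[OF _ d] by simp
  moreover have "real_of_int (p 1) > 0" using p_ge[of 1] by simp
  ultimately show ?thesis by (simp add: zero_le_mult_iff)
qed

lemma prod_p_ge: "(\<Prod>k=Suc n..n + i. real_of_int (p k)) \<ge> 2 ^ i"
proof (induction i)
  case (Suc i)
  have "2 ^ Suc i = (2 ^ i) * (2::real)" by simp
  also have "\<dots> \<le> (\<Prod>k=Suc n..n + i. real_of_int (p k)) * real_of_int (p (n + Suc i))"
    using p_ge[of "n + Suc i"] by (intro mult_mono Suc.IH prod_nonneg ballI order_trans[OF _ p_ge[THEN of_int_le_iff[THEN iffD2]]]) auto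
  finally show ?case by simp
qed auto

text \<open>The last factor of the denominator absorbs the bound C p of the digit, and each of the
  other i factors is at least 2. This geometric majorant is the same for all n and all sequences; it
  yields convergence and the support bound 2C.\<close>

lemma digit_term_bounds:
  "0 \<le> real_of_int (digit (Suc n + i) x) / (\<Prod>k=Suc n..Suc n + i. of_int (p k))"
  "real_of_int (digit (Suc n + i) x) / (\<Prod>k=Suc n..Suc n + i. of_int (p k)) \<le> C * (1/2) ^ i"
proof -
  have pr: "(\<Prod>k=Suc n..Suc n + i. real_of_int (p k)) = (\<Prod>k=Suc n..n + i. real_of_int (p k)) * of_int (p (Suc n + i))"
    by simp
  have pos: "real_of_int (p (Suc n + i)) > 0" using p_ge[of "Suc n + i"] by simp
  have P: "(\<Prod>k=Suc n..n + i. real_of_int (p k)) \<ge> 2 ^ i" by (rule prod_p_ge)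
  then have Ppos: "(\<Prod>k=Suc n..n + i. real_of_int (p k)) > 0"
    by (rule less_le_trans[rotated]) simp
  have dg: "0 \<le> real_of_int (digit (Suc n + i) x)"
    "real_of_int (digit (Suc n + i) x) \<le> C * of_int (p (Suc n + i))"
    using nonneg[of "Suc n + i" x] bound[of "Suc n + i" x] C_nonneg pos by (auto simp: digit_def)
  show "0 \<le> real_of_int (digit (Suc n + i) x) / (\<Prod>k=Suc n..Suc n + i. of_int (p k))"
    unfolding pr using dg pos Ppos by (intro divide_nonneg_pos mult_pos_pos) auto
  have "real_of_int (digit (Suc n + i) x) / (\<Prod>k=Suc n..Suc n + i. of_int (p k))
      \<le> C * of_int (p (Suc n + i)) / ((\<Prod>k=Suc n..n + i. real_of_int (p k)) * of_int (p (Suc n + i)))"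
    unfolding pr using dg pos Ppos by (intro divide_right_mono mult_nonneg_nonneg) auto
  also have "\<dots> = C / (\<Prod>k=Suc n..n + i. real_of_int (p k))" using pos by simp
  also have "\<dots> \<le> C / 2 ^ i" using P C_nonneg by (intro divide_left_mono mult_pos_pos Ppos) auto
  finally show "real_of_int (digit (Suc n + i) x) / (\<Prod>k=Suc n..Suc n + i. of_int (p k)) \<le> C * (1/2) ^ i"
    by (simp add: power_divide)
qed

lemma summable_tail_sum:
  "summable (\<lambda>i. real_of_int (digit (Suc n + i) (\<omega> (Suc n + i))) / (\<Prod>k=Suc n..Suc n + i. of_int (p k)))"
proof (rule summable_comparison_test')
  show "summable (\<lambda>i. C * (1/2) ^ i :: real)" by (intro summable_mult summable_geometric) simp
  fix i :: nat
  show "norm (real_of_int (digit (Suc n + i) (\<omega> (Suc n + i))) / (\<Prod>k=Suc n..Suc n + i. of_int (p k))) \<le> C * (1/2) ^ i"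
    using digit_term_bounds[of n i "\<omega> (Suc n + i)"] by (simp del: prod.cl_ivl_Suc)
qed

lemma tail_sum_bounds: "0 \<le> tail_sum n \<omega>" "tail_sum n \<omega> \<le> 2 * C"
proof -
  show "0 \<le> tail_sum n \<omega>"
    unfolding tail_sum_def by (intro suminf_nonneg summable_tail_sum digit_term_bounds)
  have "tail_sum n \<omega> \<le> (\<Sum>i. C * (1/2) ^ i)"
    unfolding tail_sum_def
    by (intro suminf_le summable_tail_sum digit_term_bounds summable_mult summable_geometric) simp
  also have "\<dots> = 2 * C" by (subst suminf_mult) (simp_all add: suminf_geometric)
  finally show "tail_sum n \<omega> \<le> 2 * C" .
qed

lemma tail_sum_Suc:
  "tail_sum n \<omega> = (of_int (digit (Suc n) (\<omega> (Suc n))) + tail_sum (Suc n) \<omega>) / of_int (p (Suc n))"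
proof -
  have pr: "(\<Prod>k=Suc n..Suc n + Suc i. real_of_int (p k)) = of_int (p (Suc n)) * (\<Prod>k=Suc (Suc n)..Suc (Suc n) + i. of_int (p k))" for i
    by (subst prod.atLeast_Suc_atMost) auto
  have "tail_sum n \<omega> = of_int (digit (Suc n) (\<omega> (Suc n))) / of_int (p (Suc n))
    + (\<Sum>i. of_int (digit (Suc (Suc n) + i) (\<omega> (Suc (Suc n) + i))) / (\<Prod>k=Suc (Suc n)..Suc (Suc n) + i. of_int (p k)) / of_int (p (Suc n)))"
    unfolding tail_sum_def
    by (subst suminf_eq_head_add[OF summable_tail_sum], unfold pr) (simp add: field_simps)
  also have "\<dots> = of_int (digit (Suc n) (\<omega> (Suc n))) / of_int (p (Suc n)) + tail_sum (Suc n) \<omega> / of_int (p (Suc n))"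
    unfolding tail_sum_def by (subst suminf_divide[OF summable_tail_sum]) simp
  finally show ?thesis by (simp add: add_divide_distrib)
qed

lemma tail_sum_cong: "(\<And>j. j > n \<Longrightarrow> \<omega> j = \<omega>' j) \<Longrightarrow> tail_sum n \<omega> = tail_sum n \<omega>'"
  by (simp add: tail_sum_def)

lemma measurable_tail_sum [measurable]:
  "tail_sum n \<in> borel_measurable (PiM {n<..} digit_measure)"
proof -
  have [measurable]: "(\<lambda>\<omega>. real_of_int (digit (Suc n + i) (\<omega> (Suc n + i)))) \<in> borel_measurable (PiM {n<..} digit_measure)" for i
    by (rule measurable_compose[OF measurable_component_singleton]) auto
  show ?thesis unfolding tail_sum_def[abs_def] by measurable
qed

lemma prob_space_digits: "prob_space (PiM I digit_measure)"
  by (intro prob_space_PiM prob_space_measure_pmf)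

lemma real_distribution_tail: "real_distribution (tail n)"
proof -
  interpret prob_space "PiM {n<..} digit_measure" by (rule prob_space_digits)
  show ?thesis unfolding tail_def by (rule real_distribution_distr) simp
qed

lemma sets_tail [simp, measurable_cong]: "sets (tail n) = sets borel"
  and space_tail [simp]: "space (tail n) = UNIV"
  by (simp_all add: tail_def)

lemma AE_tail_bounds: "AE x in tail n. 0 \<le> x \<and> x \<le> 2 * C"
  unfolding tail_def by (subst AE_distr_iff) (simp_all add: tail_sum_bounds)

text \<open>The product measure splits into its coordinate \<open>Suc n\<close> and the rest, and
  \<open>tail_sum_Suc\<close> peels the corresponding digit off the series. The integral formulas
  for tails below all come from this recursion.\<close>

lemma tail_refine:
  "tail n = distr (digit_measure (Suc n) \<Otimes>\<^sub>M tail (Suc n)) borel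
     (\<lambda>(d, y). (of_int (digit (Suc n) d) + y) / of_int (p (Suc n)))"
proof -
  let ?P = "\<lambda>n. PiM {n<..} digit_measure"
  interpret S: prob_space "?P (Suc n)" by (rule prob_space_digits)
  have ins: "insert (Suc n) {Suc n<..} = {n<..}" by auto
  have M: "(\<lambda>(x, X). X(Suc n := x)) \<in> measurable (digit_measure (Suc n) \<Otimes>\<^sub>M ?P (Suc n)) (?P n)"
    by (subst ins[symmetric]) measurable
  have "?P n = distr (digit_measure (Suc n) \<Otimes>\<^sub>M ?P (Suc n)) (?P n) (\<lambda>(x, X). X(Suc n := x))"
    using distr_pair_PiM_eq_PiM[of "{Suc n<..}" digit_measure "Suc n"]
    by (simp add: ins prob_space_measure_pmf)
  then have "tail n = distr (distr (digit_measure (Suc n) \<Otimes>\<^sub>M ?P (Suc n)) (?P n) (\<lambda>(x, X). X(Suc n := x))) borel (tail_sum n)"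
    unfolding tail_def by simp
  also have "\<dots> = distr (digit_measure (Suc n) \<Otimes>\<^sub>M ?P (Suc n)) borel (tail_sum n \<circ> (\<lambda>(x, X). X(Suc n := x)))"
    by (intro distr_distr M) simp
  also have "tail_sum n \<circ> (\<lambda>(x, X). X(Suc n := x)) =
     (\<lambda>(d, y). (of_int (digit (Suc n) d) + y) / of_int (p (Suc n))) \<circ> (\<lambda>(x, X). (x, tail_sum (Suc n) X))"
    by (auto simp: fun_eq_iff tail_sum_Suc[of n] intro!: tail_sum_cong arg_cong2[where f="(/)"])
  also have "distr (digit_measure (Suc n) \<Otimes>\<^sub>M ?P (Suc n)) borel \<dots> =
     distr (distr (digit_measure (Suc n) \<Otimes>\<^sub>M ?P (Suc n)) (digit_measure (Suc n) \<Otimes>\<^sub>M borel) (\<lambda>(x, X). (x, tail_sum (Suc n) X)))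
       borel (\<lambda>(d, y). (of_int (digit (Suc n) d) + y) / of_int (p (Suc n)))"
    by (intro distr_distr[symmetric]) measurable
  also have "distr (digit_measure (Suc n) \<Otimes>\<^sub>M ?P (Suc n)) (digit_measure (Suc n) \<Otimes>\<^sub>M borel) (\<lambda>(x, X). (x, tail_sum (Suc n) X))
     = distr (digit_measure (Suc n)) (digit_measure (Suc n)) (\<lambda>x. x) \<Otimes>\<^sub>M tail (Suc n)"
    unfolding tail_def
    by (intro pair_measure_distr[symmetric] prob_space_imp_sigma_finite S.prob_space_distr) simp_all
  finally show ?thesis by simp
qed

lemma nn_integral_tail:
  assumes F [measurable]: "F \<in> borel_measurable borel"
  shows "(\<integral>\<^sup>+x. F x \<partial>tail n) =
    (\<Sum>d\<in>D (Suc n). \<integral>\<^sup>+y. F ((of_int d + y) / of_int (p (Suc n))) \<partial>tail (Suc n)) / ennreal (card (D (Suc n)))"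
proof -
  interpret T: real_distribution "tail (Suc n)" by (rule real_distribution_tail)
  have "(\<integral>\<^sup>+x. F x \<partial>tail n) = (\<integral>\<^sup>+z. F ((of_int (digit (Suc n) (fst z)) + snd z) / of_int (p (Suc n))) \<partial>(digit_measure (Suc n) \<Otimes>\<^sub>M tail (Suc n)))"
    by (subst tail_refine) (simp add: nn_integral_distr case_prod_unfold)
  also have "\<dots> = (\<integral>\<^sup>+d. \<integral>\<^sup>+y. F ((of_int (digit (Suc n) d) + y) / of_int (p (Suc n))) \<partial>tail (Suc n) \<partial>digit_measure (Suc n))"
    by (subst T.nn_integral_fst[symmetric]) simp_all
  also have "\<dots> = (\<Sum>d\<in>D (Suc n). \<integral>\<^sup>+y. F ((of_int (digit (Suc n) d) + y) / of_int (p (Suc n))) \<partial>tail (Suc n)) / ennreal (card (D (Suc n)))"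
    by (subst nn_integral_pmf_of_set) (simp_all add: fin ne ennreal_of_nat_eq_real_of_nat)
  finally show ?thesis by (simp add: digit_def cong: sum.cong)
qed

text \<open>Each digit has the positive weight 1 / card, so a single branch costs at most card times
  the full integral.\<close>

lemma integrable_tail:
  fixes F :: "real \<Rightarrow> 'a::{banach, second_countable_topology}"
  assumes F: "integrable (tail n) F" and d: "d \<in> D (Suc n)"
  shows "integrable (tail (Suc n)) (\<lambda>y. F ((of_int d + y) / of_int (p (Suc n))))"
proof -
  have [measurable]: "F \<in> borel_measurable borel" using F by (auto simp: integrable_iff_bounded)
  have "(\<integral>\<^sup>+y. norm (F ((of_int d + y) / of_int (p (Suc n)))) \<partial>tail (Suc n))
     \<le> (\<Sum>d\<in>D (Suc n). \<integral>\<^sup>+y. norm (F ((of_int d + y) / of_int (p (Suc n)))) \<partial>tail (Suc n))"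
    by (rule member_le_sum[OF d, where f="\<lambda>d. \<integral>\<^sup>+y. norm (F ((of_int d + y) / of_int (p (Suc n)))) \<partial>tail (Suc n)"]) (simp_all add: fin)
  also have "\<dots> = (\<integral>\<^sup>+x. norm (F x) \<partial>tail n) * ennreal (card (D (Suc n)))"
    using ne[of "Suc n"] fin[of "Suc n"]
    by (subst nn_integral_tail) (simp_all add: ennreal_divide_times card_gt_0_iff ennreal_mult_divide_eq)
  also have "\<dots> < \<infinity>"
    using F by (auto simp: integrable_iff_bounded intro: ennreal_mult_less_top[THEN iffD2])
  finally show ?thesis by (simp add: integrable_iff_bounded)
qed

lemma integral_tail:
  fixes F :: "real \<Rightarrow> 'a::{banach, second_countable_topology}"
  assumes F: "integrable (tail n) F"
  shows "(\<integral>x. F x \<partial>tail n) =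
    (\<Sum>d\<in>D (Suc n). \<integral>y. F ((of_int d + y) / of_int (p (Suc n))) \<partial>tail (Suc n)) /\<^sub>R card (D (Suc n))"
proof -
  interpret T: real_distribution "tail (Suc n)" by (rule real_distribution_tail)
  interpret PP: pair_sigma_finite "digit_measure (Suc n)" "tail (Suc n)" ..
  have [measurable]: "F \<in> borel_measurable borel" using F by (auto simp: integrable_iff_bounded)
  have int: "integrable (digit_measure (Suc n) \<Otimes>\<^sub>M tail (Suc n)) (\<lambda>z. F ((of_int (digit (Suc n) (fst z)) + snd z) / of_int (p (Suc n))))"
    using F by (subst (asm) tail_refine) (simp add: integrable_distr_eq case_prod_unfold)
  have "(\<integral>x. F x \<partial>tail n) = (\<integral>z. F ((of_int (digit (Suc n) (fst z)) + snd z) / of_int (p (Suc n))) \<partial>(digit_measure (Suc n) \<Otimes>\<^sub>M tail (Suc n)))"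
    by (subst tail_refine) (simp add: integral_distr case_prod_unfold)
  also have "\<dots> = (\<integral>d. \<integral>y. F ((of_int (digit (Suc n) d) + y) / of_int (p (Suc n))) \<partial>tail (Suc n) \<partial>digit_measure (Suc n))"
    using PP.integral_fst'[OF int] by simp
  also have "\<dots> = (\<Sum>d\<in>D (Suc n). pmf (pmf_of_set (D (Suc n))) d *\<^sub>R (\<integral>y. F ((of_int (digit (Suc n) d) + y) / of_int (p (Suc n))) \<partial>tail (Suc n)))"
    by (subst integral_measure_pmf[of "D (Suc n)"]) (auto simp: fin ne)
  also have "\<dots> = (\<Sum>d\<in>D (Suc n). (\<integral>y. F ((of_int d + y) / of_int (p (Suc n))) \<partial>tail (Suc n)) /\<^sub>R card (D (Suc n)))"
    by (intro sum.cong refl) (simp add: fin ne digit_def divide_inverse)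
  finally show ?thesis by (simp add: scaleR_sum_right)
qed

end

section \<open>Exponentials, Hadamard triples and spectra of consecutive tails\<close>

definition ue :: "real \<Rightarrow> complex" where
  "ue x = cis (2 * pi * x)"

lemma ue_add: "ue (x + y) = ue x * ue y"
  by (simp add: ue_def cis_mult ring_distribs)

lemma ue_minus: "ue (- x) = cnj (ue x)"
  by (simp add: ue_def cis_cnj)

lemma ue_diff: "ue (x - y) = ue x * cnj (ue y)"
  using ue_add[of x "- y"] by (simp add: ue_minus)

lemma norm_ue [simp]: "norm (ue x) = 1"
  by (simp add: ue_def)

lemma ue_0 [simp]: "ue 0 = 1"
  by (simp add: ue_def)

lemma ue_Ints: "x \<in> \<int> \<Longrightarrow> ue x = 1"
  by (auto simp: ue_def elim!: Ints_cases)

lemma ue_of_int [simp]: "ue (of_int k) = 1"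
  by (simp add: ue_Ints)

lemma ue_eq_1_iff: "ue x = 1 \<longleftrightarrow> x \<in> \<int>"
proof
  assume "ue x = 1"
  then have "exp (\<i> * complex_of_real (2 * pi * x)) = 1" by (simp add: ue_def cis_conv_exp)
  then obtain k :: int where "2 * pi * x = of_int (2 * k) * pi"
    by (auto simp: exp_eq_1)
  then show "x \<in> \<int>" by simp
qed (rule ue_Ints)

lemma ue_cong_Ints: "x - y \<in> \<int> \<Longrightarrow> ue x = ue y"
  using ue_add[of "x - y" y] by (simp add: ue_Ints)

lemma ue_mult_cnj: "ue x * cnj (ue x) = 1"
  by (simp add: complex_norm_square[symmetric])

lemma continuous_ue [continuous_intros]: "continuous_on A f \<Longrightarrow> continuous_on A (\<lambda>x. ue (f x))"
  unfolding ue_def by (intro continuous_intros)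

lemma measurable_ue [measurable]: "ue \<in> borel_measurable borel"
  by (intro borel_measurable_continuous_onI continuous_intros)

lemma exp_eq_ue: "exp (2 * pi * \<i> * complex_of_real x) = ue x"
  by (simp add: ue_def cis_conv_exp mult_ac)

section \<open>Orthogonality relations of a Hadamard matrix\<close>

lemma hadamard_rows:
  assumes H: "hadamard_triple p D L" and l: "l \<in> L" "l' \<in> L"
  shows "(\<Sum>d\<in>D. ue (of_int (d * (l - l')) / of_int p)) = (if l = l' then of_nat (card D) else 0)"
proof -
  have N: "card D > 0"
    using H l by (metis card_gt_0_iff empty_iff hadamard_triple_def)
  have term_eq: "(exp (2 * pi * \<i> * of_int (d * l) / of_int p) / sqrt (card D))
      * cnj (exp (2 * pi * \<i> * of_int (d * l') / of_int p) / sqrt (card D))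
      = ue (of_int (d * (l - l')) / of_int p) / of_nat (card D)" for d
  proof -
    have e: "exp (2 * pi * \<i> * of_int (d * l) / of_int p) = ue (of_int (d * l) / of_int p)" for l
      using exp_eq_ue[of "of_int (d * l) / of_int p"] by simp
    have s: "complex_of_real (sqrt (card D)) * complex_of_real (sqrt (card D)) = of_nat (card D)"
      by (simp flip: of_real_mult)
    show ?thesis
      unfolding e by (simp add: s ue_diff right_diff_distrib diff_divide_distrib)
  qed
  have "(\<Sum>d\<in>D. ue (of_int (d * (l - l')) / of_int p) / of_nat (card D)) = (if l = l' then 1 else 0)"
    unfolding term_eq[symmetric] using H l unfolding hadamard_triple_def by blast
  then have "(\<Sum>d\<in>D. ue (of_int (d * (l - l')) / of_int p)) / of_nat (card D) = (if l = l' then 1 else 0)"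
    by (simp add: sum_divide_distrib)
  then show ?thesis using N by (simp add: field_simps split: if_splits)
qed

lemma hadamard_columns:
  assumes H: "hadamard_triple p D L" and d: "d \<in> D" "d' \<in> D"
  shows "(\<Sum>l\<in>L. ue (of_int ((d - d') * l) / of_int p)) = (if d = d' then of_nat (card D) else 0)"
proof (cases "d = d'")
  case True
  with H show ?thesis by (simp add: hadamard_triple_def)
next
  case False
  define S where "S x = (\<Sum>l\<in>L. ue (of_int ((x - d') * l) / of_int p))" for x
  have finD: "finite D" and finL: "finite L" and NL: "card L = card D" using H by (auto simp: hadamard_triple_def)
  \<comment> \<open>All entries are unimodular, so the entry x = d' already exhausts the sum over x of the squared moduli of S.\<close>
  have "(\<Sum>x\<in>D. complex_of_real ((cmod (S x))\<^sup>2)) = (\<Sum>x\<in>D. \<Sum>l\<in>L. \<Sum>l'\<in>L. ue (of_int ((x - d') * (l - l')) / of_int p))"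
    by (intro sum.cong refl)
       (simp add: S_def complex_norm_square sum_product ue_diff right_diff_distrib diff_divide_distrib del: of_real_power)
  also have "\<dots> = (\<Sum>l\<in>L. \<Sum>l'\<in>L. \<Sum>x\<in>D. ue (of_int ((x - d') * (l - l')) / of_int p))"
    by (subst sum.swap) (intro sum.cong refl sum.swap)
  also have "\<dots> = (\<Sum>l\<in>L. \<Sum>l'\<in>L. cnj (ue (of_int (d' * (l - l')) / of_int p)) * (\<Sum>x\<in>D. ue (of_int (x * (l - l')) / of_int p)))"
  proof (intro sum.cong refl, subst sum_distrib_left, intro sum.cong refl)
    fix l l' x
    have "of_int ((x - d') * (l - l')) / real_of_int p = of_int (x * (l - l')) / of_int p - of_int (d' * (l - l')) / of_int p"
      by (simp add: algebra_simps flip: diff_divide_distrib)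
    then show "ue (of_int ((x - d') * (l - l')) / of_int p) = cnj (ue (of_int (d' * (l - l')) / of_int p)) * ue (of_int (x * (l - l')) / of_int p)"
      by (simp only: ue_diff mult.commute)
  qed
  also have "\<dots> = (\<Sum>l\<in>L. \<Sum>l'\<in>L. if l = l' then of_nat (card D) else 0)"
    by (intro sum.cong refl) (subst hadamard_rows[OF H], assumption, assumption, simp)
  also have "\<dots> = of_nat (card D) ^ 2" using finL NL by (simp add: power2_eq_square)
  also have "\<dots> = complex_of_real ((cmod (S d'))\<^sup>2)" by (simp add: S_def NL)
  finally have "(\<Sum>x\<in>D. (cmod (S x))\<^sup>2) = (cmod (S d'))\<^sup>2"
    unfolding of_real_sum[symmetric] of_real_eq_iff .
  then have "(\<Sum>x\<in>D - {d'}. (cmod (S x))\<^sup>2) = 0"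
    using finD d by (simp add: sum.remove[of D d'])
  then have "S d = 0" using finD d False by (simp add: sum_nonneg_eq_0_iff)
  then show ?thesis using False by (simp add: S_def)
qed

text \<open>Congruent digits give identical columns, whose inner product is the number of rows and
  not the 0 that column orthogonality demands. Together with p = card D this makes D a complete
  residue system.\<close>

lemma hadamard_inj_mod:
  assumes H: "hadamard_triple p D L"
  shows "inj_on (\<lambda>d. d mod p) D"
proof (rule inj_onI, rule ccontr)
  fix d d' assume d: "d \<in> D" "d' \<in> D" "d mod p = d' mod p" "d \<noteq> d'"
  then obtain k where k: "d - d' = p * k" by (metis mod_eq_dvd_iff dvdE)
  have p: "p > 1" using H by (simp add: hadamard_triple_def)
  have "(\<Sum>l\<in>L. ue (of_int ((d - d') * l) / of_int p)) = of_nat (card L)"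
  proof -
    have "ue (of_int ((d - d') * l) / of_int p) = 1" for l
      using p ue_of_int[of "k * l"] by (simp add: k del: ue_of_int)
    then show ?thesis by simp
  qed
  then have "card L = 0" using hadamard_columns[OF H d(1,2)] d by simp
  then show False using H d by (metis card_0_eq empty_iff hadamard_triple_def)
qed

text \<open>Integer frequencies suffice: the tails from level N on have all integers as a spectrum,
  and the passage to l + p a preserves integrality.\<close>

definition exp_orthogonal :: "real measure \<Rightarrow> int set \<Rightarrow> bool" where
  "exp_orthogonal M \<Lambda> \<longleftrightarrow> (\<forall>a\<in>\<Lambda>. \<forall>b\<in>\<Lambda>. a \<noteq> b \<longrightarrow> (LINT x|M. ue (of_int (a - b) * x)) = 0)"

text \<open>Completeness is tested on integrable functions, a class that is preserved when passing from one tail to the next.\<close>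
definition exp_complete :: "real measure \<Rightarrow> int set \<Rightarrow> bool" where
  "exp_complete M \<Lambda> \<longleftrightarrow> (\<forall>f. integrable M f \<longrightarrow> (\<forall>a\<in>\<Lambda>. (LINT x|M. f x * ue (- (of_int a * x))) = 0) \<longrightarrow> (AE x in M. f x = 0))"

text \<open>On a probability space square integrability implies integrability, so completeness
  tested on integrable functions covers L^2.\<close>

lemma spectral_measureI:
  assumes "real_distribution M" "exp_orthogonal M \<Lambda>" "exp_complete M \<Lambda>"
  shows "spectral_measure M"
proof -
  interpret real_distribution M by fact
  have e: "exp (2 * complex_of_real pi * \<i> * (complex_of_real a * complex_of_real x)) = ue (a * x)" for a x
    using exp_eq_ue[of "a * x"] by simp
  have "AE x in M. f x = 0"
    if f: "f \<in> borel_measurable M" "integrable M (\<lambda>x. (cmod (f x))\<^sup>2)"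
      and 0: "\<forall>a\<in>real_of_int ` \<Lambda>. (LINT x|M. f x * cnj (ue (a * x))) = 0" for f
  proof -
    have "integrable M (\<lambda>x. norm (f x))"
      by (rule square_integrable_imp_integrable) (use f in auto)
    then have "integrable M f" using f by (simp add: integrable_norm_iff)
    then show ?thesis using assms(3) 0 by (simp add: exp_complete_def ue_minus)
  qed
  moreover have "(LINT x|M. ue (a * x) * cnj (ue (b * x))) = 0"
    if "a \<in> real_of_int ` \<Lambda>" "b \<in> real_of_int ` \<Lambda>" "a \<noteq> b" for a b
    using that assms(2) by (auto simp: exp_orthogonal_def left_diff_distrib ue_diff)
  ultimately show ?thesis
    unfolding spectral_measure_def by (intro exI[of _ "real_of_int ` \<Lambda>"]) (simp add: e)
qed

context digit_system
begin

lemma integrable_mult_ue: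
  assumes "integrable (tail n) f"
  shows "integrable (tail n) (\<lambda>x. f x * ue (a * x))"
  by (rule Bochner_Integration.integrable_bound[OF assms])
     (use assms in \<open>auto simp: norm_mult integrable_iff_bounded\<close>)

lemma integrable_ue: "integrable (tail n) (\<lambda>x. ue (a * x))"
proof -
  interpret real_distribution "tail n" by (rule real_distribution_tail)
  show ?thesis using integrable_mult_ue[of n "\<lambda>_. 1"] by simp
qed

lemma integral_tail_ue:
  "(LINT x|tail n. ue (a * x)) = (\<Sum>d\<in>D (Suc n). ue (a * of_int d / of_int (p (Suc n))))
     / of_nat (card (D (Suc n))) * (LINT y|tail (Suc n). ue (a / of_int (p (Suc n)) * y))"
proof -
  have "(LINT x|tail n. ue (a * x)) = (\<Sum>d\<in>D (Suc n). LINT y|tail (Suc n). ue (a * of_int d / of_int (p (Suc n))) * ue (a / of_int (p (Suc n)) * y)) /\<^sub>R card (D (Suc n))"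
    by (subst integral_tail[OF integrable_ue]) (simp add: add_divide_distrib ring_distribs ue_add)
  also have "\<dots> = (\<Sum>d\<in>D (Suc n). ue (a * of_int d / of_int (p (Suc n))))
     / of_nat (card (D (Suc n))) * (LINT y|tail (Suc n). ue (a / of_int (p (Suc n)) * y))"
    by (simp add: sum_distrib_right[symmetric] scaleR_conv_of_real divide_inverse mult_ac)
  finally show ?thesis .
qed

lemma AE_tailI:
  fixes f :: "real \<Rightarrow> complex"
  assumes f [measurable]: "f \<in> borel_measurable borel"
    and 0: "\<And>d. d \<in> D (Suc n) \<Longrightarrow> AE y in tail (Suc n). f ((of_int d + y) / of_int (p (Suc n))) = 0"
  shows "AE x in tail n. f x = 0"
proof -
  have "(\<integral>\<^sup>+y. norm (f ((of_int d + y) / of_int (p (Suc n)))) \<partial>tail (Suc n)) = 0" if "d \<in> D (Suc n)" for d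
    using 0[OF that] by (subst nn_integral_0_iff_AE) auto
  then have "(\<integral>\<^sup>+x. norm (f x) \<partial>tail n) = 0"
    by (subst nn_integral_tail) simp_all
  then show ?thesis by (subst (asm) nn_integral_0_iff_AE) auto
qed

text \<open>At the point (d + y) / p the exponential of frequency l + p a equals e(l (d + y) / p)
  e(a y), because a d is an integer. Hence the digits see only l: orthogonality splits into the two
  known ones, and completeness becomes, at almost every y, a linear system with the Hadamard
  matrix.\<close>

lemma spectrum_step:
  assumes H: "hadamard_triple (p (Suc n)) (D (Suc n)) L"
    and orth: "exp_orthogonal (tail (Suc n)) \<Lambda>" and compl: "exp_complete (tail (Suc n)) \<Lambda>"
  defines "\<Lambda>' \<equiv> {l + p (Suc n) * a | l a. l \<in> L \<and> a \<in> \<Lambda>}"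
  shows "exp_orthogonal (tail n) \<Lambda>'" and "exp_complete (tail n) \<Lambda>'"
proof -
  let ?p = "p (Suc n)" and ?D = "D (Suc n)"
  have p0: "real_of_int ?p \<noteq> 0" using p_ge[of "Suc n"] by simp
  show "exp_orthogonal (tail n) \<Lambda>'"
    unfolding exp_orthogonal_def
  proof (intro ballI impI)
    fix b b' assume b: "b \<in> \<Lambda>'" "b' \<in> \<Lambda>'" "b \<noteq> b'"
    obtain l a l' a' where la: "l \<in> L" "a \<in> \<Lambda>" "b = l + ?p * a" "l' \<in> L" "a' \<in> \<Lambda>" "b' = l' + ?p * a'"
      using b unfolding \<Lambda>'_def by auto
    have "(\<Sum>d\<in>?D. ue (of_int (b - b') * of_int d / of_int ?p)) = (\<Sum>d\<in>?D. ue (of_int (d * (l - l')) / of_int ?p))"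
    proof (rule sum.cong[OF refl])
      fix d
      have "of_int (b - b') * of_int d / of_int ?p = of_int (d * (l - l')) / real_of_int ?p + of_int (d * (a - a'))"
        using p0 by (simp add: la field_simps)
      then show "ue (of_int (b - b') * of_int d / of_int ?p) = ue (of_int (d * (l - l')) / of_int ?p)"
        by (simp only: ue_add ue_of_int mult_1_right)
    qed
    also have "\<dots> = (if l = l' then of_nat (card ?D) else 0)" by (rule hadamard_rows[OF H la(1,4)])
    finally have S: "(\<Sum>d\<in>?D. ue (of_int (b - b') * of_int d / of_int ?p)) = (if l = l' then of_nat (card ?D) else 0)" .
    show "(LINT x|tail n. ue (of_int (b - b') * x)) = 0"
    proof (cases "l = l'")
      case True
      then have "of_int (b - b') / real_of_int ?p = of_int (a - a')" using p0 by (simp add: la field_simps)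
      moreover have "a \<noteq> a'" using True b la by auto
      ultimately show ?thesis
        using orth la by (subst integral_tail_ue) (simp add: exp_orthogonal_def)
    qed (subst integral_tail_ue, use S in simp)
  qed
  show "exp_complete (tail n) \<Lambda>'"
    unfolding exp_complete_def
  proof (intro allI impI)
    fix f assume f: "integrable (tail n) f" and 0: "\<forall>b\<in>\<Lambda>'. (LINT x|tail n. f x * ue (- (of_int b * x))) = 0"
    define g where "g d y = f ((of_int d + y) / of_int ?p)" for d y
    have g: "integrable (tail (Suc n)) (g d)" if "d \<in> ?D" for d
      unfolding g_def[abs_def] by (rule integrable_tail[OF f that])
    have gu: "integrable (tail (Suc n)) (\<lambda>y. g d y * ue (- (of_int l * (of_int d + y) / of_int ?p)))" if "d \<in> ?D" for d l
    proof -
      have "integrable (tail (Suc n)) (\<lambda>y. g d y * ue ((- of_int l / of_int ?p) * y) * ue (- (of_int l * of_int d / of_int ?p)))"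
        by (intro integrable_mult_left integrable_mult_ue g that)
      then show ?thesis
        by (simp add: add_divide_distrib ring_distribs ue_add mult_ac ue_diff ue_minus)
    qed
    \<comment> \<open>For fixed l the coefficients of f at l + p a, with a in \<Lambda>, are up to
      the factor 1 / card the coefficients of one function of y; completeness of \<Lambda> makes it
      vanish.\<close>
    have "AE y in tail (Suc n). (\<Sum>d\<in>?D. g d y * ue (- (of_int l * (of_int d + y) / of_int ?p))) = 0" if l: "l \<in> L" for l
    proof -
      let ?G = "\<lambda>y. \<Sum>d\<in>?D. g d y * ue (- (of_int l * (of_int d + y) / of_int ?p))"
      have "integrable (tail (Suc n)) ?G" by (intro Bochner_Integration.integrable_sum gu)
      moreover have "(LINT y|tail (Suc n). ?G y * ue (- (of_int a * y))) = 0" if a: "a \<in> \<Lambda>" for a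
      proof -
        let ?b = "l + ?p * a"
        have i: "integrable (tail (Suc n)) (\<lambda>y. g d y * ue (- (of_int l * (of_int d + y) / of_int ?p)) * ue (- (of_int a * y)))"
          if "d \<in> ?D" for d
          using integrable_mult_ue[OF gu[OF that, of l], of "- of_int a"] by simp
        have "ue (- (of_int ?b * ((of_int d + y) / of_int ?p))) = ue (- (of_int l * (of_int d + y) / of_int ?p)) * ue (- (of_int a * y))" for d y
        proof -
          have "- (of_int ?b * ((of_int d + y) / of_int ?p)) = - (of_int l * (of_int d + y) / of_int ?p) + - (of_int a * y) + of_int (- (a * d))"
            using p0 by (simp add: field_simps)
          then show ?thesis by (simp only: ue_add ue_of_int mult_1_right)
        qed
        then have u: "f ((of_int d + y) / of_int ?p) * ue (- (of_int ?b * ((of_int d + y) / of_int ?p)))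
            = g d y * ue (- (of_int l * (of_int d + y) / of_int ?p)) * ue (- (of_int a * y))" for d y
          by (simp only: g_def mult.assoc)
        have "integrable (tail n) (\<lambda>x. f x * ue (- (of_int ?b * x)))"
          using integrable_mult_ue[OF f, of "- of_int ?b"] by (simp only: minus_mult_left)
        then have "(LINT x|tail n. f x * ue (- (of_int ?b * x))) =
           (\<Sum>d\<in>?D. LINT y|tail (Suc n). g d y * ue (- (of_int l * (of_int d + y) / of_int ?p)) * ue (- (of_int a * y))) /\<^sub>R card ?D"
          by (subst integral_tail) (assumption, simp only: u)
        also have "\<dots> = (LINT y|tail (Suc n). ?G y * ue (- (of_int a * y))) /\<^sub>R card ?D"
          by (subst Bochner_Integration.integral_sum[symmetric, OF i]) (simp_all add: sum_distrib_right)
        finally have "(LINT y|tail (Suc n). ?G y * ue (- (of_int a * y))) /\<^sub>R card ?D = (LINT x|tail n. f x * ue (- (of_int ?b * x)))" ..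
        also have "\<dots> = 0"
        proof -
          have "?b \<in> \<Lambda>'" using l a by (auto simp: \<Lambda>'_def)
          with 0 show ?thesis by (rule bspec)
        qed
        finally show ?thesis using fin[of "Suc n"] ne[of "Suc n"] by simp
      qed
      ultimately show ?thesis using compl by (simp add: exp_complete_def)
    qed
    then have "AE y in tail (Suc n). \<forall>l\<in>L. (\<Sum>d\<in>?D. g d y * ue (- (of_int l * (of_int d + y) / of_int ?p))) = 0"
      using H by (intro AE_finite_allI) (auto simp: hadamard_triple_def)
    then have AE_g: "AE y in tail (Suc n). \<forall>d\<in>?D. g d y = 0"
    proof (eventually_elim, intro ballI)
      fix y d' assume y: "\<forall>l\<in>L. (\<Sum>d\<in>?D. g d y * ue (- (of_int l * (of_int d + y) / of_int ?p))) = 0" and d': "d' \<in> ?D"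
      \<comment> \<open>Pairing the system with column d' inverts the Hadamard matrix: only the term
        d = d' survives.\<close>
      have "0 = (\<Sum>l\<in>L. ue (of_int l * (of_int d' + y) / of_int ?p) * (\<Sum>d\<in>?D. g d y * ue (- (of_int l * (of_int d + y) / of_int ?p))))"
        using y by simp
      also have "\<dots> = (\<Sum>l\<in>L. \<Sum>d\<in>?D. g d y * ue (of_int ((d' - d) * l) / of_int ?p))"
      proof (intro sum.cong refl, subst sum_distrib_left, intro sum.cong refl)
        fix l d
        have "of_int ((d' - d) * l) / real_of_int ?p = of_int l * (of_int d' + y) / of_int ?p + - (of_int l * (of_int d + y) / of_int ?p)"
          by (simp add: algebra_simps add_divide_distrib diff_divide_distrib)
        then show "ue (of_int l * (of_int d' + y) / of_int ?p) * (g d y * ue (- (of_int l * (of_int d + y) / of_int ?p))) = g d y * ue (of_int ((d' - d) * l) / of_int ?p)"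
          by (simp only: ue_add mult_ac)
      qed
      also have "\<dots> = (\<Sum>d\<in>?D. g d y * (\<Sum>l\<in>L. ue (of_int ((d' - d) * l) / of_int ?p)))"
        by (subst sum.swap) (simp add: sum_distrib_left)
      also have "\<dots> = (\<Sum>d\<in>?D. if d' = d then g d y * of_nat (card ?D) else 0)"
        by (intro sum.cong refl) (subst hadamard_columns[OF H d'], assumption, simp)
      also have "\<dots> = g d' y * of_nat (card ?D)"
        using d' fin[of "Suc n"] by simp
      finally show "g d' y = 0" using fin[of "Suc n"] ne[of "Suc n"] by simp
    qed
    show "AE x in tail n. f x = 0"
    proof (rule AE_tailI)
      show "f \<in> borel_measurable borel" using f by (auto simp: integrable_iff_bounded)
      fix d assume "d \<in> ?D"
      then show "AE y in tail (Suc n). f ((of_int d + y) / of_int ?p) = 0"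
        using AE_g by (auto simp: g_def elim!: eventually_mono)
    qed
  qed
qed

text \<open>An affine bijection pulls Lebesgue null sets back to Lebesgue null sets, and
  \<open>tail n\<close> averages finitely many affine images of the next tail.\<close>

lemma absolutely_continuous_step:
  assumes "absolutely_continuous lborel (tail (Suc n))"
  shows "absolutely_continuous lborel (tail n)"
  unfolding absolutely_continuous_def
proof
  let ?p = "p (Suc n)"
  have p0: "real_of_int ?p > 0" using p_ge[of "Suc n"] by simp
  fix A :: "real set" assume A: "A \<in> null_sets lborel"
  then have [measurable]: "A \<in> sets borel" by auto
  have "(\<integral>\<^sup>+y. indicator A ((of_int d + y) / of_int ?p) \<partial>tail (Suc n)) = 0" for d
  proof -
    have ind: "indicator {y. (of_int d + y) / of_int ?p \<in> A} y = (indicator A ((of_int d + y) / of_int ?p) :: ennreal)" for y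
      by (simp add: indicator_def)
    have "emeasure lborel {y. (of_int d + y) / of_int ?p \<in> A} = (\<integral>\<^sup>+y. indicator {y. (of_int d + y) / of_int ?p \<in> A} y \<partial>lborel)"
      by (rule nn_integral_indicator[symmetric]) measurable
    also have "\<dots> = (\<integral>\<^sup>+y. indicator A (of_int d / of_int ?p + (1 / of_int ?p) * y) \<partial>lborel)"
      unfolding ind by (simp add: add_divide_distrib)
    also have "\<dots> = 0"
      using nn_integral_real_affine[of "indicator A" "1 / of_int ?p" "of_int d / of_int ?p"] p0 A
      by (simp add: null_sets_def)
    finally have "{y. (of_int d + y) / of_int ?p \<in> A} \<in> null_sets lborel" by (auto simp: null_sets_def)
    then have "emeasure (tail (Suc n)) {y. (of_int d + y) / of_int ?p \<in> A} = 0"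
      using assms by (auto simp: absolutely_continuous_def)
    moreover have "(\<integral>\<^sup>+y. indicator A ((of_int d + y) / of_int ?p) \<partial>tail (Suc n)) = emeasure (tail (Suc n)) {y. (of_int d + y) / of_int ?p \<in> A}"
      unfolding ind[symmetric] by (rule nn_integral_indicator) measurable
    ultimately show ?thesis by simp
  qed
  then have "(\<integral>\<^sup>+x. indicator A x \<partial>tail n) = 0" by (subst nn_integral_tail) simp_all
  then show "A \<in> null_sets (tail n)" by (auto simp: null_sets_def)
qed

end

section \<open>The weak limit of the finite convolutions\<close>

lemma char_convolution:
  assumes "real_distribution M" "real_distribution N"
  shows "char (convolution M N) t = char M t * char N t"
proof -
  interpret M: real_distribution M by fact
  interpret N: real_distribution N by fact
  interpret PS: pair_prob_space M N ..
  have [measurable_cong]: "sets M = sets borel" "sets N = sets borel" by simp_all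
  have int: "integrable (M \<Otimes>\<^sub>M N) (\<lambda>z. iexp (t * (fst z + snd z)))"
    by (rule PS.integrable_const_bound[where B=1]) simp_all
  have "char (convolution M N) t = (\<integral>z. iexp (t * (fst z + snd z)) \<partial>(M \<Otimes>\<^sub>M N))"
    unfolding char_def convolution_def by (subst integral_distr) (simp_all add: case_prod_unfold)
  also have "\<dots> = (\<integral>x. \<integral>y. iexp (t * x) * iexp (t * y) \<partial>N \<partial>M)"
    using PS.integral_fst'[OF int] by (simp add: ring_distribs exp_add)
  also have "\<dots> = char M t * char N t" by (simp add: char_def)
  finally show ?thesis .
qed

lemma real_distribution_convolution:
  assumes "real_distribution M" "real_distribution N"
  shows "real_distribution (convolution M N)"
proof -
  interpret M: real_distribution M by fact
  interpret N: real_distribution N by fact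
  interpret PS: pair_prob_space M N ..
  have [measurable_cong]: "sets M = sets borel" "sets N = sets borel" by simp_all
  show ?thesis unfolding convolution_def by (rule PS.real_distribution_distr) measurable
qed

lemma real_distribution_delta_set: "real_distribution (delta_set A)"
  unfolding delta_set_def by (rule prob_space.real_distribution_distr[OF prob_space_measure_pmf]) simp

lemma char_delta_set:
  assumes "finite A" "A \<noteq> {}"
  shows "char (delta_set A) t = (\<Sum>a\<in>A. cis (t * a)) / of_nat (card A)"
proof -
  have "char (delta_set A) t = (\<integral>a. cis (t * a) \<partial>measure_pmf (pmf_of_set A))"
    unfolding char_def delta_set_def by (subst integral_distr) (simp_all add: cis_conv_exp)
  also have "\<dots> = (\<Sum>a\<in>A. pmf (pmf_of_set A) a *\<^sub>R cis (t * a))"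
    by (rule integral_measure_pmf) (use assms in auto)
  also have "\<dots> = (\<Sum>a\<in>A. cis (t * a)) / of_nat (card A)"
    using assms by (simp add: sum_divide_distrib scaleR_conv_of_real)
  finally show ?thesis .
qed

lemma real_distribution_return: "real_distribution (return borel (a::real))"
  using prob_space_return[of a borel] by (auto simp: real_distribution_def real_distribution_axioms_def)

lemma real_distribution_moran_partial: "real_distribution (moran_partial p D n)"
  by (induction n) (auto intro: real_distribution_return real_distribution_convolution real_distribution_delta_set)

context digit_system
begin

lemma char_tail_eq: "char (tail n) t = (LINT x|tail n. ue (t / (2 * pi) * x))"
  unfolding char_def ue_def by (simp add: cis_conv_exp)

text \<open>Iterates the one-digit formula. The last factor belongs to the contracted remainder of
  the infinite convolution, so weak convergence only needs its argument to tend to 0.\<close>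

lemma char_tail_0:
  "char (tail 0) t = char (moran_partial p D n) t * char (tail n) (t / (\<Prod>k=1..n. of_int (p k)))"
proof (induction n)
  case 0
  show ?case by (simp add: char_def integral_return)
next
  case (Suc n)
  let ?P = "\<Prod>k=1..n. real_of_int (p k)" and ?D = "D (Suc n)"
  define Q where "Q = (\<Prod>k=1..Suc n. real_of_int (p k))"
  have "0 < Q"
    using less_le_trans[OF _ prod_p_ge[of "Suc n" 0], of 0] unfolding Q_def by (simp only: One_nat_def add_0) simp
  \<comment> \<open>\<open>delta_set\<close> gives equal weights to the points of an image set, so
    these weights match those of the digits only if distinct digits give distinct points.\<close>
  then have inj: "inj_on (\<lambda>d. real_of_int d / Q) ?D" by (auto simp: inj_on_def)
  have Q: "Q = ?P * of_int (p (Suc n))" by (simp add: Q_def)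
  have "char (tail n) (t / ?P) = (\<Sum>d\<in>?D. ue (t / ?P / (2 * pi) * of_int d / of_int (p (Suc n)))) / of_nat (card ?D) *
     char (tail (Suc n)) (t / Q)"
    unfolding char_tail_eq Q by (subst integral_tail_ue) (simp add: mult_ac)
  also have "(\<Sum>d\<in>?D. ue (t / ?P / (2 * pi) * of_int d / of_int (p (Suc n)))) / of_nat (card ?D)
     = (\<Sum>d\<in>?D. cis (t * (of_int d / Q))) / of_nat (card ?D)"
    unfolding Q ue_def by (simp add: mult_ac)
  also have "\<dots> = char (delta_set ((\<lambda>d. real_of_int d / Q) ` ?D)) t"
    using fin[of "Suc n"] ne[of "Suc n"]
    by (subst char_delta_set) (simp_all add: sum.reindex[OF inj] card_image[OF inj])
  finally show ?case
    unfolding moran_partial.simps Q_def[symmetric]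
    by (simp add: Suc.IH char_convolution real_distribution_moran_partial real_distribution_delta_set)
qed

text \<open>Uniform in n because all tails live on [0, 2C]; the contracted remainders can therefore
  be compared with the point mass at 0.\<close>

lemma norm_char_tail: "cmod (char (tail n) s - 1) \<le> \<bar>s\<bar> * (2 * C)"
proof -
  interpret real_distribution "tail n" by (rule real_distribution_tail)
  have b: "AE x in tail n. cmod (iexp (s * x) - 1) \<le> \<bar>s\<bar> * (2 * C)"
    using AE_tail_bounds[of n]
  proof eventually_elim
    fix x assume x: "0 \<le> x \<and> x \<le> 2 * C"
    have "cmod (iexp (s * x) - 1) \<le> \<bar>s * x\<bar>" using iexp_approx1[of "s * x" 0] by simp
    also have "\<dots> \<le> \<bar>s\<bar> * (2 * C)" using x by (auto simp: abs_mult intro!: mult_left_mono)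
    finally show "cmod (iexp (s * x) - 1) \<le> \<bar>s\<bar> * (2 * C)" .
  qed
  have i: "integrable (tail n) (\<lambda>x. iexp (s * x))"
    by (rule integrable_const_bound[where B=1]) simp_all
  have "char (tail n) s - 1 = (\<integral>x. iexp (s * x) - 1 \<partial>tail n)"
    unfolding char_def using i by (subst Bochner_Integration.integral_diff) (simp_all add: prob_space[simplified])
  also have "cmod \<dots> \<le> (\<integral>x. cmod (iexp (s * x) - 1) \<partial>tail n)" by (rule integral_norm_bound)
  also have "\<dots> \<le> \<bar>s\<bar> * (2 * C)"
    by (rule integral_le_const[OF _ b]) (use i in auto)
  finally show ?thesis .
qed

lemma weak_conv_moran_tail: "weak_conv_m (moran_partial p D) (tail 0)"
proof (rule levy_continuity)
  fix t
  let ?P = "\<lambda>n. \<Prod>k=1..n. real_of_int (p k)"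
  have lim: "(\<lambda>n. \<bar>t\<bar> * (2 * C) * (1/2) ^ n) \<longlonglongrightarrow> \<bar>t\<bar> * (2 * C) * 0"
    by (intro tendsto_mult tendsto_const LIMSEQ_power_zero) simp
  have le: "cmod (char (moran_partial p D n) t - char (tail 0) t) \<le> \<bar>t\<bar> * (2 * C) * (1/2) ^ n" for n
  proof -
    interpret Mn: real_distribution "moran_partial p D n" by (rule real_distribution_moran_partial)
    have P: "?P n \<ge> 2 ^ n" using prod_p_ge[of n 0] by (simp only: One_nat_def add_0)
    have Ppos: "?P n > 0" by (rule less_le_trans[OF _ P]) simp
    have "cmod (char (moran_partial p D n) t - char (tail 0) t) = cmod (char (moran_partial p D n) t) * cmod (char (tail n) (t / ?P n) - 1)"
      unfolding char_tail_0[of t n] norm_mult[symmetric] by (subst norm_minus_commute) (simp add: algebra_simps)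
    also have "\<dots> \<le> 1 * (\<bar>t / ?P n\<bar> * (2 * C))"
      by (intro mult_mono Mn.cmod_char_le_1 norm_char_tail) auto
    also have "\<dots> = \<bar>t\<bar> * (2 * C) * (1 / ?P n)" using Ppos by (simp add: abs_divide)
    also have "\<dots> \<le> \<bar>t\<bar> * (2 * C) * (1/2) ^ n"
      using P C_nonneg Ppos by (intro mult_left_mono) (auto simp: power_divide intro!: divide_left_mono)
    finally show ?thesis .
  qed
  have "(\<lambda>n. char (moran_partial p D n) t - char (tail 0) t) \<longlonglongrightarrow> 0"
    by (rule Lim_null_comparison[OF always_eventually lim[simplified mult_zero_right]]) (simp add: le)
  then show "(\<lambda>n. char (moran_partial p D n) t) \<longlonglongrightarrow> char (tail 0) t" by (rule LIM_zero_cancel)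
qed (rule real_distribution_moran_partial real_distribution_tail)+

lemma weak_limit_unique:
  assumes \<mu>: "real_distribution \<mu>" and w: "weak_conv_m (moran_partial p D) \<mu>"
  shows "\<mu> = tail 0"
proof (rule Levy_uniqueness[OF \<mu> real_distribution_tail])
  show "char \<mu> = char (tail 0)"
  proof
    fix t
    show "char \<mu> t = char (tail 0) t"
      by (rule LIMSEQ_unique[OF levy_continuity1[OF real_distribution_moran_partial \<mu> w]
            levy_continuity1[OF real_distribution_moran_partial real_distribution_tail weak_conv_moran_tail]])
  qed
qed

end

section \<open>Measures on the circle are determined by their Fourier coefficients\<close>

inductive trig_poly :: "(real \<Rightarrow> complex) \<Rightarrow> bool" where
  monomial: "trig_poly (\<lambda>x. c * ue (of_int k * x))"
| add: "trig_poly f \<Longrightarrow> trig_poly g \<Longrightarrow> trig_poly (\<lambda>x. f x + g x)"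

lemma trig_poly_mult:
  assumes "trig_poly f" "trig_poly g" shows "trig_poly (\<lambda>x. f x * g x)"
  using assms(1)
proof induction
  case (monomial c k)
  show ?case using assms(2)
  proof induction
    case (monomial d j)
    have "(\<lambda>x. c * ue (of_int k * x) * (d * ue (of_int j * x))) = (\<lambda>x. (c * d) * ue (of_int (k + j) * x))"
      by (simp add: ring_distribs ue_add mult_ac)
    then show ?case by (simp only: trig_poly.monomial)
  next
    case (add f g)
    from trig_poly.add[OF add.IH] show ?case by (simp only: distrib_left)
  qed
next
  case (add f g)
  from trig_poly.add[OF add.IH] show ?case by (simp only: distrib_right)
qed

text \<open>The real and imaginary parts of \<open>ue x\<close> are combinations of
  \<open>ue x\<close> and \<open>ue (- x)\<close>, and trigonometric polynomials form an algebra.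
  This makes Fourier coefficients accessible to the real Stone-Weierstrass theorem.\<close>

lemma trig_poly_real_polynomial:
  "real_polynomial_function g \<Longrightarrow> trig_poly (\<lambda>x. complex_of_real (g (ue x)))"
proof (induction rule: real_polynomial_function.induct)
  case (linear g)
  then interpret bounded_linear g .
  have "complex_of_real (g (ue x)) = (of_real (g 1) - \<i> * of_real (g \<i>)) / 2 * ue (of_int 1 * x) + (of_real (g 1) + \<i> * of_real (g \<i>)) / 2 * ue (of_int (-1) * x)" for x
  proof -
    have "ue x = Re (ue x) *\<^sub>R 1 + Im (ue x) *\<^sub>R \<i>" by (simp add: complex_eq_iff)
    then have "g (ue x) = g (Re (ue x) *\<^sub>R 1 + Im (ue x) *\<^sub>R \<i>)" by simp
    also have "\<dots> = Re (ue x) * g 1 + Im (ue x) * g \<i>" unfolding add scaleR by simp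
    finally show ?thesis by (simp add: complex_eq_iff ue_minus field_simps)
  qed
  then show ?case by (simp only: trig_poly.intros)
next
  case (const c)
  show ?case using trig_poly.monomial[of "of_real c" 0] by simp
next
  case (add f g)
  from trig_poly.add[OF add.IH] show ?case by simp
next
  case (mult f g)
  from trig_poly_mult[OF mult.IH] show ?case by simp
qed

lemma trig_poly_integral_eq:
  assumes fin: "finite_measure m" "finite_measure m'" and sets [measurable_cong]: "sets m = sets borel" "sets m' = sets borel"
    and eq: "\<And>k::int. (LINT x|m. ue (of_int k * x)) = (LINT x|m'. ue (of_int k * x))" and f: "trig_poly f"
  shows "integrable m f \<and> integrable m' f \<and> (LINT x|m. f x) = (LINT x|m'. f x)"
  using f
proof induction
  case (monomial c k)
  interpret m: finite_measure m by fact
  interpret m': finite_measure m' by fact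
  have "integrable m (\<lambda>x. c * ue (of_int k * x))"
    by (rule m.integrable_const_bound[where B="norm c"]) (simp_all add: norm_mult)
  moreover have "integrable m' (\<lambda>x. c * ue (of_int k * x))"
    by (rule m'.integrable_const_bound[where B="norm c"]) (simp_all add: norm_mult)
  ultimately show ?case by (simp add: eq)
qed auto

lemma integral_circle_eq:
  fixes F :: "complex \<Rightarrow> real"
  assumes fin: "finite_measure m" "finite_measure m'" and sets [measurable_cong]: "sets m = sets borel" "sets m' = sets borel"
    and eq: "\<And>k::int. (LINT x|m. ue (of_int k * x)) = (LINT x|m'. ue (of_int k * x))"
    and F: "continuous_on UNIV F"
  shows "(LINT x|m. F (ue x)) = (LINT x|m'. F (ue x))"
proof -
  interpret m: finite_measure m by fact
  interpret m': finite_measure m' by fact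
  have [measurable]: "F \<in> borel_measurable borel" by (rule borel_measurable_continuous_onI[OF F])
  let ?S = "sphere (0::complex) 1"
  have "compact (F ` ?S)" by (intro compact_continuous_image continuous_on_subset[OF F]) auto
  then obtain K where "\<forall>y\<in>F ` ?S. norm y \<le> K" using compact_imp_bounded bounded_iff by metis
  then have K: "\<bar>F z\<bar> \<le> K" if "z \<in> ?S" for z using that by auto
  have iF: "integrable m (\<lambda>x. F (ue x))"
    by (rule m.integrable_const_bound[where B=K]) (auto intro!: K)
  have iF': "integrable m' (\<lambda>x. F (ue x))"
    by (rule m'.integrable_const_bound[where B=K]) (auto intro!: K)
  have "\<bar>(LINT x|m. F (ue x)) - (LINT x|m'. F (ue x))\<bar> \<le> 0 + e" if e: "e > 0" for e
  proof -
    define S where "S = measure m (space m) + measure m' (space m')"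
    have S: "S \<ge> 0" by (simp add: S_def)
    \<comment> \<open>The added 1 keeps the quotient meaningful when both measures vanish.\<close>
    define \<delta> where "\<delta> = e / (S + 1)"
    have \<delta>: "\<delta> > 0" "\<delta> * S \<le> e"
      using e S by (simp_all add: \<delta>_def field_simps)
    obtain g where g: "real_polynomial_function g" "\<And>z. z \<in> ?S \<Longrightarrow> \<bar>F z - g z\<bar> < \<delta>"
      using Stone_Weierstrass_real_polynomial_function[of ?S F \<delta>] F \<delta> continuous_on_subset by (metis compact_sphere subset_UNIV)
    note T = trig_poly_integral_eq[OF fin sets eq trig_poly_real_polynomial[OF g(1)]]
    have ig: "integrable m (\<lambda>x. g (ue x))" "integrable m' (\<lambda>x. g (ue x))"
      using T by (auto dest: Bochner_Integration.integrable_Re)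
    have eqg: "(LINT x|m. g (ue x)) = (LINT x|m'. g (ue x))"
      using T by (auto simp: integral_complex_of_real)
    have "\<bar>LINT x|m. F (ue x) - g (ue x)\<bar> \<le> (LINT x|m. \<delta>)"
      by (rule order_trans[OF integral_abs_bound integral_mono])
         (use iF ig g(2) in \<open>auto intro!: less_imp_le\<close>)
    moreover have "\<bar>LINT x|m'. F (ue x) - g (ue x)\<bar> \<le> (LINT x|m'. \<delta>)"
      by (rule order_trans[OF integral_abs_bound integral_mono])
         (use iF' ig g(2) in \<open>auto intro!: less_imp_le\<close>)
    moreover have "(LINT x|m. F (ue x)) - (LINT x|m'. F (ue x)) = (LINT x|m. F (ue x) - g (ue x)) - (LINT x|m'. F (ue x) - g (ue x))"
      using iF iF' ig by (simp add: eqg)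
    ultimately have "\<bar>(LINT x|m. F (ue x)) - (LINT x|m'. F (ue x))\<bar> \<le> \<delta> * S"
      by (simp add: S_def ring_distribs mult.commute)
    also have "\<dots> \<le> 0 + e" using \<delta>(2) by simp
    finally show ?thesis .
  qed
  then have "\<bar>(LINT x|m. F (ue x)) - (LINT x|m'. F (ue x))\<bar> \<le> 0" by (rule field_le_epsilon)
  then show ?thesis by simp
qed

text \<open>The continuous functions \<open>F n\<close> decrease to the indicator of C, by
  closedness. The empty set is excluded because \<open>infdist\<close> to it is 0, which would make
  \<open>F n\<close> constantly 1.\<close>

lemma measure_circle_closed_eq:
  assumes fin: "finite_measure m" "finite_measure m'" and sets [measurable_cong]: "sets m = sets borel" "sets m' = sets borel"
    and eq: "\<And>k::int. (LINT x|m. ue (of_int k * x)) = (LINT x|m'. ue (of_int k * x))"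
    and C: "closed C" "C \<noteq> {}"
  shows "emeasure m {x. ue x \<in> C} = emeasure m' {x. ue x \<in> C}"
proof -
  define F where "F n z = max 0 (1 - real n * infdist z C)" for n z
  have cont: "continuous_on UNIV (F n)" for n
    unfolding F_def by (intro continuous_intros)
  have [measurable]: "F n \<in> borel_measurable borel" for n by (rule borel_measurable_continuous_onI[OF cont])
  have [measurable]: "C \<in> sets borel" using C by simp
  have lim: "(\<lambda>n. F n z) \<longlonglongrightarrow> indicator C z" for z
  proof (cases "z \<in> C")
    case True
    then show ?thesis by (simp add: F_def)
  next
    case False
    then have pos: "infdist z C > 0" using C by (metis in_closed_iff_infdist_zero infdist_nonneg less_eq_real_def)
    obtain N where N: "real N * infdist z C > 1" using reals_Archimedean3[OF pos] by blast
    have "F n z = 0" if "n \<ge> N" for n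
    proof -
      have "real N * infdist z C \<le> real n * infdist z C" using that pos by (intro mult_right_mono) auto
      then show ?thesis using N by (simp add: F_def)
    qed
    then have "\<forall>\<^sub>F n in sequentially. F n z = indicator C z"
      using False by (auto simp: eventually_sequentially)
    then show ?thesis by (rule tendsto_eventually)
  qed
  have conv: "(\<lambda>n. LINT x|m. F n (ue x)) \<longlonglongrightarrow> measure m {x. ue x \<in> C}"
    if "finite_measure m" "sets m = sets borel" for m
  proof -
    interpret finite_measure m by fact
    note [measurable_cong] = that(2)
    have sp: "space m = UNIV" using sets_eq_imp_space_eq[OF that(2)] by simp
    have "(\<lambda>n. LINT x|m. F n (ue x)) \<longlonglongrightarrow> (LINT x|m. indicator C (ue x))"
      by (rule integral_dominated_convergence[where w="\<lambda>_. 1"])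
         (auto intro!: lim, auto simp: F_def infdist_nonneg)
    also have "(LINT x|m. indicator C (ue x)) = (LINT x|m. indicator {x. ue x \<in> C} x)"
      by (simp add: indicator_def)
    also have "\<dots> = measure m {x. ue x \<in> C}" by (simp add: sp)
    finally show ?thesis .
  qed
  have "(LINT x|m. F n (ue x)) = (LINT x|m'. F n (ue x))" for n
    by (rule integral_circle_eq[OF fin sets eq cont])
  with conv[OF fin(1) sets(1)] conv[OF fin(2) sets(2)]
  have "measure m {x. ue x \<in> C} = measure m' {x. ue x \<in> C}" by (simp add: LIMSEQ_unique)
  then show ?thesis using fin by (simp add: finite_measure.emeasure_eq_measure)
qed

lemma measurable_Arg2pi [measurable]: "Arg2pi \<in> borel_measurable borel"
  unfolding borel_measurable_iff_greater using open_Arg2pi2pi_gt by (auto intro: borel_open)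

lemma Arg2pi_ue: "Arg2pi (ue x) / (2 * pi) = frac x"
proof -
  have "ue x = ue (frac x)" by (rule ue_cong_Ints) (simp add: frac_def)
  also have "Arg2pi \<dots> = 2 * pi * frac x"
    using Arg2pi_unique[of 1 "2 * pi * frac x" "ue (frac x)"] frac_ge_0[of x] frac_lt_1[of x]
    by (simp add: ue_def cis_conv_exp)
  finally show ?thesis by simp
qed

lemma measurable_frac [measurable]: "frac \<in> borel_measurable (borel :: real measure)"
  unfolding frac_def[abs_def] by measurable

text \<open>Closed sets generate the Borel sets of the plane, so the images on the circle coincide;
  composing with the argument recovers \<open>frac\<close>.\<close>

theorem distr_frac_eq:
  assumes fin: "finite_measure m" "finite_measure m'" and sets [measurable_cong]: "sets m = sets borel" "sets m' = sets borel"
    and eq: "\<And>k::int. (LINT x|m. ue (of_int k * x)) = (LINT x|m'. ue (of_int k * x))"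
  shows "distr m borel frac = distr m' borel frac"
proof -
  have sp: "space m = UNIV" "space m' = UNIV" using sets[THEN sets_eq_imp_space_eq] by simp_all
  have "distr m borel ue = distr m' borel ue"
  proof (rule measure_eqI_generator_eq[where E="Collect closed" and \<Omega>=UNIV and A="\<lambda>_. UNIV"])
    fix X :: "complex set" assume "X \<in> Collect closed"
    then show "emeasure (distr m borel ue) X = emeasure (distr m' borel ue) X"
      using measure_circle_closed_eq[OF fin sets eq, of X]
      by (cases "X = {}") (simp_all add: emeasure_distr sp vimage_def)
  next
    show "emeasure (distr m borel ue) UNIV \<noteq> \<infinity>"
      using finite_measure.emeasure_finite[OF fin(1)] by (simp add: emeasure_distr sp)
  qed (auto simp: Int_stable_def borel_eq_closed)
  then have "distr (distr m borel ue) borel (\<lambda>z. Arg2pi z / (2 * pi)) = distr (distr m' borel ue) borel (\<lambda>z. Arg2pi z / (2 * pi))"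
    by simp
  then show ?thesis by (simp add: distr_distr comp_def Arg2pi_ue)
qed

text \<open>The positive and the negative part of Re G, used as densities, give two finite measures
  with the same Fourier coefficients, so their images under \<open>frac\<close> agree on A.\<close>

lemma integral_frac_eq_0:
  fixes G :: "real \<Rightarrow> complex"
  assumes sets [measurable_cong]: "sets m = sets borel" and G: "integrable m G"
    and 0: "\<And>k::int. (LINT x|m. G x * ue (of_int k * x)) = 0" and A: "A \<in> sets borel"
  shows "(LINT x|m. Re (G x) * indicator A (frac x)) = 0"
proof -
  define R where "R x = Re (G x)" for x
  have [measurable]: "G \<in> borel_measurable borel" using G sets by (auto simp: integrable_iff_bounded cong: measurable_cong_sets)
  have [measurable]: "R \<in> borel_measurable borel" by (simp add: R_def[abs_def])
  note [measurable] = A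
  have sp: "space m = UNIV" using sets[THEN sets_eq_imp_space_eq] by simp
  have iG: "integrable m (\<lambda>x. H x * ue (a * x))" if "integrable m H" for H and a :: real
    by (rule Bochner_Integration.integrable_bound[OF that]) (use that in \<open>auto simp: norm_mult\<close>)
  have iR: "integrable m R" unfolding R_def using G by simp
  \<comment> \<open>The coefficient of Re G at k combines that of G at k with the conjugate of that
    at -k; both vanish.\<close>
  have R0: "(LINT x|m. complex_of_real (R x) * ue (of_int k * x)) = 0" for k :: int
  proof -
    have "(LINT x|m. cnj (G x * ue (of_int (-k) * x))) = 0" using Bochner_Integration.integral_cnj[of m "\<lambda>x. G x * ue (of_int (-k) * x)"] 0[of "-k"] by simp
    then have c: "(LINT x|m. cnj (G x) * ue (of_int k * x)) = 0" by (simp add: ue_minus)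
    have "(LINT x|m. complex_of_real (R x) * ue (of_int k * x)) = (LINT x|m. (G x * ue (of_int k * x) + cnj (G x) * ue (of_int k * x)) / 2)"
      by (intro Bochner_Integration.integral_cong refl) (simp add: R_def distrib_right[symmetric] complex_add_cnj)
    also have "\<dots> = 0" using iG[OF G] iG[of "\<lambda>x. cnj (G x)"] G 0 c by simp
    finally show ?thesis .
  qed
  define P where "P x = max 0 (R x)" for x
  define N where "N x = max 0 (- R x)" for x
  have [measurable]: "P \<in> borel_measurable borel" "N \<in> borel_measurable borel" by (simp_all add: P_def[abs_def] N_def[abs_def])
  have PN: "R x = P x - N x" "P x \<ge> 0" "N x \<ge> 0" for x by (auto simp: P_def N_def)
  have iP: "integrable m P" "integrable m N" unfolding P_def N_def using iR by (auto intro: integrable_max)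
  have fin: "finite_measure (density m (\<lambda>x. ennreal (Q x)))" if "integrable m Q" "\<And>x. Q x \<ge> 0" "Q \<in> borel_measurable borel" for Q
  proof (rule finite_measureI)
    have [measurable]: "Q \<in> borel_measurable borel" by fact
    show "emeasure (density m (\<lambda>x. ennreal (Q x))) (space (density m (\<lambda>x. ennreal (Q x)))) \<noteq> \<infinity>"
      using that(1,2) by (simp add: emeasure_density sp nn_integral_eq_integral)
  qed
  have dens: "(LINT x|density m (\<lambda>x. ennreal (Q x)). ue (of_int k * x)) = (LINT x|m. complex_of_real (Q x) * ue (of_int k * x))"
    if "Q \<in> borel_measurable borel" "\<And>x. Q x \<ge> 0" for Q and k :: int
  proof -
    have [measurable]: "Q \<in> borel_measurable borel" by fact
    show ?thesis using that(2) by (subst integral_density) (simp_all add: scaleR_conv_of_real)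
  qed
  have "distr (density m P) borel frac = distr (density m N) borel frac"
  proof (rule distr_frac_eq)
    fix k :: int
    have "(LINT x|m. complex_of_real (P x) * ue (of_int k * x)) - (LINT x|m. complex_of_real (N x) * ue (of_int k * x)) = (LINT x|m. complex_of_real (R x) * ue (of_int k * x))"
      using iG[of "\<lambda>x. complex_of_real (P x)"] iG[of "\<lambda>x. complex_of_real (N x)"] iP
      by (subst Bochner_Integration.integral_diff[symmetric]) (simp_all add: PN(1) left_diff_distrib)
    then have "(LINT x|m. complex_of_real (P x) * ue (of_int k * x)) = (LINT x|m. complex_of_real (N x) * ue (of_int k * x))"
      unfolding R0 by simp
    then show "(LINT x|density m P. ue (of_int k * x)) = (LINT x|density m N. ue (of_int k * x))"
      by (simp add: dens PN)
  qed (use fin iP PN sets in auto)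
  then have "emeasure (distr (density m P) borel frac) A = emeasure (distr (density m N) borel frac) A" by simp
  moreover have "emeasure (distr (density m (\<lambda>x. ennreal (Q x))) borel frac) A = ennreal (LINT x|m. Q x * indicator A (frac x))"
    if Q: "Q \<in> borel_measurable borel" "\<And>x. Q x \<ge> 0" "integrable m Q" for Q
  proof -
    have [measurable]: "Q \<in> borel_measurable borel" by fact
    have "emeasure (distr (density m (\<lambda>x. ennreal (Q x))) borel frac) A = (\<integral>\<^sup>+x. ennreal (Q x) * indicator (frac -` A) x \<partial>m)"
      using measurable_sets_borel[OF measurable_frac A] sets by (simp add: emeasure_distr emeasure_density sp)
    also have "\<dots> = (\<integral>\<^sup>+x. ennreal (Q x * indicator A (frac x)) \<partial>m)"
      by (intro nn_integral_cong) (simp add: indicator_def)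
    also have "\<dots> = ennreal (LINT x|m. Q x * indicator A (frac x))"
      by (intro nn_integral_eq_integral Bochner_Integration.integrable_bound[OF Q(3)]) (auto simp: Q(2) indicator_def)
    finally show ?thesis .
  qed
  ultimately have "ennreal (LINT x|m. P x * indicator A (frac x)) = ennreal (LINT x|m. N x * indicator A (frac x))"
    using iP PN by simp
  then have "(LINT x|m. P x * indicator A (frac x)) = (LINT x|m. N x * indicator A (frac x))"
    by (subst (asm) ennreal_inj) (auto intro!: integral_nonneg_AE simp: PN)
  moreover have "integrable m (\<lambda>x. Q x * indicator A (frac x))" if "integrable m Q" for Q :: "real \<Rightarrow> real"
    by (rule Bochner_Integration.integrable_bound[OF that]) (use that in \<open>auto simp: indicator_def\<close>)
  ultimately have "(LINT x|m. P x * indicator A (frac x) - N x * indicator A (frac x)) = 0"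
    using iP by simp
  then show ?thesis by (simp add: R_def[symmetric] PN(1) left_diff_distrib)
qed

text \<open>On each interval [k, k + 1) the map \<open>frac\<close> is a translation, so the image
  is a countable union of translated Borel pieces.\<close>

lemma sets_frac_image:
  assumes [measurable]: "A \<in> sets borel" shows "frac ` A \<in> sets (borel :: real measure)"
proof -
  have "frac ` A = (\<Union>k::int. {x. x \<in> {0..<1} \<and> x + of_int k \<in> A})"
  proof (intro equalityI subsetI)
    fix y assume "y \<in> frac ` A"
    then obtain x where "x \<in> A" "y = frac x" by auto
    then show "y \<in> (\<Union>k::int. {x. x \<in> {0..<1} \<and> x + of_int k \<in> A})"
      by (auto intro!: exI[of _ "\<lfloor>x\<rfloor>"] simp: frac_lt_1) (simp add: frac_def)
  next
    fix y assume "y \<in> (\<Union>k::int. {x. x \<in> {0..<1} \<and> x + of_int k \<in> A})"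
    then obtain k :: int where "y \<in> {0..<1}" "y + of_int k \<in> A" by auto
    then show "y \<in> frac ` A" by (intro image_eqI[of _ _ "y + of_int k"]) (auto simp: frac_unique_iff)
  qed
  also have "\<dots> \<in> sets borel" by measurable
  finally show ?thesis .
qed

text \<open>Injectivity lets every Borel part of T be recognised from fractional parts alone, and
  integrals over such sets are what vanishing coefficients control. Applied to the part where Re G
  is positive, this leaves Re G \<le> 0 almost everywhere.\<close>

theorem exp_complete_of_inj_frac:
  assumes sets: "sets m = sets borel" and T [measurable]: "T \<in> sets borel" and AE: "AE x in m. x \<in> T" and inj: "inj_on frac T"
  shows "exp_complete m UNIV"
proof -
  note [measurable_cong] = sets
  have Re0: "AE x in m. Re (G x) \<le> 0"
    if G: "integrable m G" and 0: "\<And>k::int. (LINT x|m. G x * ue (of_int k * x)) = 0" for G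
  proof -
    have [measurable]: "G \<in> borel_measurable borel" using G sets by (auto simp: integrable_iff_bounded cong: measurable_cong_sets)
    define A where "A = {x\<in>T. Re (G x) > 0}"
    have [measurable]: "A \<in> sets borel" unfolding A_def by measurable
    have AE_eq: "AE x in m. Re (G x) * indicator (frac ` A) (frac x) = max 0 (Re (G x))"
      using AE
    proof eventually_elim
      fix x assume x: "x \<in> T"
      then have "frac x \<in> frac ` A \<longleftrightarrow> x \<in> A" using inj by (auto simp: A_def inj_on_def)
      then show "Re (G x) * indicator (frac ` A) (frac x) = max 0 (Re (G x))"
        using x by (auto simp: A_def indicator_def)
    qed
    have "(LINT x|m. max 0 (Re (G x))) = (LINT x|m. Re (G x) * indicator (frac ` A) (frac x))"
      using AE_eq sets_frac_image[of A] by (intro integral_cong_AE) auto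
    also have "\<dots> = 0" by (rule integral_frac_eq_0[OF sets G 0]) (simp add: sets_frac_image)
    finally have "AE x in m. max 0 (Re (G x)) = 0"
      using G by (subst (asm) integral_nonneg_eq_0_iff_AE) auto
    then show ?thesis by eventually_elim simp
  qed
  have "AE x in m. G x = 0" if G: "integrable m G" and 0: "\<And>k::int. (LINT x|m. G x * ue (- (of_int k * x))) = 0" for G
  proof -
    have 1: "(LINT x|m. G x * ue (of_int k * x)) = 0" for k :: int using 0[of "-k"] by simp
    have c: "AE x in m. Re (c * G x) \<le> 0" for c
      using G 1 by (intro Re0) (simp_all add: mult.assoc)
    \<comment> \<open>Rotation by the four fourth roots of unity bounds Re G and Im G from both
      sides.\<close>
    from c[of 1] c[of "-1"] c[of "\<i>"] c[of "-\<i>"] show ?thesis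
      by eventually_elim (simp add: complex_eq_iff)
  qed
  then show ?thesis by (simp add: exp_complete_def)
qed

section \<open>The transfer operator on carry laws\<close>

lemma ue_power: "ue x ^ n = ue (of_nat n * x)"
  by (induction n) (simp_all add: ue_add ring_distribs)

text \<open>The p points are the preimages of \<xi> under multiplication by p modulo 1. The sum is
  geometric, and its ratio is a p-th root of unity which equals 1 exactly when p divides m.\<close>

lemma sum_ue_residues:
  assumes p: "p > (0::int)"
  shows "(\<Sum>l\<in>{0..<p}. ue (of_int m * ((\<xi> + of_int l) / of_int p)))
    = (if p dvd m then of_int p * ue (of_int (m div p) * \<xi>) else 0)"
proof -
  define z where "z = ue (of_int m / of_int p)"
  have "(\<Sum>l\<in>{0..<p}. ue (of_int m * ((\<xi> + of_int l) / of_int p))) =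
     (\<Sum>l<nat p. ue (of_int m * \<xi> / of_int p) * z ^ l)"
  proof (rule sum.reindex_bij_witness[of _ int nat])
    fix l assume "l \<in> {0..<p}"
    then have "of_int m * \<xi> / of_int p + of_nat (nat l) * (of_int m / of_int p) = of_int m * ((\<xi> + of_int l) / of_int p)"
      by (simp add: field_simps)
    then show "ue (of_int m * \<xi> / of_int p) * z ^ nat l = ue (of_int m * ((\<xi> + of_int l) / of_int p))"
      by (simp only: z_def ue_power ue_add[symmetric])
  qed (use p in auto)
  also have "\<dots> = ue (of_int m * \<xi> / of_int p) * (\<Sum>l<nat p. z ^ l)" by (simp add: sum_distrib_left)
  also have "\<dots> = (if p dvd m then of_int p * ue (of_int (m div p) * \<xi>) else 0)"
  proof (cases "p dvd m")
    case True
    then obtain k where "m = p * k" by auto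
    with p show ?thesis by (simp add: z_def)
  next
    case False
    have "z \<noteq> 1"
    proof
      assume "z = 1"
      then obtain k where "of_int m / real_of_int p = of_int k" by (auto simp: z_def ue_eq_1_iff elim!: Ints_cases)
      then have "real_of_int m = of_int (p * k)" using p by (simp add: field_simps)
      then show False using False by (simp only: of_int_eq_iff) auto
    qed
    moreover have "z ^ nat p = 1" using p by (simp add: z_def ue_power)
    ultimately show ?thesis using False by (simp add: geometric_sum)
  qed
  finally show ?thesis .
qed

text \<open>The squared modulus of the Fourier transform of the uniform measure on D, provided card
  D = p, which \<open>residue_digits\<close> guarantees.\<close>

definition mask_sq :: "int \<Rightarrow> int set \<Rightarrow> real \<Rightarrow> real" where
  "mask_sq p D \<eta> = (cmod (\<Sum>d\<in>D. ue (of_int d * \<eta>)))\<^sup>2 / (of_int p)\<^sup>2"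

lemma mask_sq_nonneg: "mask_sq p D \<eta> \<ge> 0"
  by (simp add: mask_sq_def)

lemma of_real_mask_sq:
  "complex_of_real (mask_sq p D \<eta>) = (\<Sum>d\<in>D. \<Sum>d'\<in>D. ue (of_int (d - d') * \<eta>)) / of_int (p\<^sup>2)"
  unfolding mask_sq_def of_real_divide complex_norm_square
  by (simp add: sum_product ue_diff left_diff_distrib)

lemma cos_eq_Re_ue: "cos (2 * pi * of_int k * x) = Re (ue (of_int k * x))"
  by (simp add: ue_def mult_ac)

text \<open>The common bound B leaves only finitely many pairs (p, D), on which the pigeonhole
  arguments rest. The digit 0 fixes the phase of the mask: where its modulus is largest, all its
  terms equal 1.\<close>

definition residue_digits :: "int \<Rightarrow> int \<Rightarrow> int set \<Rightarrow> bool" where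
  "residue_digits B p D \<longleftrightarrow> 2 \<le> p \<and> p \<le> B \<and> 0 \<in> D \<and> D \<subseteq> {0..B} \<and> int (card D) = p \<and> inj_on (\<lambda>d. d mod p) D"

definition int_law :: "int \<Rightarrow> (int \<Rightarrow> real) \<Rightarrow> bool" where
  "int_law M v \<longleftrightarrow> (\<forall>k. v k \<ge> 0) \<and> (\<forall>k. \<bar>k\<bar> > M \<longrightarrow> v k = 0) \<and> (\<Sum>k\<in>{-M..M}. v k) = 1"

text \<open>If two sums of digits x and x' agree modulo 1, and their parts beyond the current digits d and d' differ by an integer j,
  then the sums differ by the integer k with p k = j + d' - d.\<close>
definition carry_step :: "int \<Rightarrow> int set \<Rightarrow> (int \<Rightarrow> real) \<Rightarrow> (int \<Rightarrow> real) \<Rightarrow> bool" where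
  "carry_step p D v v' \<longleftrightarrow> (\<forall>k. v k = (\<Sum>d\<in>D. \<Sum>d'\<in>D. v' (p * k + d - d')) / of_int p)"

text \<open>The real part of the Fourier transform of v. Real parts pass through the transfer
  identity because its weights are real.\<close>

definition cos_poly :: "int \<Rightarrow> (int \<Rightarrow> real) \<Rightarrow> real \<Rightarrow> real" where
  "cos_poly M v \<xi> = (\<Sum>k\<in>{-M..M}. v k * cos (2 * pi * of_int k * \<xi>))"

text \<open>Expanding \<open>mask_sq\<close> gives exponentials of frequency d' - d + j. Averaging
  over the p preimages keeps the frequencies p k, that is j = p k + d - d', and these terms are
  collected by \<open>carry_step\<close>.\<close>

lemma cos_poly_transfer:
  assumes D: "residue_digits B p D" and v: "int_law M v" and v': "int_law M v'" and st: "carry_step p D v v'"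
  shows "cos_poly M v \<xi> = (\<Sum>l\<in>{0..<p}. mask_sq p D ((\<xi> + of_int l) / of_int p) * cos_poly M v' ((\<xi> + of_int l) / of_int p))"
proof -
  have p: "p > 0" and finD: "finite D" using D by (auto simp: residue_digits_def intro: finite_subset)
  let ?I = "{-M..M}"
  let ?\<eta> = "\<lambda>l. (\<xi> + of_int l) / of_int p"
  define G where "G v \<xi> = (\<Sum>k\<in>?I. complex_of_real (v k) * ue (of_int k * \<xi>))" for v \<xi>
  have ReG: "Re (G v \<xi>) = cos_poly M v \<xi>" for v \<xi>
    by (simp add: G_def cos_poly_def cos_eq_Re_ue)
  have nonneg: "v' j \<ge> 0" for j using v' by (simp add: int_law_def)
  \<comment> \<open>The terms of \<open>carry_step\<close> are nonnegative with sum 0 when k is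
    outside the window, so each of them vanishes and the later reindexing loses nothing.\<close>
  have z: "v' (p * k + d - d') = 0" if "\<bar>k\<bar> > M" "d \<in> D" "d' \<in> D" for k d d'
  proof -
    have "(\<Sum>d\<in>D. \<Sum>d'\<in>D. v' (p * k + d - d')) = 0"
      using that(1) v st p unfolding int_law_def carry_step_def by (metis divide_eq_0_iff of_int_eq_0_iff less_irrefl)
    then have "(\<Sum>d'\<in>D. v' (p * k + d - d')) = 0"
      using that finD by (subst (asm) sum_nonneg_eq_0_iff) (auto intro: sum_nonneg nonneg)
    then show ?thesis
      using that finD by (subst (asm) sum_nonneg_eq_0_iff) (auto intro: nonneg)
  qed
  have inner: "(\<Sum>j\<in>?I. complex_of_real (v' j) * (if p dvd (d' - d + j) then of_int p * ue (of_int ((d' - d + j) div p) * \<xi>) else 0))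
     = of_int p * (\<Sum>k\<in>?I. complex_of_real (v' (p * k + d - d')) * ue (of_int k * \<xi>))" if "d \<in> D" "d' \<in> D" for d d'
  proof -
    let ?f = "\<lambda>j. complex_of_real (v' j) * (if p dvd (d' - d + j) then of_int p * ue (of_int ((d' - d + j) div p) * \<xi>) else 0)"
    let ?h = "\<lambda>k. of_int p * (complex_of_real (v' (p * k + d - d')) * ue (of_int k * \<xi>))"
    have "(\<Sum>j\<in>?I. ?f j) = (\<Sum>j\<in>{j\<in>?I. p dvd (d' - d + j) \<and> (d' - d + j) div p \<in> ?I}. ?f j)"
    proof (intro sum.mono_neutral_right ballI)
      fix j assume j: "j \<in> ?I - {j\<in>?I. p dvd (d' - d + j) \<and> (d' - d + j) div p \<in> ?I}"
      show "?f j = 0"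
      proof (cases "p dvd (d' - d + j)")
        case True
        with j have "\<bar>(d' - d + j) div p\<bar> > M" by auto
        from z[OF this that] True have "v' j = 0" by simp
        then show ?thesis by simp
      qed simp
    qed auto
    also have "\<dots> = (\<Sum>k\<in>{k\<in>?I. p * k + d - d' \<in> ?I}. ?h k)"
      by (rule sum.reindex_bij_witness[of _ "\<lambda>k. p * k + d - d'" "\<lambda>j. (d' - d + j) div p"]) (use p in auto)
    also have "\<dots> = (\<Sum>k\<in>?I. ?h k)"
    proof (intro sum.mono_neutral_left ballI)
      fix k assume "k \<in> ?I - {k\<in>?I. p * k + d - d' \<in> ?I}"
      then have "v' (p * k + d - d') = 0" using v' by (auto simp: int_law_def)
      then show "?h k = 0" by simp
    qed auto
    finally have "(\<Sum>j\<in>?I. ?f j) = (\<Sum>k\<in>?I. ?h k)" .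
    then show ?thesis by (simp add: sum_distrib_left)
  qed
  have "(\<Sum>l\<in>{0..<p}. complex_of_real (mask_sq p D (?\<eta> l)) * G v' (?\<eta> l))
    = (\<Sum>l\<in>{0..<p}. \<Sum>d\<in>D. \<Sum>d'\<in>D. \<Sum>j\<in>?I. complex_of_real (v' j) * ue (of_int (d' - d + j) * ?\<eta> l)) / of_int (p\<^sup>2)"
  proof -
    \<comment> \<open>Exchanging d and d' reverses the sign of the frequency, to match the sign
      convention of \<open>carry_step\<close>.\<close>
    have "complex_of_real (mask_sq p D \<eta>) = (\<Sum>d\<in>D. \<Sum>d'\<in>D. ue (of_int (d' - d) * \<eta>)) / of_int (p\<^sup>2)" for \<eta>
      unfolding of_real_mask_sq by (subst sum.swap) simp
    then have "complex_of_real (mask_sq p D \<eta>) * G v' \<eta> = (\<Sum>d\<in>D. \<Sum>d'\<in>D. \<Sum>j\<in>?I. complex_of_real (v' j) * ue (of_int (d' - d + j) * \<eta>)) / of_int (p\<^sup>2)" for \<eta>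
      by (simp add: G_def sum_distrib_left sum_distrib_right ring_distribs ue_add mult_ac sum_divide_distrib)
    then show ?thesis by (simp add: sum_divide_distrib)
  qed
  also have "(\<Sum>l\<in>{0..<p}. \<Sum>d\<in>D. \<Sum>d'\<in>D. \<Sum>j\<in>?I. complex_of_real (v' j) * ue (of_int (d' - d + j) * ?\<eta> l))
     = (\<Sum>d\<in>D. \<Sum>d'\<in>D. \<Sum>j\<in>?I. complex_of_real (v' j) * (\<Sum>l\<in>{0..<p}. ue (of_int (d' - d + j) * ?\<eta> l)))"
  proof -
    have "(\<Sum>l\<in>{0..<p}. \<Sum>d\<in>D. \<Sum>d'\<in>D. \<Sum>j\<in>?I. f l d d' j) = (\<Sum>d\<in>D. \<Sum>d'\<in>D. \<Sum>j\<in>?I. \<Sum>l\<in>{0..<p}. f l d d' j)" for f :: "int \<Rightarrow> int \<Rightarrow> int \<Rightarrow> int \<Rightarrow> complex"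
      by (subst sum.swap, rule sum.cong[OF refl], subst sum.swap, rule sum.cong[OF refl], rule sum.swap)
    then show ?thesis by (simp add: sum_distrib_left)
  qed
  also have "\<dots> = (\<Sum>d\<in>D. \<Sum>d'\<in>D. of_int p * (\<Sum>k\<in>?I. complex_of_real (v' (p * k + d - d')) * ue (of_int k * \<xi>)))"
    by (intro sum.cong refl) (simp only: sum_ue_residues[OF p] inner)
  also have "\<dots> = of_int p * (\<Sum>k\<in>?I. (\<Sum>d\<in>D. \<Sum>d'\<in>D. complex_of_real (v' (p * k + d - d'))) * ue (of_int k * \<xi>))"
  proof -
    have "(\<Sum>d\<in>D. \<Sum>d'\<in>D. \<Sum>k\<in>?I. f d d' k) = (\<Sum>k\<in>?I. \<Sum>d\<in>D. \<Sum>d'\<in>D. f d d' k)" for f :: "int \<Rightarrow> int \<Rightarrow> int \<Rightarrow> complex"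
      by (subst (2) sum.swap, rule sum.cong[OF refl], rule sum.swap)
    then show ?thesis by (simp add: sum_distrib_left sum_distrib_right)
  qed
  also have "\<dots> / of_int (p\<^sup>2) = G v \<xi>"
  proof -
    have "(\<Sum>d\<in>D. \<Sum>d'\<in>D. complex_of_real (v' (p * k + d - d'))) = of_int p * of_real (v k)" for k
    proof -
      have "v k = (\<Sum>d\<in>D. \<Sum>d'\<in>D. v' (p * k + d - d')) / of_int p" using st by (simp add: carry_step_def)
      then show ?thesis using p by simp
    qed
    then show ?thesis using p by (simp add: G_def sum_distrib_left sum_divide_distrib power2_eq_square)
  qed
  finally have "Re (G v \<xi>) = Re (\<Sum>l\<in>{0..<p}. complex_of_real (mask_sq p D (?\<eta> l)) * G v' (?\<eta> l))" by simp
  then show ?thesis by (simp add: ReG)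
qed

text \<open>The point mass at 0 is invariant under \<open>carry_step\<close>, since distinct digits
  are incongruent modulo p. Its cosine polynomial is constantly 1, so its transfer identity is this
  sum.\<close>

lemma sum_mask_sq:
  assumes D: "residue_digits B p D"
  shows "(\<Sum>l\<in>{0..<p}. mask_sq p D ((\<xi> + of_int l) / of_int p)) = 1"
proof -
  define v where "v k = (if k = (0::int) then 1 else 0 :: real)" for k
  have p: "p > 0" and finD: "finite D" using D by (auto simp: residue_digits_def intro: finite_subset)
  have law: "int_law 0 v" by (simp add: int_law_def v_def)
  have "v k = (\<Sum>d\<in>D. \<Sum>d'\<in>D. v (p * k + d - d')) / of_int p" for k
  proof -
    have "v (p * k + d - d') = (if d' = d then v k else 0)" if "d \<in> D" "d' \<in> D" for d d'
    proof (cases "d' = d")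
      case True
      then show ?thesis using p by (simp add: v_def)
    next
      case False
      then have "d' mod p \<noteq> d mod p" using D that by (auto simp: residue_digits_def inj_on_def)
      then have "p * k + d - d' \<noteq> 0" by (metis add.commute mod_mult_self2 eq_iff_diff_eq_0)
      then show ?thesis using False by (simp add: v_def)
    qed
    then have "(\<Sum>d\<in>D. \<Sum>d'\<in>D. v (p * k + d - d')) = (\<Sum>d\<in>D. \<Sum>d'\<in>D. if d' = d then v k else 0)"
      by (intro sum.cong refl)
    also have "\<dots> = of_int p * v k"
      using finD D by (simp add: residue_digits_def of_nat_eq_iff[symmetric])
    finally show ?thesis using p by simp
  qed
  then have "carry_step p D v v" unfolding carry_step_def by blast
  from cos_poly_transfer[OF D law law this, of \<xi>] show ?thesis
    by (simp add: cos_poly_def v_def)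
qed

text \<open>Equality in the triangle inequality: p unimodular numbers whose sum has modulus p
  coincide, and the digit 0 contributes 1. The proof pairs the terms of 0 and d, since |1 + z| < 2
  for unimodular z other than 1.\<close>

lemma mask_sq_eq_1:
  assumes D: "residue_digits B p D" and 1: "mask_sq p D \<eta> = 1" and d: "d \<in> D"
  shows "of_int d * \<eta> \<in> \<int>"
proof (rule ccontr)
  assume nI: "of_int d * \<eta> \<notin> \<int>"
  define z where "z = ue (of_int d * \<eta>)"
  have d0: "d \<noteq> 0" using nI by auto
  have finD: "finite D" and p: "p > 0" and card: "real (card D) = of_int p" and 0: "0 \<in> D"
    using D by (auto simp: residue_digits_def intro: finite_subset)
  have "(cmod (\<Sum>d\<in>D. ue (of_int d * \<eta>)))\<^sup>2 = (of_int p)\<^sup>2"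
    using 1 p by (simp add: mask_sq_def)
  then have "cmod (\<Sum>d\<in>D. ue (of_int d * \<eta>)) = of_int p" using p by (simp add: power2_eq_iff_nonneg)
  also have "(\<Sum>d\<in>D. ue (of_int d * \<eta>)) = (1 + z) + (\<Sum>d\<in>D - {0} - {d}. ue (of_int d * \<eta>))"
    using finD 0 d d0 by (simp add: sum.remove[of D 0] sum.remove[of "D - {0}" d] z_def)
  finally have "cmod ((1 + z) + (\<Sum>d\<in>D - {0} - {d}. ue (of_int d * \<eta>))) = of_int p" .
  moreover have "cmod (\<Sum>d\<in>D - {0} - {d}. ue (of_int d * \<eta>)) \<le> real (card (D - {0} - {d}))"
    using norm_sum[of "\<lambda>d. ue (of_int d * \<eta>)" "D - {0} - {d}"] by simp
  moreover have "real (card (D - {0} - {d})) = of_int p - 2"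
  proof -
    have "card D = Suc (card (D - {0}))" by (rule card.remove[OF finD 0])
    also have "card (D - {0}) = Suc (card (D - {0} - {d}))" using finD d d0 by (intro card.remove) auto
    finally show ?thesis using card by linarith
  qed
  moreover have "cmod (1 + z) < 2"
  proof -
    have "Re z \<noteq> 1"
    proof
      assume "Re z = 1"
      moreover have "(Re z)\<^sup>2 + (Im z)\<^sup>2 = 1" using norm_ue[of "of_int d * \<eta>"] by (simp add: z_def cmod_def)
      ultimately have "z = 1" by (simp add: complex_eq_iff)
      then show False using nI by (simp add: z_def ue_eq_1_iff)
    qed
    moreover have "Re z \<le> 1" using complex_Re_le_cmod[of z] by (simp add: z_def)
    ultimately have "Re z < 1" by simp
    moreover have "(cmod (1 + z))\<^sup>2 = 1 + 2 * Re z + ((Re z)\<^sup>2 + (Im z)\<^sup>2)"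
      unfolding cmod_power2 by (simp add: power2_eq_square algebra_simps)
    moreover have "(Re z)\<^sup>2 + (Im z)\<^sup>2 = 1" using norm_ue[of "of_int d * \<eta>"] by (simp add: z_def cmod_def)
    ultimately have "(cmod (1 + z))\<^sup>2 < 2\<^sup>2" by simp
    then show ?thesis by (rule power2_less_imp_less) simp
  qed
  ultimately show False using norm_triangle_ineq[of "1 + z" "\<Sum>d\<in>D - {0} - {d}. ue (of_int d * \<eta>)"] by linarith
qed

text \<open>As p \<ge> 2 there is a digit d with 0 < d \<le> B, and d divides B!. All points of full
  mask thus share one denominator.\<close>

lemma mask_sq_eq_1_fact:
  assumes D: "residue_digits B p D" and 1: "mask_sq p D \<eta> = 1"
  shows "fact (nat B) * \<eta> \<in> \<int>"
proof -
  have "D \<noteq> {0}" using D by (auto simp: residue_digits_def)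
  then obtain d where d: "d \<in> D" "d \<noteq> 0" using D by (auto simp: residue_digits_def)
  then have dB: "0 < d" "d \<le> B" using D by (auto simp: residue_digits_def)
  then have "nat d dvd fact (nat B)" by (intro dvd_fact) auto
  then obtain k where "fact (nat B) = nat d * k" by auto
  then have "real (fact (nat B)) = real (nat d * k)" by (rule arg_cong)
  then have "fact (nat B) * \<eta> = of_nat k * (of_int d * \<eta>)" using dB by simp
  also have "\<dots> \<in> \<int>" by (intro Ints_mult mask_sq_eq_1[OF D 1 d(1)]) simp
  finally show ?thesis .
qed

text \<open>Multiplied by \<open>2 * ue (of_int M * \<xi>)\<close>, the difference
  \<open>cos_poly M v \<xi> - \<alpha>\<close> becomes a polynomial in \<open>ue \<xi>\<close> of
  degree at most 2M. It is not the zero polynomial, because \<open>cos_poly\<close> takes the value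
  1 at 0.\<close>

lemma cos_poly_level_card:
  assumes v: "int_law M v" and M: "M \<ge> 0" and \<alpha>: "\<alpha> \<noteq> 1"
  shows "finite {\<xi>\<in>{0..<1}. cos_poly M v \<xi> = \<alpha>}" "card {\<xi>\<in>{0..<1}. cos_poly M v \<xi> = \<alpha>} \<le> 2 * nat M"
proof -
  let ?Z = "{\<xi>\<in>{0..<1}. cos_poly M v \<xi> = \<alpha>}"
  define q :: "complex poly" where
    "q = (\<Sum>k\<in>{-M..M}. smult (of_real (v k)) (monom 1 (nat (M + k)) + monom 1 (nat (M - k)))) - monom (2 * of_real \<alpha>) (nat M)"
  have pq: "poly q (ue \<xi>) = 2 * ue (of_int M * \<xi>) * of_real (cos_poly M v \<xi> - \<alpha>)" for \<xi>
  proof -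
    have "2 * ue (of_int M * \<xi>) * of_real (v k * cos (2 * pi * of_int k * \<xi>)) = of_real (v k) * (ue \<xi> ^ nat (M + k) + ue \<xi> ^ nat (M - k))"
      if "k \<in> {-M..M}" for k
    proof -
      have "complex_of_real (2 * cos (2 * pi * of_int k * \<xi>)) = ue (of_int k * \<xi>) + cnj (ue (of_int k * \<xi>))"
        unfolding cos_eq_Re_ue by (simp add: complex_add_cnj)
      then have "2 * ue (of_int M * \<xi>) * of_real (v k * cos (2 * pi * of_int k * \<xi>)) =
         of_real (v k) * (ue (of_int M * \<xi>) * (ue (of_int k * \<xi>) + cnj (ue (of_int k * \<xi>))))" by simp
      also have "ue (of_int M * \<xi>) * (ue (of_int k * \<xi>) + cnj (ue (of_int k * \<xi>))) = ue \<xi> ^ nat (M + k) + ue \<xi> ^ nat (M - k)"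
        using that unfolding ue_power by (simp add: ring_distribs ue_add ue_diff left_diff_distrib)
      finally show ?thesis .
    qed
    then have "2 * ue (of_int M * \<xi>) * of_real (cos_poly M v \<xi>) = (\<Sum>k\<in>{-M..M}. of_real (v k) * (ue \<xi> ^ nat (M + k) + ue \<xi> ^ nat (M - k)))"
      unfolding cos_poly_def of_real_sum sum_distrib_left by (intro sum.cong refl)
    moreover have "ue \<xi> ^ nat M = ue (of_int M * \<xi>)" using M by (simp add: ue_power)
    ultimately show ?thesis
      by (simp add: q_def poly_sum poly_monom right_diff_distrib)
  qed
  have cos1: "cos_poly M v 0 = 1" using v by (simp add: cos_poly_def int_law_def)
  have q0: "q \<noteq> 0"
  proof
    assume "q = 0"
    then have "complex_of_real (1 - \<alpha>) = 0" using pq[of 0] cos1 by simp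
    then show False using \<alpha> by simp
  qed
  have deg: "degree q \<le> 2 * nat M"
    unfolding q_def using M
    by (intro degree_diff_le degree_sum_le degree_add_le order_trans[OF degree_smult_le] order_trans[OF degree_monom_le]) auto
  have inj: "inj_on ue ?Z"
  proof (rule inj_onI)
    fix x y assume xy: "x \<in> ?Z" "y \<in> ?Z" "ue x = ue y"
    then have "ue (x - y) = 1" by (simp add: ue_diff ue_mult_cnj)
    then obtain k :: int where k: "x - y = of_int k" by (auto simp: ue_eq_1_iff elim!: Ints_cases)
    moreover have "\<bar>x - y\<bar> < 1" using xy by auto
    ultimately have "real_of_int \<bar>k\<bar> < of_int 1" by simp
    then have "k = 0" by (simp only: of_int_less_iff)
    with k show "x = y" by simp
  qed
  have sub: "ue ` ?Z \<subseteq> {z. poly q z = 0}" by (auto simp: pq)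
  have finq: "finite {z. poly q z = 0}" by (rule poly_roots_finite[OF q0])
  show "finite ?Z" using inj finite_subset[OF sub finq] by (rule finite_imageD[rotated])
  have "card ?Z = card (ue ` ?Z)" by (rule card_image[OF inj, symmetric])
  also have "\<dots> \<le> card {z. poly q z = 0}" by (rule card_mono[OF finq sub])
  also have "\<dots> \<le> degree q" by (rule card_poly_roots_bound[OF q0])
  finally show "card ?Z \<le> 2 * nat M" using deg by simp
qed

section \<open>Compactness and elementary properties of cosine polynomials\<close>

lemma common_convergent_subseq:
  fixes f :: "nat \<Rightarrow> 'k \<Rightarrow> real"
  assumes "finite A" "\<And>k. k \<in> A \<Longrightarrow> bounded (range (\<lambda>i. f i k))"
  shows "\<exists>r. strict_mono (r::nat \<Rightarrow> nat) \<and> (\<forall>k\<in>A. \<exists>l. (\<lambda>i. f (r i) k) \<longlonglongrightarrow> l)"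
  using assms
proof (induction A rule: finite_induct)
  case empty
  show ?case by (intro exI[of _ id]) (simp add: strict_mono_id)
next
  case (insert a A)
  then obtain r where r: "strict_mono (r::nat \<Rightarrow> nat)" "\<forall>k\<in>A. \<exists>l. (\<lambda>i. f (r i) k) \<longlonglongrightarrow> l" by auto
  have "bounded (range (\<lambda>i. f (r i) a))"
    by (rule bounded_subset[OF insert.prems[OF insertI1]]) auto
  then obtain l s where s: "strict_mono (s::nat \<Rightarrow> nat)" "((\<lambda>i. f (r i) a) \<circ> s) \<longlonglongrightarrow> l"
    using bounded_imp_convergent_subsequence by blast
  have "\<exists>l. (\<lambda>i. f (r (s i)) k) \<longlonglongrightarrow> l" if k: "k \<in> insert a A" for k
  proof (cases "k = a")
    case True
    then show ?thesis using s(2) by (auto simp: comp_def)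
  next
    case False
    then obtain l where "(\<lambda>i. f (r i) k) \<longlonglongrightarrow> l" using r k by auto
    then show ?thesis using LIMSEQ_subseq_LIMSEQ[OF _ s(1), of "\<lambda>i. f (r i) k"] by (auto simp: comp_def)
  qed
  then show ?case using strict_mono_o[OF r(1) s(1)] by (intro exI[of _ "r \<circ> s"]) (auto simp: comp_def)
qed

lemma pigeonhole_subseq:
  fixes f :: "nat \<Rightarrow> 'a"
  assumes "finite F" "\<And>i. f i \<in> F"
  shows "\<exists>r c. strict_mono (r::nat \<Rightarrow> nat) \<and> (\<forall>i. f (r i) = c)"
proof -
  have "finite (range f)" using assms by (meson finite_subset image_subsetI)
  then obtain a where "infinite {i\<in>UNIV. f i = f a}"
    using pigeonhole_infinite[of "UNIV :: nat set" f] by auto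
  from infinite_enumerate[OF this] show ?thesis by blast
qed

lemma continuous_cos_poly: "continuous_on S (cos_poly M v)"
  unfolding cos_poly_def[abs_def] by (intro continuous_intros)

lemma tendsto_cos_poly:
  assumes "\<And>k. (\<lambda>i. v i k) \<longlonglongrightarrow> w k" "x \<longlonglongrightarrow> \<xi>"
  shows "(\<lambda>i. cos_poly M (v i) (x i)) \<longlonglongrightarrow> cos_poly M w \<xi>"
  unfolding cos_poly_def by (intro tendsto_intros assms)

lemma cos_poly_Ints_diff:
  assumes "x - y \<in> \<int>" shows "cos_poly M v x = cos_poly M v y"
proof -
  obtain m :: int where m: "x = y + of_int m" using assms by (metis Ints_cases add.commute diff_add_cancel)
  have "ue (of_int k * x) = ue (of_int k * y)" for k :: int
  proof (rule ue_cong_Ints)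
    have "of_int k * x - of_int k * y = of_int (k * m)" by (simp add: m algebra_simps)
    then show "of_int k * x - of_int k * y \<in> \<int>" by (simp only: Ints_of_int)
  qed
  then show ?thesis by (simp add: cos_poly_def cos_eq_Re_ue)
qed

lemma cos_poly_bounds:
  assumes v: "int_law M v" shows "cos_poly M v \<xi> \<le> 1" "- 1 \<le> cos_poly M v \<xi>"
proof -
  have s: "(\<Sum>k\<in>{-M..M}. v k) = 1" and nn: "v k \<ge> 0" for k using v by (auto simp: int_law_def)
  have "cos_poly M v \<xi> \<le> (\<Sum>k\<in>{-M..M}. v k * 1)"
    unfolding cos_poly_def by (intro sum_mono mult_left_mono nn) simp
  then show "cos_poly M v \<xi> \<le> 1" by (simp add: s)
  have "(\<Sum>k\<in>{-M..M}. v k * (- 1)) \<le> cos_poly M v \<xi>"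
    unfolding cos_poly_def by (intro sum_mono mult_left_mono nn) simp
  then show "- 1 \<le> cos_poly M v \<xi>" by (simp add: s sum_negf)
qed

lemma cos_poly_0: "int_law M v \<Longrightarrow> cos_poly M v 0 = 1"
  by (simp add: cos_poly_def int_law_def)

lemma cos_poly_attains_min:
  "\<exists>\<xi>\<in>{0..<1}. \<forall>x. cos_poly M v \<xi> \<le> cos_poly M v x"
proof -
  obtain y where y: "y \<in> {0..1}" "\<forall>x\<in>{0..1}. cos_poly M v y \<le> cos_poly M v x"
    using continuous_attains_inf[of "{0..1::real}" "cos_poly M v"] continuous_cos_poly by auto
  have "cos_poly M v (frac y) \<le> cos_poly M v x" for x
  proof -
    have "cos_poly M v (frac y) = cos_poly M v y" by (rule cos_poly_Ints_diff) (simp add: frac_def)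
    also have "\<dots> \<le> cos_poly M v (frac x)" using y frac_lt_1[of x] by auto
    also have "\<dots> = cos_poly M v x" by (rule cos_poly_Ints_diff) (simp add: frac_def)
    finally show ?thesis .
  qed
  then show ?thesis by (intro bexI[of _ "frac y"]) (auto simp: frac_lt_1)
qed

text \<open>One point decides: at \<xi> = 1 / (2M + 1) every nonzero k of the window has cosine
  below 1, so an average of at least 1 leaves no mass there.\<close>

lemma int_law_dirac:
  assumes v: "int_law M v" and M: "M \<ge> 0" and 1: "\<And>\<xi>. cos_poly M v \<xi> \<ge> 1"
  shows "v k = (if k = 0 then 1 else 0)"
proof -
  have s: "(\<Sum>k\<in>{-M..M}. v k) = 1" and nn: "v k \<ge> 0" for k using v by (auto simp: int_law_def)
  define \<xi> :: real where "\<xi> = 1 / of_int (2 * M + 1)"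
  have "(\<Sum>k\<in>{-M..M}. v k * (1 - cos (2 * pi * of_int k * \<xi>))) \<le> 0"
    using 1[of \<xi>] s by (simp add: cos_poly_def right_diff_distrib sum_subtractf)
  moreover have t: "v k * (1 - cos (2 * pi * of_int k * \<xi>)) \<ge> 0" for k by (intro mult_nonneg_nonneg nn) simp
  ultimately have 0: "v k * (1 - cos (2 * pi * of_int k * \<xi>)) = 0" if "k \<in> {-M..M}" for k
    using that by (metis (no_types, lifting) finite_atLeastAtMost_int order_antisym sum_nonneg sum_nonneg_eq_0_iff)
  have z: "v k = 0" if "k \<noteq> 0" for k
  proof (cases "k \<in> {-M..M}")
    case True
    have "cos (2 * pi * of_int k * \<xi>) \<noteq> 1"
    proof
      assume "cos (2 * pi * of_int k * \<xi>) = 1"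
      then obtain m :: int where "2 * pi * of_int k * \<xi> = of_int m * 2 * pi" by (auto simp: cos_one_2pi_int)
      then have "of_int k * \<xi> = of_int m" by simp
      then have "real_of_int k = of_int (m * (2 * M + 1))" using M by (simp add: \<xi>_def field_simps)
      then have km: "k = m * (2 * M + 1)" by (simp only: of_int_eq_iff)
      then have "m \<noteq> 0" using that by auto
      then have "\<bar>m\<bar> * (2 * M + 1) \<ge> 1 * (2 * M + 1)" using M by (intro mult_right_mono) auto
      then have "\<bar>k\<bar> \<ge> 2 * M + 1" using km M by (simp add: abs_mult)
      then show False using True M by auto
    qed
    then show ?thesis using 0[OF True] by simp
  next
    case False
    then show ?thesis using v by (auto simp: int_law_def abs_le_iff)
  qed
  have "(\<Sum>k\<in>{-M..M}. v k) = (\<Sum>k\<in>{-M..M}. if k = 0 then v 0 else 0)" by (intro sum.cong refl) (simp add: z)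
  then have "v 0 = 1" using s M by simp
  then show ?thesis using z by simp
qed

lemma unique_preimage:
  fixes \<xi> \<xi>' :: real and l l' :: int
  assumes "(\<xi> + of_int l) / of_int p = (\<xi>' + of_int l') / of_int p" "p > (0::int)" "\<xi> \<in> {0..<1}" "\<xi>' \<in> {0..<1}"
  shows "\<xi> = \<xi>'" "l = l'"
proof -
  have e: "\<xi> - \<xi>' = of_int (l' - l)" using assms by (simp add: field_simps)
  have "\<bar>\<xi> - \<xi>'\<bar> < 1" using assms by auto
  then have "real_of_int \<bar>l' - l\<bar> < of_int 1" using e by simp
  then have "l' - l = 0" by (simp only: of_int_less_iff)
  then show "\<xi> = \<xi>'" "l = l'" using e by simp_all
qed

lemma preimage_in_unit:
  fixes \<xi> :: real and l :: int
  assumes "\<xi> \<in> {0..<1}" "l \<in> {0..<p}"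
  shows "(\<xi> + of_int l) / of_int p \<in> {0..<1}"
proof -
  have "real_of_int l + 1 \<le> of_int p" using assms(2) by auto
  then show ?thesis using assms by (auto simp: divide_simps)
qed

text \<open>Points of a minimum level set of v pull back, along every branch of positive mask, into the
  level set of v'; distinct points have disjoint sets of preimages. So if the level set of v' is not larger
  then each point has a single branch, which then carries the full mask.\<close>
lemma no_branching:
  assumes D: "residue_digits B p D" and v: "int_law M v" and v': "int_law M v'" and st: "carry_step p D v v'"
    and fin: "finite {\<xi>\<in>{0..<1}. cos_poly M v' \<xi> = \<alpha>}" and fin0: "finite {\<xi>\<in>{0..<1}. cos_poly M v \<xi> = \<alpha>}"
    and le: "card {\<xi>\<in>{0..<1}. cos_poly M v' \<xi> = \<alpha>} \<le> card {\<xi>\<in>{0..<1}. cos_poly M v \<xi> = \<alpha>}"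
    and min: "\<And>x. \<alpha> \<le> cos_poly M v' x" and \<xi>: "\<xi> \<in> {0..<1}" "cos_poly M v \<xi> = \<alpha>"
  shows "\<exists>l\<in>{0..<p}. mask_sq p D ((\<xi> + of_int l) / of_int p) = 1"
proof (rule ccontr)
  assume no: "\<not> ?thesis"
  let ?Z = "\<lambda>v. {\<xi>\<in>{0..<1}. cos_poly M v \<xi> = \<alpha>}"
  let ?W = "\<lambda>\<xi> l. mask_sq p D ((\<xi> + of_int l) / of_int p)"
  have p: "p > 0" using D by (simp add: residue_digits_def)
  have sum1: "(\<Sum>l\<in>{0..<p}. ?W x l) = 1" for x by (rule sum_mask_sq[OF D])
  have pull: "(x + of_int l) / of_int p \<in> ?Z v'" if x: "x \<in> ?Z v" and l: "l \<in> {0..<p}" "?W x l > 0" for x l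
  proof -
    have "(\<Sum>l\<in>{0..<p}. ?W x l * (cos_poly M v' ((x + of_int l) / of_int p) - \<alpha>)) = cos_poly M v x - \<alpha> * 1"
      unfolding cos_poly_transfer[OF D v v' st, of x] sum1[of x, symmetric]
      by (simp add: right_diff_distrib sum_subtractf sum_distrib_left mult.commute)
    then have "(\<Sum>l\<in>{0..<p}. ?W x l * (cos_poly M v' ((x + of_int l) / of_int p) - \<alpha>)) = 0" using x by simp
    then have "\<forall>l\<in>{0..<p}. ?W x l * (cos_poly M v' ((x + of_int l) / of_int p) - \<alpha>) = 0"
      by (subst (asm) sum_nonneg_eq_0_iff) (auto intro!: mult_nonneg_nonneg mask_sq_nonneg min)
    then have "?W x l * (cos_poly M v' ((x + of_int l) / of_int p) - \<alpha>) = 0" using l by blast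
    then have "cos_poly M v' ((x + of_int l) / of_int p) = \<alpha>" using l by simp
    moreover have "(x + of_int l) / of_int p \<in> {0..<1}" using x l by (intro preimage_in_unit) auto
    ultimately show ?thesis by simp
  qed
  have ex: "\<exists>l\<in>{0..<p}. ?W x l > 0" for x
  proof (rule ccontr)
    assume "\<not> ?thesis"
    then have "(\<Sum>l\<in>{0..<p}. ?W x l) = 0" by (intro sum.neutral) (auto simp: not_less intro: order_antisym mask_sq_nonneg)
    then show False using sum1[of x] by simp
  qed
  then obtain b where b: "\<And>x. b x \<in> {0..<p}" "\<And>x. ?W x (b x) > 0" by metis
  define f where "f x = (x + of_int (b x)) / of_int p" for x
  have inj: "inj_on f (?Z v)"
  proof (rule inj_onI)
    fix x y assume "x \<in> ?Z v" "y \<in> ?Z v" "f x = f y"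
    then show "x = y" using unique_preimage(1)[of x "b x" p y "b y"] p by (simp add: f_def)
  qed
  have "\<exists>l\<in>{0..<p}. l \<noteq> b \<xi> \<and> ?W \<xi> l > 0"
  proof (rule ccontr)
    assume "\<not> ?thesis"
    then have "(\<Sum>l\<in>{0..<p} - {b \<xi>}. ?W \<xi> l) = 0" by (intro sum.neutral) (auto simp: not_less intro: order_antisym mask_sq_nonneg)
    then have "?W \<xi> (b \<xi>) = 1" using sum1[of \<xi>] b(1)[of \<xi>] by (simp add: sum.remove[of _ "b \<xi>"])
    then show False using no b(1)[of \<xi>] by blast
  qed
  then obtain l where l: "l \<in> {0..<p}" "l \<noteq> b \<xi>" "?W \<xi> l > 0" by blast
  have new: "(\<xi> + of_int l) / of_int p \<notin> f ` ?Z v"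
  proof
    assume "(\<xi> + of_int l) / of_int p \<in> f ` ?Z v"
    then obtain x where x: "x \<in> ?Z v" "(\<xi> + of_int l) / of_int p = (x + of_int (b x)) / of_int p" by (auto simp: f_def)
    then show False using unique_preimage[OF x(2) p] \<xi> l by auto
  qed
  have "insert ((\<xi> + of_int l) / of_int p) (f ` ?Z v) \<subseteq> ?Z v'"
    using pull[OF _ l(1,3)] \<xi> pull[OF _ b] unfolding f_def by blast
  then have "card (insert ((\<xi> + of_int l) / of_int p) (f ` ?Z v)) \<le> card (?Z v')" by (rule card_mono[OF fin])
  moreover have "card (insert ((\<xi> + of_int l) / of_int p) (f ` ?Z v)) = Suc (card (?Z v))"
    using card_image[OF inj] new fin0 by simp
  ultimately show False using le by simp
qed

section \<open>The density of the tail measures\<close>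

definition unit_measure :: "real measure" where
  "unit_measure = density lborel (indicator {0..<1})"

lemma sets_unit_measure [simp, measurable_cong]: "sets unit_measure = sets borel"
  by (simp add: unit_measure_def)

lemma finite_measure_unit: "finite_measure unit_measure"
  by (rule finite_measureI) (simp add: unit_measure_def emeasure_density)

lemma integral_ue_unit: "(LINT x|unit_measure. ue (of_int k * x)) = (if k = 0 then 1 else 0)"
proof -
  have "(LINT x|unit_measure. ue (of_int k * x)) = (LINT x|lborel. indicator {0..<1} x *\<^sub>R ue (of_int k * x))"
    unfolding unit_measure_def by (subst integral_density[where g="indicator {0..<1}", symmetric]) (auto simp: ennreal_indicator)
  also have "\<dots> = (LINT x|lborel. indicator {0..1} x *\<^sub>R ue (of_int k * x))"
    using AE_lborel_singleton[of 1] by (intro integral_cong_AE) (auto simp: indicator_def elim!: eventually_mono)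
  also have "\<dots> = (if k = 0 then 1 else 0)"
  proof (cases "k = 0")
    case False
    define c where "c = 2 * pi * of_int k * \<i>"
    have c: "c \<noteq> 0" "ue (of_int k * x) = exp (c * of_real x)" for x
      using False by (simp_all add: c_def ue_def cis_conv_exp mult_ac)
    have "((\<lambda>x. exp (c * of_real x) / c) has_vector_derivative exp (c * of_real x)) (at x within {0..1})" for x
      using c(1) by (intro has_vector_derivative_real_field) (auto intro!: derivative_eq_intros)
    then have "(LINT x|lborel. indicator {0..1} x *\<^sub>R ue (of_int k * x)) = exp (c * of_real 1) / c - exp (c * of_real 0) / c"
      unfolding c(2) by (intro integral_FTC_Icc) (auto intro!: continuous_intros)
    also have "\<dots> = (ue (of_int k * 1) - ue (of_int k * 0)) / c"
      unfolding c(2) by (simp add: diff_divide_distrib)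
    finally have "(LINT x|lborel. indicator {0..1} x *\<^sub>R ue (of_int k * x)) = (ue (of_int k * 1) - ue (of_int k * 0)) / c" .
    then show ?thesis using False ue_of_int[of k] by simp
  qed simp
  finally show ?thesis .
qed

lemma residue_digits_image:
  assumes "residue_digits B p D" shows "bij_betw (\<lambda>d. d mod p) D {0..<p}"
proof -
  have "card ((\<lambda>d. d mod p) ` D) = card {0..<p}" using assms card_image by (fastforce simp: residue_digits_def)
  moreover have "(\<lambda>d. d mod p) ` D \<subseteq> {0..<p}" using assms by (auto simp: residue_digits_def)
  ultimately have "(\<lambda>d. d mod p) ` D = {0..<p}" by (intro card_subset_eq) auto
  then show ?thesis using assms by (auto simp: bij_betw_def residue_digits_def)
qed

text \<open>\<open>coprime_digits\<close> states the gcd condition by divisors: a common divisor of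
  all digits past level n is a unit. The tail of index n starts with digit \<open>Suc n\<close>,
  hence the shift in both assumptions.\<close>

locale residue_system = digit_system +
  fixes N :: nat and B :: int
  assumes residues: "n \<ge> N \<Longrightarrow> residue_digits B (p (Suc n)) (D (Suc n))"
    and coprime_digits: "n \<ge> N \<Longrightarrow> (\<And>j d. j > n \<Longrightarrow> d \<in> D j \<Longrightarrow> q dvd d) \<Longrightarrow> q dvd 1"
begin

text \<open>Induction on |k|. If p does not divide k, the mask vanishes because the digits run
  through all residues; otherwise the coefficient is a multiple of the one at k / p, which is closer
  to 0.\<close>

lemma integral_ue_tail:
  assumes "n \<ge> N" "k \<noteq> 0" shows "(LINT x|tail n. ue (of_int k * x)) = 0"
  using assms
proof (induction "nat \<bar>k\<bar>" arbitrary: n k rule: less_induct)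
  case less
  let ?p = "p (Suc n)" and ?D = "D (Suc n)"
  have R: "residue_digits B ?p ?D" using residues less.prems by simp
  then have p: "?p \<ge> 2" by (simp add: residue_digits_def)
  show ?case
  proof (cases "?p dvd k")
    case True
    then obtain j where j: "k = ?p * j" by auto
    have j0: "j \<noteq> 0" using j less.prems by auto
    have "\<bar>j\<bar> < \<bar>k\<bar>" using p j0 by (simp add: j abs_mult)
    then have "(LINT x|tail (Suc n). ue (of_int j * x)) = 0" using less j0 by (intro less.hyps) auto
    moreover have "of_int k / real_of_int ?p = of_int j" using p by (simp add: j)
    ultimately show ?thesis by (subst integral_tail_ue) simp
  next
    case False
    have "(\<Sum>d\<in>?D. ue (of_int k * of_int d / of_int ?p)) = (\<Sum>d\<in>?D. ue (of_int k * ((0 + of_int (d mod ?p)) / of_int ?p)))"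
    proof (intro sum.cong refl ue_cong_Ints)
      fix d
      have "real_of_int d = of_int (d mod ?p) + of_int ?p * of_int (d div ?p)"
        by (metis add.commute mult_div_mod_eq of_int_add of_int_mult)
      then have "of_int k * of_int d / of_int ?p - of_int k * ((0 + of_int (d mod ?p)) / of_int ?p) = real_of_int (k * (d div ?p))"
        using p by (simp add: field_simps)
      then show "of_int k * of_int d / of_int ?p - of_int k * ((0 + of_int (d mod ?p)) / of_int ?p) \<in> (\<int> :: real set)"
        by (simp only: Ints_of_int)
    qed
    also have "\<dots> = (\<Sum>l\<in>{0..<?p}. ue (of_int k * ((0 + of_int l) / of_int ?p)))"
      by (rule sum.reindex_bij_betw[OF residue_digits_image[OF R]])
    also have "\<dots> = 0" using False p by (subst sum_ue_residues) auto
    finally show ?thesis by (subst integral_tail_ue) simp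
  qed
qed

lemma exp_orthogonal_tail: "n \<ge> N \<Longrightarrow> exp_orthogonal (tail n) UNIV"
  using integral_ue_tail by (auto simp: exp_orthogonal_def simp del: of_int_diff)

lemma distr_frac_tail:
  assumes "n \<ge> N" shows "distr (tail n) borel frac = distr unit_measure borel frac"
proof (rule distr_frac_eq)
  interpret real_distribution "tail n" by (rule real_distribution_tail)
  show "finite_measure (tail n)" by (rule finite_measure_axioms)
  fix k :: int
  show "(LINT x|tail n. ue (of_int k * x)) = (LINT x|unit_measure. ue (of_int k * x))"
    using integral_ue_tail[OF assms, of k] prob_space by (simp add: integral_ue_unit)
qed (simp_all add: finite_measure_unit)

lemma nn_integral_periodic_tail:
  assumes "n \<ge> N" and [measurable]: "F \<in> borel_measurable borel" and per: "\<And>x. F (frac x) = F x"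
  shows "(\<integral>\<^sup>+x. F x \<partial>tail n) = (\<integral>\<^sup>+x. F x * indicator {0..<1} x \<partial>lborel)"
proof -
  have "(\<integral>\<^sup>+x. F x \<partial>tail n) = (\<integral>\<^sup>+x. F x \<partial>distr (tail n) borel frac)"
    by (simp add: nn_integral_distr per)
  also have "\<dots> = (\<integral>\<^sup>+x. F x \<partial>distr unit_measure borel frac)" by (simp add: distr_frac_tail[OF assms(1)])
  also have "\<dots> = (\<integral>\<^sup>+x. F x \<partial>unit_measure)"
    by (simp add: nn_integral_distr per)
  also have "\<dots> = (\<integral>\<^sup>+x. F x * indicator {0..<1} x \<partial>lborel)"
    by (simp add: unit_measure_def nn_integral_density mult.commute)
  finally show ?thesis .
qed

lemma nn_integral_translate:
  fixes f :: "real \<Rightarrow> ennreal"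
  assumes "f \<in> borel_measurable borel"
  shows "(\<integral>\<^sup>+x. f (x + a) \<partial>lborel) = (\<integral>\<^sup>+x. f x \<partial>lborel)"
  using nn_integral_real_affine[OF assms, of 1 a] by (simp add: add.commute)

text \<open>The intervals [k, k + 1) tile the line: after exchanging sum and integral, each x is
  counted once, at k = \<lfloor>x\<rfloor>.\<close>

lemma nn_integral_unit_periodize:
  fixes f :: "real \<Rightarrow> ennreal"
  assumes f [measurable]: "f \<in> borel_measurable borel"
  shows "(\<integral>\<^sup>+x. (\<integral>\<^sup>+k. f (x + of_int k) \<partial>count_space UNIV) * indicator {0..<1} x \<partial>lborel) = (\<integral>\<^sup>+x. f x \<partial>lborel)"
proof -
  have "(\<integral>\<^sup>+x. (\<integral>\<^sup>+k. f (x + of_int k) \<partial>count_space UNIV) * indicator {0..<1} x \<partial>lborel)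
     = (\<integral>\<^sup>+x. \<integral>\<^sup>+k. f (x + of_int k) * indicator {0..<1} x \<partial>count_space (UNIV :: int set) \<partial>lborel)"
    by (intro nn_integral_cong nn_integral_multc[symmetric]) simp
  also have "\<dots> = (\<integral>\<^sup>+k. \<integral>\<^sup>+x. f (x + of_int k) * indicator {0..<1} x \<partial>lborel \<partial>count_space (UNIV :: int set))"
    by (rule nn_integral_count_space_nn_integral) auto
  also have "\<dots> = (\<integral>\<^sup>+k. \<integral>\<^sup>+x. f x * indicator {0..<1} (x - of_int k) \<partial>lborel \<partial>count_space (UNIV :: int set))"
  proof (rule nn_integral_cong)
    fix k :: int
    show "(\<integral>\<^sup>+x. f (x + of_int k) * indicator {0..<1} x \<partial>lborel) = (\<integral>\<^sup>+x. f x * indicator {0..<1} (x - of_int k) \<partial>lborel)"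
      using nn_integral_translate[of "\<lambda>x. f x * indicator {0..<1} (x - of_int k)" "of_int k"] by simp
  qed
  also have "\<dots> = (\<integral>\<^sup>+x. \<integral>\<^sup>+k. f x * indicator {0..<1} (x - of_int k) \<partial>count_space (UNIV :: int set) \<partial>lborel)"
    by (rule nn_integral_count_space_nn_integral[symmetric]) auto
  also have "\<dots> = (\<integral>\<^sup>+x. f x \<partial>lborel)"
  proof (intro nn_integral_cong)
    fix x :: real
    have "x - of_int k \<in> {0..<1} \<longleftrightarrow> \<lfloor>x\<rfloor> = k" for k :: int
      unfolding floor_eq_iff by auto
    then have "(indicator {0..<1} (x - of_int k) :: ennreal) = indicator {\<lfloor>x\<rfloor>} k" for k :: int
      by (auto simp: indicator_def)
    then show "(\<integral>\<^sup>+k. f x * indicator {0..<1} (x - of_int k) \<partial>count_space (UNIV :: int set)) = f x"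
      by (simp add: nn_integral_cmult)
  qed
  finally show ?thesis .
qed

lemma measurable_periodization [measurable]:
  fixes f :: "real \<Rightarrow> ennreal"
  assumes [measurable]: "f \<in> borel_measurable borel"
  shows "(\<lambda>x. \<integral>\<^sup>+k. f (x + of_int k) \<partial>count_space (UNIV :: int set)) \<in> borel_measurable borel"
proof -
  interpret sigma_finite_measure "count_space (UNIV :: int set)" by (rule sigma_finite_measure_count_space)
  have "(\<lambda>(x, k :: int). f (x + of_int k)) \<in> borel_measurable (borel \<Otimes>\<^sub>M count_space UNIV)" by measurable
  then show ?thesis by (rule borel_measurable_nn_integral)
qed

lemma periodization_frac:
  fixes f :: "real \<Rightarrow> ennreal"
  shows "(\<integral>\<^sup>+k. f (frac x + of_int k) \<partial>count_space (UNIV :: int set)) = (\<integral>\<^sup>+k. f (x + of_int k) \<partial>count_space (UNIV :: int set))"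
proof -
  have "bij_betw (\<lambda>k. k - \<lfloor>x\<rfloor>) UNIV (UNIV :: int set)"
    by (rule bij_betwI[of _ _ _ "\<lambda>k. k + \<lfloor>x\<rfloor>"]) auto
  from nn_integral_bij_count_space[OF this, of "\<lambda>k. f (x + of_int k)"]
  show ?thesis by (simp add: frac_def algebra_simps)
qed

text \<open>Periodic functions see the tail as Lebesgue measure on the unit interval. With f an
  indicator this yields absolute continuity, with f the density it yields total overlap 1.\<close>

lemma nn_integral_periodized_tail:
  fixes f :: "real \<Rightarrow> ennreal"
  assumes "n \<ge> N" "f \<in> borel_measurable borel"
  shows "(\<integral>\<^sup>+x. \<integral>\<^sup>+k. f (x + of_int k) \<partial>count_space (UNIV :: int set) \<partial>tail n) = (\<integral>\<^sup>+x. f x \<partial>lborel)"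
  by (subst nn_integral_periodic_tail[OF assms(1)])
     (simp_all add: assms(2) measurable_periodization periodization_frac nn_integral_unit_periodize)

lemma absolutely_continuous_tail:
  assumes "n \<ge> N" shows "absolutely_continuous lborel (tail n)"
  unfolding absolutely_continuous_def
proof
  fix A :: "real set" assume A: "A \<in> null_sets lborel"
  then have [measurable]: "A \<in> sets borel" by auto
  have "emeasure (tail n) A = (\<integral>\<^sup>+x. indicator A x \<partial>tail n)" by simp
  also have "\<dots> \<le> (\<integral>\<^sup>+x. \<integral>\<^sup>+k. indicator A (x + of_int k) \<partial>count_space (UNIV :: int set) \<partial>tail n)"
  proof (intro nn_integral_mono)
    fix x
    show "indicator A x \<le> (\<integral>\<^sup>+k. indicator A (x + of_int k) \<partial>count_space (UNIV :: int set))"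
      using nn_integral_ge_point[of "0::int" UNIV "\<lambda>k. indicator A (x + of_int k)"] by simp
  qed
  also have "\<dots> = 0" using A by (subst nn_integral_periodized_tail[OF assms]) auto
  finally show "A \<in> null_sets (tail n)" by auto
qed

section \<open>Densities and their overlaps with integer translates\<close>

definition tail_density :: "nat \<Rightarrow> real \<Rightarrow> ennreal" where
  "tail_density n = RN_deriv lborel (tail n)"

lemma measurable_tail_density [measurable]: "tail_density n \<in> borel_measurable borel"
  unfolding tail_density_def using borel_measurable_RN_deriv[of lborel "tail n"] by simp

lemma density_tail_density: "n \<ge> N \<Longrightarrow> density lborel (tail_density n) = tail n"
  unfolding tail_density_def by (intro sigma_finite_measure.density_RN_deriv lborel.sigma_finite_measure_axioms absolutely_continuous_tail) simp_all

lemma nn_integral_tail_density: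
  assumes "n \<ge> N" "F \<in> borel_measurable borel"
  shows "(\<integral>\<^sup>+x. F x \<partial>tail n) = (\<integral>\<^sup>+x. tail_density n x * F x \<partial>lborel)"
  using assms by (subst density_tail_density[symmetric]) (simp_all add: nn_integral_density)

text \<open>Extended nonnegative values allow sums and integrals to be exchanged freely; that the
  products of densities are integrable follows only from \<open>sum_autocorr\<close>.\<close>

definition autocorr :: "nat \<Rightarrow> int \<Rightarrow> ennreal" where
  "autocorr n k = (\<integral>\<^sup>+x. tail_density n x * tail_density n (x + of_int k) \<partial>lborel)"

lemma sum_autocorr:
  assumes "n \<ge> N" shows "(\<integral>\<^sup>+k. autocorr n k \<partial>count_space UNIV) = 1"
proof -
  interpret real_distribution "tail n" by (rule real_distribution_tail)
  have "(\<integral>\<^sup>+k. autocorr n k \<partial>count_space UNIV) = (\<integral>\<^sup>+x. \<integral>\<^sup>+k. tail_density n x * tail_density n (x + of_int k) \<partial>count_space (UNIV :: int set) \<partial>lborel)"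
    unfolding autocorr_def by (rule nn_integral_count_space_nn_integral[symmetric]) auto
  also have "\<dots> = (\<integral>\<^sup>+x. tail_density n x * (\<integral>\<^sup>+k. tail_density n (x + of_int k) \<partial>count_space (UNIV :: int set)) \<partial>lborel)"
    by (simp add: nn_integral_cmult)
  also have "\<dots> = (\<integral>\<^sup>+x. \<integral>\<^sup>+k. tail_density n (x + of_int k) \<partial>count_space (UNIV :: int set) \<partial>tail n)"
    by (rule nn_integral_tail_density[OF assms, symmetric]) measurable
  also have "\<dots> = (\<integral>\<^sup>+x. tail_density n x \<partial>lborel)"
    by (rule nn_integral_periodized_tail[OF assms]) measurable
  also have "\<dots> = 1" using nn_integral_tail_density[OF assms, of "\<lambda>_. 1"] emeasure_space_1 by simp
  finally show ?thesis .
qed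

text \<open>Where both factors are positive, x and x + k lie in [0, 2C]. This gives a window for the
  carry laws that does not depend on n.\<close>

lemma autocorr_eq_0:
  assumes "n \<ge> N" "\<bar>real_of_int k\<bar> > 2 * C" shows "autocorr n k = 0"
proof -
  have "AE x in lborel. tail_density n x > 0 \<longrightarrow> 0 \<le> x \<and> x \<le> 2 * C"
    using AE_tail_bounds[of n] unfolding density_tail_density[OF assms(1), symmetric] by (subst (asm) AE_density) simp_all
  moreover from AE_borel_affine[OF _ _ this, of 1 "of_int k"]
  have "AE x in lborel. tail_density n (x + of_int k) > 0 \<longrightarrow> 0 \<le> x + of_int k \<and> x + of_int k \<le> 2 * C"
    by (simp add: add.commute)
  ultimately have "AE x in lborel. tail_density n x * tail_density n (x + of_int k) = 0"
  proof eventually_elim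
    case (elim x)
    then show ?case using assms(2) by (auto simp: zero_less_iff_neq_zero)
  qed
  then show ?thesis unfolding autocorr_def by (subst nn_integral_0_iff_AE) simp_all
qed

text \<open>The substitution y = p x - d produces a factor p, which cancels the weight 1 / card D =
  1 / p of a digit.\<close>

lemma tail_density_refine:
  assumes n: "n \<ge> N"
  shows "AE x in lborel. tail_density n x = (\<Sum>d\<in>D (Suc n). tail_density (Suc n) (of_int (p (Suc n)) * x - of_int d))"
proof (rule sigma_finite_measure.density_unique[OF lborel.sigma_finite_measure_axioms])
  let ?p = "p (Suc n)" and ?D = "D (Suc n)"
  have R: "residue_digits B ?p ?D" using residues n by simp
  then have p: "real_of_int ?p > 0" and c: "real (card ?D) = of_int ?p" by (auto simp: residue_digits_def)
  have "density lborel (\<lambda>x. \<Sum>d\<in>?D. tail_density (Suc n) (of_int ?p * x - of_int d)) = tail n"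
  proof (rule measure_eqI)
    fix A :: "real set" assume "A \<in> sets (density lborel (\<lambda>x. \<Sum>d\<in>?D. tail_density (Suc n) (of_int ?p * x - of_int d)))"
    then have [measurable]: "A \<in> sets borel" by simp
    have d: "(\<integral>\<^sup>+y. indicator A ((of_int d + y) / of_int ?p) \<partial>tail (Suc n)) =
        ennreal (of_int ?p) * (\<integral>\<^sup>+x. tail_density (Suc n) (of_int ?p * x - of_int d) * indicator A x \<partial>lborel)" for d
    proof -
      have "(\<integral>\<^sup>+y. indicator A ((of_int d + y) / of_int ?p) \<partial>tail (Suc n)) =
        (\<integral>\<^sup>+y. tail_density (Suc n) y * indicator A ((of_int d + y) / of_int ?p) \<partial>lborel)"
        using n by (intro nn_integral_tail_density) auto
      also have "\<dots> = ennreal (of_int ?p) * (\<integral>\<^sup>+x. tail_density (Suc n) (of_int ?p * x - of_int d) * indicator A x \<partial>lborel)"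
        using p by (subst nn_integral_real_affine[where c="of_int ?p" and t="- of_int d"]) (simp_all add: add.commute)
      finally show ?thesis .
    qed
    have "emeasure (tail n) A = (\<integral>\<^sup>+x. indicator A x \<partial>tail n)" by simp
    also have "\<dots> = ennreal (of_int ?p) * (\<Sum>d\<in>?D. \<integral>\<^sup>+x. tail_density (Suc n) (of_int ?p * x - of_int d) * indicator A x \<partial>lborel) / ennreal (of_int ?p)"
      by (subst nn_integral_tail) (simp_all add: d sum_distrib_left c)
    also have "\<dots> = (\<Sum>d\<in>?D. \<integral>\<^sup>+x. tail_density (Suc n) (of_int ?p * x - of_int d) * indicator A x \<partial>lborel)"
      using p by (subst mult.commute) (simp add: ennreal_mult_divide_eq)
    also have "\<dots> = (\<integral>\<^sup>+x. (\<Sum>d\<in>?D. tail_density (Suc n) (of_int ?p * x - of_int d)) * indicator A x \<partial>lborel)"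
      by (subst nn_integral_sum[symmetric]) (simp_all add: sum_distrib_right)
    finally show "emeasure (density lborel (\<lambda>x. \<Sum>d\<in>?D. tail_density (Suc n) (of_int ?p * x - of_int d))) A = emeasure (tail n) A"
      by (simp add: emeasure_density)
  qed simp
  then show "density lborel (tail_density n) = density lborel (\<lambda>x. \<Sum>d\<in>?D. tail_density (Suc n) (of_int ?p * x - of_int d))"
    using density_tail_density[OF n] by simp
qed simp_all

text \<open>After refinement of both factors, the substitution y = p x - d turns the translation by
  k into one by p k + d - d' and leaves the factor 1 / p.\<close>

lemma autocorr_step:
  assumes n: "n \<ge> N"
  shows "autocorr n k = (\<Sum>d\<in>D (Suc n). \<Sum>d'\<in>D (Suc n). autocorr (Suc n) (p (Suc n) * k + d - d')) / ennreal (of_int (p (Suc n)))"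
proof -
  let ?p = "p (Suc n)" and ?D = "D (Suc n)" and ?f = "tail_density (Suc n)"
  have p: "real_of_int ?p > 0" using p_ge[of "Suc n"] by simp
  note R = tail_density_refine[OF n]
  have R': "AE x in lborel. tail_density n (x + of_int k) = (\<Sum>d\<in>?D. ?f (of_int ?p * (x + of_int k) - of_int d))"
    using AE_borel_affine[OF _ _ R, of 1 "of_int k"] by (simp add: add.commute)
  have one: "(\<integral>\<^sup>+x. ?f (of_int ?p * x - of_int d) * ?f (of_int ?p * (x + of_int k) - of_int d') \<partial>lborel)
     = autocorr (Suc n) (?p * k + d - d') / ennreal (of_int ?p)" for d d'
  proof -
    let ?I = "\<integral>\<^sup>+x. ?f (of_int ?p * x - of_int d) * ?f (of_int ?p * (x + of_int k) - of_int d') \<partial>lborel"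
    have "autocorr (Suc n) (?p * k + d - d') = ennreal (of_int ?p) * ?I"
      unfolding autocorr_def using p
      by (subst nn_integral_real_affine[where c="of_int ?p" and t="- of_int d"]) (simp_all add: algebra_simps)
    then show ?thesis using p by (subst (asm) mult.commute) (simp add: ennreal_mult_divide_eq)
  qed
  have "autocorr n k = (\<integral>\<^sup>+x. (\<Sum>d\<in>?D. ?f (of_int ?p * x - of_int d)) * (\<Sum>d'\<in>?D. ?f (of_int ?p * (x + of_int k) - of_int d')) \<partial>lborel)"
    unfolding autocorr_def by (rule nn_integral_cong_AE) (use R R' in eventually_elim, simp)
  also have "\<dots> = (\<Sum>d\<in>?D. \<Sum>d'\<in>?D. \<integral>\<^sup>+x. ?f (of_int ?p * x - of_int d) * ?f (of_int ?p * (x + of_int k) - of_int d') \<partial>lborel)"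
    by (simp add: sum_product nn_integral_sum)
  also have "\<dots> = (\<Sum>d\<in>?D. \<Sum>d'\<in>?D. autocorr (Suc n) (?p * k + d - d')) / ennreal (of_int ?p)"
    by (simp add: one divide_ennreal_def sum_distrib_right)
  finally show ?thesis .
qed

lemma autocorr_finite:
  assumes "n \<ge> N" shows "autocorr n k \<noteq> \<top>"
proof -
  have "autocorr n k \<le> (\<integral>\<^sup>+k. autocorr n k \<partial>count_space UNIV)"
    by (rule nn_integral_ge_point) simp
  then show ?thesis by (auto simp: sum_autocorr[OF assms] top_unique)
qed

end

section \<open>Entrance laws of the carry chain are trivial\<close>

text \<open>The bounds M and B, common to all levels, provide compactness. \<open>coprime\<close> is
  required from every n on because points are followed only from some late level.\<close>

locale entrance_law =
  fixes p :: "nat \<Rightarrow> int" and D :: "nat \<Rightarrow> int set" and h :: "nat \<Rightarrow> int \<Rightarrow> real" and M B :: int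
  assumes M_nonneg: "M \<ge> 0"
    and digits: "residue_digits B (p n) (D n)"
    and law: "int_law M (h n)"
    and step: "carry_step (p n) (D n) (h n) (h (Suc n))"
    and coprime: "(\<And>j d. j \<ge> n \<Longrightarrow> d \<in> D j \<Longrightarrow> q dvd d) \<Longrightarrow> q dvd 1"
begin

definition limit_law :: "(int \<Rightarrow> real) \<Rightarrow> bool" where
  "limit_law v \<longleftrightarrow> (\<exists>r. strict_mono (r :: nat \<Rightarrow> nat) \<and> (\<forall>k. (\<lambda>i. h (r i) k) \<longlonglongrightarrow> v k))"

text \<open>The index map f is arbitrary, so that the lemma serves along any subsequence and along
  the successors of its members.\<close>

lemma subseq_limit_law:
  "\<exists>s v. strict_mono (s :: nat \<Rightarrow> nat) \<and> (\<forall>k. (\<lambda>i. h (f (s i)) k) \<longlonglongrightarrow> v k)"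
proof -
  have "\<exists>s. strict_mono (s::nat \<Rightarrow> nat) \<and> (\<forall>k\<in>{-M..M}. \<exists>l. (\<lambda>i. h (f (s i)) k) \<longlonglongrightarrow> l)"
  proof (rule common_convergent_subseq)
    fix k assume k: "k \<in> {-M..M}"
    have "\<bar>h n k\<bar> \<le> 1" for n
    proof -
      have s: "(\<Sum>k\<in>{-M..M}. h n k) = 1" and nn: "h n k \<ge> 0" for k using law[of n] by (auto simp: int_law_def)
      have "h n k \<le> (\<Sum>k\<in>{-M..M}. h n k)" using k by (intro member_le_sum nn) auto
      then show ?thesis using s nn[of k] by simp
    qed
    then show "bounded (range (\<lambda>i. h (f i) k))" by (auto simp: bounded_iff)
  qed simp
  then obtain s where s: "strict_mono (s::nat \<Rightarrow> nat)" "\<And>k. k \<in> {-M..M} \<Longrightarrow> \<exists>l. (\<lambda>i. h (f (s i)) k) \<longlonglongrightarrow> l" by auto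
  have "\<exists>l. (\<lambda>i. h (f (s i)) k) \<longlonglongrightarrow> l" for k
  proof (cases "k \<in> {-M..M}")
    case False
    then have "h (f (s i)) k = 0" for i using law[of "f (s i)"] by (auto simp: int_law_def abs_le_iff)
    then show ?thesis by (intro exI[of _ 0]) simp
  qed (rule s(2))
  then show ?thesis using s(1) by metis
qed

lemma int_law_limit:
  assumes "\<And>k. (\<lambda>i. h (r i) k) \<longlonglongrightarrow> v k" shows "int_law M v"
  unfolding int_law_def
proof (intro conjI allI impI)
  fix k
  show "v k \<ge> 0" using law by (intro LIMSEQ_le_const[OF assms]) (auto simp: int_law_def)
  assume "\<bar>k\<bar> > M"
  then have "(\<lambda>i. h (r i) k) = (\<lambda>_. 0)" using law by (auto simp: int_law_def)
  then show "v k = 0" using assms[of k] by (simp add: LIMSEQ_const_iff)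
next
  have "(\<lambda>i. \<Sum>k\<in>{-M..M}. h (r i) k) \<longlonglongrightarrow> (\<Sum>k\<in>{-M..M}. v k)" by (intro tendsto_sum assms)
  moreover have "(\<lambda>i. \<Sum>k\<in>{-M..M}. h (r i) k) = (\<lambda>_. 1)" using law by (auto simp: int_law_def)
  ultimately show "(\<Sum>k\<in>{-M..M}. v k) = 1" by (simp add: LIMSEQ_const_iff)
qed

lemma limit_law_int_law: "limit_law v \<Longrightarrow> int_law M v"
  unfolding limit_law_def using int_law_limit by blast

section \<open>Minima along the sequence and at limit laws\<close>

definition min_val :: "nat \<Rightarrow> real" where
  "min_val n = (INF x. cos_poly M (h n) x)"

lemma min_val_le: "min_val n \<le> cos_poly M (h n) x"
  unfolding min_val_def
  by (intro cINF_lower bdd_belowI2[of _ "-1"]) (auto intro: cos_poly_bounds law)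

lemma min_val_attained: "\<exists>\<xi>\<in>{0..<1}. cos_poly M (h n) \<xi> = min_val n"
proof -
  obtain \<xi> where \<xi>: "\<xi> \<in> {0..<1}" "\<And>x. cos_poly M (h n) \<xi> \<le> cos_poly M (h n) x"
    using cos_poly_attains_min by blast
  have "cos_poly M (h n) \<xi> \<le> min_val n" unfolding min_val_def by (intro cINF_greatest \<xi>(2)) simp
  then show ?thesis using \<xi>(1) min_val_le[of n \<xi>] by (intro bexI[of _ \<xi>]) auto
qed

text \<open>The value at a minimum point of level n is a convex combination of values at level n +
  1, hence at least the minimum there.\<close>

lemma decseq_min_val: "decseq min_val"
proof (rule decseq_SucI)
  fix n
  obtain \<xi> where \<xi>: "cos_poly M (h n) \<xi> = min_val n" using min_val_attained by blast
  have "min_val (Suc n) = (\<Sum>l\<in>{0..<p n}. mask_sq (p n) (D n) ((\<xi> + of_int l) / of_int (p n)) * min_val (Suc n))"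
    by (simp add: sum_distrib_right[symmetric] sum_mask_sq[OF digits])
  also have "\<dots> \<le> (\<Sum>l\<in>{0..<p n}. mask_sq (p n) (D n) ((\<xi> + of_int l) / of_int (p n)) * cos_poly M (h (Suc n)) ((\<xi> + of_int l) / of_int (p n)))"
    by (intro sum_mono mult_left_mono mask_sq_nonneg min_val_le)
  also have "\<dots> = cos_poly M (h n) \<xi>"
    by (rule cos_poly_transfer[OF digits law law step, symmetric])
  finally show "min_val (Suc n) \<le> min_val n" by (simp add: \<xi>)
qed

definition limit_min :: real where "limit_min = lim min_val"

lemma min_val_tendsto: "min_val \<longlonglongrightarrow> limit_min"
proof -
  have "\<forall>n. -1 \<le> min_val n" using min_val_attained cos_poly_bounds(2)[OF law] by metis
  then obtain L where "min_val \<longlonglongrightarrow> L" by (rule decseq_convergent[OF decseq_min_val])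
  then show ?thesis unfolding limit_min_def by (metis limI)
qed

lemma limit_min_le: "limit_min \<le> cos_poly M (h n) x"
  using decseq_ge[OF decseq_min_val min_val_tendsto, of n] min_val_le[of n x] by linarith

lemma limit_law_ge:
  assumes "limit_law v" shows "limit_min \<le> cos_poly M v x"
proof -
  obtain r where "\<And>k. (\<lambda>i. h (r i) k) \<longlonglongrightarrow> v k" using assms by (auto simp: limit_law_def)
  then have "(\<lambda>i. cos_poly M (h (r i)) x) \<longlonglongrightarrow> cos_poly M v x" by (intro tendsto_cos_poly) auto
  then show ?thesis by (rule LIMSEQ_le_const) (auto intro: limit_min_le)
qed

definition min_set :: "(int \<Rightarrow> real) \<Rightarrow> real set" where
  "min_set v = {\<xi>\<in>{0..<1}. cos_poly M v \<xi> = limit_min}"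

text \<open>Minimum points of the approximating laws accumulate somewhere, and there the limit law
  takes the limiting value.\<close>

lemma min_set_nonempty:
  assumes "limit_law v" shows "min_set v \<noteq> {}"
proof -
  obtain r where r: "strict_mono (r::nat \<Rightarrow> nat)" "\<And>k. (\<lambda>i. h (r i) k) \<longlonglongrightarrow> v k" using assms by (auto simp: limit_law_def)
  obtain x where x: "\<And>n. x n \<in> {0..<1}" "\<And>n. cos_poly M (h n) (x n) = min_val n" using min_val_attained by metis
  have "bounded (range (\<lambda>i. x (r i)))"
    unfolding bounded_iff using x(1) by (intro exI[of _ 1]) (auto simp: less_eq_real_def)
  then obtain l s where s: "strict_mono (s::nat \<Rightarrow> nat)" "((\<lambda>i. x (r i)) \<circ> s) \<longlonglongrightarrow> l"
    using bounded_imp_convergent_subsequence by blast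
  have "(\<lambda>i. h (r (s i)) k) \<longlonglongrightarrow> v k" for k
    using LIMSEQ_subseq_LIMSEQ[OF r(2) s(1)] by (simp add: comp_def)
  then have "(\<lambda>i. cos_poly M (h (r (s i))) (x (r (s i)))) \<longlonglongrightarrow> cos_poly M v l"
    using s(2) by (intro tendsto_cos_poly) (auto simp: comp_def)
  moreover have "(\<lambda>i. min_val (r (s i))) \<longlonglongrightarrow> limit_min"
    using LIMSEQ_subseq_LIMSEQ[OF min_val_tendsto strict_mono_o[OF r(1) s(1)]] by (simp add: comp_def)
  ultimately have "cos_poly M v l = limit_min" by (simp add: x(2) LIMSEQ_unique)
  \<comment> \<open>The accumulation point may be 1, outside the half-open unit interval.\<close>
  moreover have "cos_poly M v (frac l) = cos_poly M v l" by (rule cos_poly_Ints_diff) (simp add: frac_def)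
  ultimately have "frac l \<in> min_set v" by (auto simp: min_set_def frac_lt_1)
  then show ?thesis by blast
qed

text \<open>Infinitely many levels \<open>r i\<close> share one pair (q, A), so the limit inherits a
  genuine carry step. The subsequence s is returned too, since it identifies q and A as data of
  actual levels.\<close>

lemma limit_step:
  assumes r: "strict_mono (r :: nat \<Rightarrow> nat)" and lim: "\<And>k. (\<lambda>i. h (r i) k) \<longlonglongrightarrow> v k"
  obtains s q A v' where "strict_mono (s :: nat \<Rightarrow> nat)" "\<And>i. p (r (s i)) = q" "\<And>i. D (r (s i)) = A"
    "residue_digits B q A" "limit_law v'" "carry_step q A v v'"
proof -
  have "(p n, D n) \<in> {2..B} \<times> Pow {0..B}" for n using digits[of n] by (auto simp: residue_digits_def)
  then obtain s c where s: "strict_mono (s::nat \<Rightarrow> nat)" "\<And>i. (p (r (s i)), D (r (s i))) = c"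
    using pigeonhole_subseq[of "{2..B} \<times> Pow {0..B}" "\<lambda>i. (p (r i), D (r i))"] by auto
  obtain t v' where t: "strict_mono (t::nat \<Rightarrow> nat)" "\<And>k. (\<lambda>i. h (Suc (r (s (t i)))) k) \<longlonglongrightarrow> v' k"
    using subseq_limit_law[of "\<lambda>i. Suc (r (s i))"] by blast
  obtain q A where c: "c = (q, A)" by (cases c)
  have mono: "strict_mono (\<lambda>i. r (s (t i)))"
    using r s(1) t(1) by (simp add: strict_mono_def)
  have dig: "residue_digits B q A" using digits[of "r (s 0)"] s(2)[of 0] by (simp add: c)
  have "limit_law v'"
    unfolding limit_law_def using mono t(2) by (intro exI[of _ "\<lambda>i. Suc (r (s (t i)))"]) (simp add: strict_mono_def)
  moreover have "carry_step q A v v'"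
    unfolding carry_step_def
  proof
    fix k
    have "(\<lambda>i. h (r (s (t i))) k) \<longlonglongrightarrow> v k"
      using LIMSEQ_subseq_LIMSEQ[OF lim strict_mono_o[OF s(1) t(1)]] by (simp add: comp_def)
    moreover have "h (r (s (t i))) k = (\<Sum>d\<in>A. \<Sum>d'\<in>A. h (Suc (r (s (t i)))) (q * k + d - d')) / of_int q" for i
      using step[of "r (s (t i))"] s(2)[of "t i"] by (simp add: carry_step_def c)
    moreover have "(\<lambda>i. (\<Sum>d\<in>A. \<Sum>d'\<in>A. h (Suc (r (s (t i)))) (q * k + d - d')) / of_int q)
        \<longlonglongrightarrow> (\<Sum>d\<in>A. \<Sum>d'\<in>A. v' (q * k + d - d')) / of_int q"
      using dig by (intro tendsto_intros t(2)) (auto simp: residue_digits_def)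
    ultimately show "v k = (\<Sum>d\<in>A. \<Sum>d'\<in>A. v' (q * k + d - d')) / of_int q" by (simp add: LIMSEQ_unique)
  qed
  ultimately show thesis using that[of s q A v'] s dig by (simp add: c)
qed

section \<open>Torsion points and limit laws with the largest minimum sets\<close>

definition torsion :: "real set" where
  "torsion = {\<xi>\<in>{0..<1}. fact (nat B) * \<xi> \<in> \<int>}"

lemma finite_torsion: "finite torsion"
proof -
  have "torsion \<subseteq> (\<lambda>k. of_int k / fact (nat B)) ` {0..fact (nat B)}"
  proof
    fix \<xi> assume \<xi>: "\<xi> \<in> torsion"
    then obtain k :: int where k: "fact (nat B) * \<xi> = of_int k" by (auto simp: torsion_def elim!: Ints_cases)
    have "0 \<le> fact (nat B) * \<xi>" "fact (nat B) * \<xi> \<le> fact (nat B) * 1"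
      using \<xi> by (auto simp: torsion_def intro!: mult_left_mono)
    then have "real_of_int k \<ge> of_int 0" "real_of_int k \<le> of_int (fact (nat B))" unfolding k by simp_all
    then have "k \<in> {0..fact (nat B)}" by (simp only: of_int_le_iff atLeastAtMost_iff)
    moreover have "\<xi> = of_int k / fact (nat B)" using k by (simp add: field_simps)
    ultimately show "\<xi> \<in> (\<lambda>k. of_int k / fact (nat B)) ` {0..fact (nat B)}" by blast
  qed
  then show ?thesis by (rule finite_subset) simp
qed

lemma preimage_in_torsion:
  assumes "residue_digits B q A" "mask_sq q A ((\<xi> + of_int l) / of_int q) = 1" "\<xi> \<in> {0..<1}" "l \<in> {0..<q}"
  shows "(\<xi> + of_int l) / of_int q \<in> torsion"
  unfolding torsion_def using preimage_in_unit[OF assms(3,4)] mask_sq_eq_1_fact[OF assms(1,2)] by simp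

text \<open>The point \<xi> is q times its preimage minus l, so integrality of a multiple descends
  from the preimage.\<close>

lemma Ints_of_preimage:
  fixes \<xi> :: real
  assumes "q > (0::int)" "a * ((\<xi> + of_int l) / of_int q) \<in> \<int>" "a \<in> \<int>"
  shows "a * \<xi> \<in> \<int>"
proof -
  have "a * \<xi> = of_int q * (a * ((\<xi> + of_int l) / of_int q)) - a * of_int l"
    using assms(1) by (simp add: field_simps)
  also have "\<dots> \<in> \<int>" by (rule Ints_diff[OF Ints_mult[OF Ints_of_int assms(2)] Ints_mult[OF assms(3) Ints_of_int]])
  finally show ?thesis .
qed

lemma finite_min_set:
  assumes "limit_min < 1" "limit_law v" shows "finite (min_set v)" "card (min_set v) \<le> 2 * nat M"
  using cos_poly_level_card[OF limit_law_int_law[OF assms(2)] M_nonneg, of limit_min, folded min_set_def] assms(1) by auto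

definition maximal_limit_law :: "(int \<Rightarrow> real) \<Rightarrow> bool" where
  "maximal_limit_law v \<longleftrightarrow> limit_law v \<and> (\<forall>u. limit_law u \<longrightarrow> card (min_set u) \<le> card (min_set v))"

lemma maximal_limit_law_exists:
  assumes "limit_min < 1" obtains v where "maximal_limit_law v"
proof -
  obtain v0 where v0: "limit_law v0"
    using subseq_limit_law[of "\<lambda>i. i"] by (auto simp: limit_law_def)
  have "\<exists>v. limit_law v \<and> (\<forall>u. limit_law u \<longrightarrow> card (min_set u) \<le> card (min_set v))"
    by (rule ex_has_greatest_nat[where k=v0 and b="Suc (2 * nat M)"])
       (use v0 finite_min_set(2)[OF assms] in \<open>auto simp: less_Suc_eq_le\<close>)
  then show thesis using that by (auto simp: maximal_limit_law_def)
qed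

lemma maximal_no_branching:
  assumes lt: "limit_min < 1" and u: "maximal_limit_law u" "limit_law u'" "carry_step q A u u'"
    and A: "residue_digits B q A" and \<xi>: "\<xi> \<in> min_set u"
  shows "\<exists>l\<in>{0..<q}. mask_sq q A ((\<xi> + of_int l) / of_int q) = 1"
proof (rule no_branching[where B=B and M=M and \<alpha>=limit_min and v=u and v'=u', folded min_set_def])
  show "card (min_set u') \<le> card (min_set u)" using u by (simp add: maximal_limit_law_def)
  show "\<xi> \<in> {0..<1}" "cos_poly M u \<xi> = limit_min" using \<xi> by (auto simp: min_set_def)
qed (use assms in \<open>auto simp: maximal_limit_law_def intro: finite_min_set limit_law_int_law limit_law_ge\<close>)

text \<open>The only branch over a minimum point leads to a point of full mask, whose denominator
  divides B!; going back to \<xi> does not enlarge the denominator.\<close>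

lemma maximal_min_set_torsion:
  assumes lt: "limit_min < 1" and v: "maximal_limit_law v" shows "min_set v \<subseteq> torsion"
proof
  obtain r where r: "strict_mono (r::nat \<Rightarrow> nat)" "\<And>k. (\<lambda>i. h (r i) k) \<longlonglongrightarrow> v k"
    using v by (auto simp: maximal_limit_law_def limit_law_def)
  obtain s q A v' where stp: "strict_mono (s::nat \<Rightarrow> nat)"
      "residue_digits B q A" "limit_law v'" "carry_step q A v v'"
    using limit_step[OF r] by metis
    fix \<xi> assume \<xi>: "\<xi> \<in> min_set v"
    from maximal_no_branching[OF lt v stp(3,4,2) \<xi>] obtain l where l: "l \<in> {0..<q}" "mask_sq q A ((\<xi> + of_int l) / of_int q) = 1"
      by blast
    have "fact (nat B) * ((\<xi> + of_int l) / of_int q) \<in> \<int>" by (rule mask_sq_eq_1_fact[OF stp(2) l(2)])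
    then have "fact (nat B) * \<xi> \<in> \<int>"
      using l by (intro Ints_of_preimage[of q _ \<xi> l]) (auto, metis Ints_of_nat of_nat_fact)
    then show "\<xi> \<in> torsion" using \<xi> by (simp add: torsion_def min_set_def)
  qed

section \<open>From limit laws back to actual levels\<close>

definition unbranched :: "nat \<Rightarrow> real set \<Rightarrow> bool" where
  "unbranched n S \<longleftrightarrow> (\<forall>\<xi>\<in>S. \<exists>l\<in>{0..<p n}. mask_sq (p n) (D n) ((\<xi> + of_int l) / of_int (p n)) = 1)"

text \<open>Counterexamples with error 1 / (i + 1) at ever later levels would, along a subsequence,
  share one set T and converge to a limit law u. Then T lies in the minimum set of u and, having the
  largest possible size, equals it. So u is maximal and its carry step does not branch; but that
  step is the one of actual levels in the subsequence.\<close>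

lemma unbranched_near_min:
  assumes lt: "limit_min < 1" and v: "maximal_limit_law v"
  obtains n0 \<epsilon> where "\<epsilon> > 0"
    "\<forall>n\<ge>n0. \<forall>S\<subseteq>torsion. card S = card (min_set v) \<longrightarrow>
       (\<forall>\<xi>\<in>S. cos_poly M (h n) \<xi> \<le> limit_min + \<epsilon>) \<longrightarrow> unbranched n S"
proof -
  define c where "c = card (min_set v)"
  have "\<exists>n0 \<epsilon>. \<epsilon> > 0 \<and> (\<forall>n\<ge>n0. \<forall>S\<subseteq>torsion. card S = c \<longrightarrow> (\<forall>\<xi>\<in>S. cos_poly M (h n) \<xi> \<le> limit_min + \<epsilon>) \<longrightarrow> unbranched n S)"
  proof (rule ccontr)
    assume neg: "\<not> ?thesis"
    define bad where "bad i n \<longleftrightarrow> (\<exists>S\<subseteq>torsion. card S = c \<and> (\<forall>\<xi>\<in>S. cos_poly M (h n) \<xi> \<le> limit_min + 1 / real (Suc i)) \<and> \<not> unbranched n S)" for i n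
    have ex_bad: "\<exists>n\<ge>m. bad i n" for i m
    proof (rule ccontr)
      assume "\<not> ?thesis"
      then have "\<forall>n\<ge>m. \<forall>S\<subseteq>torsion. card S = c \<longrightarrow> (\<forall>\<xi>\<in>S. cos_poly M (h n) \<xi> \<le> limit_min + 1 / real (Suc i)) \<longrightarrow> unbranched n S"
        unfolding bad_def by blast
      moreover have "1 / real (Suc i) > 0" by simp
      ultimately show False using neg by blast
    qed
    have "\<exists>r. \<forall>i. bad i (r i) \<and> r i < r (Suc i)"
    proof (rule dependent_nat_choice)
      show "\<exists>x. bad 0 x" using ex_bad by blast
      fix x i
      show "\<exists>y. bad (Suc i) y \<and> x < y" using ex_bad[of "Suc x" "Suc i"] by (auto simp: Suc_le_eq)
    qed
    then obtain r where r: "\<And>i. bad i (r i)" "strict_mono r" by (auto simp: strict_mono_Suc_iff)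
    obtain S where S: "\<And>i. S i \<subseteq> torsion" "\<And>i. card (S i) = c" "\<And>i \<xi>. \<xi> \<in> S i \<Longrightarrow> cos_poly M (h (r i)) \<xi> \<le> limit_min + 1 / real (Suc i)" "\<And>i. \<not> unbranched (r i) (S i)"
      using r(1) unfolding bad_def by metis
    obtain s T where s: "strict_mono (s::nat \<Rightarrow> nat)" "\<And>i. S (s i) = T"
      using pigeonhole_subseq[of "Pow torsion" S] finite_torsion S(1) by auto
    obtain t u where t: "strict_mono (t::nat \<Rightarrow> nat)" "\<And>k. (\<lambda>i. h (r (s (t i))) k) \<longlonglongrightarrow> u k"
      using subseq_limit_law[of "\<lambda>i. r (s i)"] by blast
    have mono: "strict_mono (\<lambda>i. r (s (t i)))" using r(2) s(1) t(1) by (simp add: strict_mono_def)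
    have u: "limit_law u" unfolding limit_law_def using mono t(2) by blast
    have T: "T \<subseteq> torsion" "card T = c" using S(1,2)[of "s 0"] s(2) by auto
    have "T \<subseteq> min_set u"
    proof
      fix \<xi> assume \<xi>: "\<xi> \<in> T"
      have l1: "(\<lambda>i. limit_min + 1 / real (Suc (s (t i)))) \<longlonglongrightarrow> limit_min + 0"
        using LIMSEQ_subseq_LIMSEQ[OF lim_1_over_n[THEN LIMSEQ_Suc] strict_mono_o[OF s(1) t(1)]]
        by (intro tendsto_add tendsto_const) (simp add: comp_def)
      have l2: "(\<lambda>i. cos_poly M (h (r (s (t i)))) \<xi>) \<longlonglongrightarrow> cos_poly M u \<xi>"
        by (intro tendsto_cos_poly t(2) tendsto_const)
      have "cos_poly M (h (r (s (t i)))) \<xi> \<le> limit_min + 1 / real (Suc (s (t i)))" for i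
        using S(3)[of \<xi> "s (t i)"] \<xi> s(2) by simp
      then have "cos_poly M u \<xi> \<le> limit_min" using LIMSEQ_le[OF l2 l1] by simp
      then show "\<xi> \<in> min_set u" using limit_law_ge[OF u, of \<xi>] \<xi> T(1) by (auto simp: torsion_def min_set_def)
    qed
    then have TZ: "T = min_set u"
      using T(2) u v finite_min_set(1)[OF lt u] by (intro card_seteq) (auto simp: c_def maximal_limit_law_def)
    then have max: "maximal_limit_law u" using T(2) u v by (simp add: c_def maximal_limit_law_def)
    obtain w q A v' where w: "strict_mono (w::nat \<Rightarrow> nat)" "\<And>i. p (r (s (t (w i)))) = q" "\<And>i. D (r (s (t (w i)))) = A"
      "residue_digits B q A" "limit_law v'" "carry_step q A u v'"
      using limit_step[OF mono t(2)] by blast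
    have "unbranched (r (s (t (w 0)))) T"
      unfolding unbranched_def w(2,3) using maximal_no_branching[OF lt max w(5,6,4)] TZ by blast
    then show False using S(4)[of "s (t (w 0))"] s(2) by simp
  qed
  then show thesis using that unfolding c_def by blast
qed

text \<open>An unbranched point passes its value of \<open>cos_poly\<close> unchanged to its
  preimage, so the preimages again form a set of c points near the minimum and the argument repeats
  for ever with the same \<epsilon>. Full masks make d times a preimage integral for every current
  digit d, and this descends to the starting point.\<close>

lemma unbranched_forever:
  assumes lt: "limit_min < 1"
  obtains n \<xi> where "\<xi> \<in> torsion" "\<xi> \<noteq> 0" "\<And>j d. j \<ge> n \<Longrightarrow> d \<in> D j \<Longrightarrow> of_int d * \<xi> \<in> \<int>"
proof -
  obtain v where max: "maximal_limit_law v" using maximal_limit_law_exists[OF lt] by blast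
  then have v: "limit_law v" by (simp add: maximal_limit_law_def)
  define c where "c = card (min_set v)"
  obtain n0 \<epsilon> where \<epsilon>: "\<epsilon> > 0" and
    near: "\<forall>n\<ge>n0. \<forall>S\<subseteq>torsion. card S = c \<longrightarrow> (\<forall>\<xi>\<in>S. cos_poly M (h n) \<xi> \<le> limit_min + \<epsilon>) \<longrightarrow> unbranched n S"
    unfolding c_def by (rule unbranched_near_min[OF lt max])
  have claim: "unbranched n S"
    if "n \<ge> n0" "S \<subseteq> torsion" "card S = c" "\<And>\<xi>. \<xi> \<in> S \<Longrightarrow> cos_poly M (h n) \<xi> \<le> limit_min + \<epsilon>" for n S
    using near that by blast
  have min_set_torsion: "min_set v \<subseteq> torsion" by (rule maximal_min_set_torsion[OF lt max])
  have fin_min_set: "finite (min_set v)" by (rule finite_min_set(1)[OF lt v])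
  obtain r where r: "strict_mono (r::nat \<Rightarrow> nat)" "\<And>k. (\<lambda>i. h (r i) k) \<longlonglongrightarrow> v k"
    using v by (auto simp: limit_law_def)
  have "\<forall>\<^sub>F i in sequentially. \<forall>\<xi>\<in>min_set v. cos_poly M (h (r i)) \<xi> < limit_min + \<epsilon>"
  proof (rule eventually_ball_finite[OF fin_min_set], intro ballI)
    fix \<xi> assume \<xi>: "\<xi> \<in> min_set v"
    have "(\<lambda>i. cos_poly M (h (r i)) \<xi>) \<longlonglongrightarrow> cos_poly M v \<xi>"
      by (intro tendsto_cos_poly r(2) tendsto_const)
    then show "\<forall>\<^sub>F i in sequentially. cos_poly M (h (r i)) \<xi> < limit_min + \<epsilon>"
      using \<xi> \<epsilon> by (intro order_tendstoD(2)) (auto simp: min_set_def)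
  qed
  then obtain i where i: "i \<ge> n0" "\<And>\<xi>. \<xi> \<in> min_set v \<Longrightarrow> cos_poly M (h (r i)) \<xi> < limit_min + \<epsilon>"
    unfolding eventually_sequentially by (metis nle_le)
  define n1 where "n1 = r i"
  have n1: "n1 \<ge> n0" using i(1) seq_suble[OF r(1), of i] by (simp add: n1_def)
  \<comment> \<open>Meaningful only at unbranched points, where \<open>someI_ex\<close> applies;
    elsewhere an arbitrary integer.\<close>
  define branch where "branch n \<xi> = (SOME l. l \<in> {0..<p n} \<and> mask_sq (p n) (D n) ((\<xi> + of_int l) / of_int (p n)) = 1)" for n and \<xi> :: real
  define pre where "pre n \<xi> = (\<xi> + of_int (branch n \<xi>)) / of_int (p n)" for n \<xi>
  define orb where "orb = rec_nat (\<lambda>\<xi>. \<xi>) (\<lambda>j f \<xi>. pre (n1 + j) (f \<xi>))"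
  have orb: "orb 0 \<xi> = \<xi>" "orb (Suc j) \<xi> = pre (n1 + j) (orb j \<xi>)" for j \<xi> by (simp_all add: orb_def)
  \<comment> \<open>Injectivity preserves the count c; with the other two properties this is what
    \<open>claim\<close> requires at the next level.\<close>
  have inv: "inj_on (orb j) (min_set v) \<and> orb j ` min_set v \<subseteq> torsion \<and> (\<forall>\<xi>\<in>min_set v. cos_poly M (h (n1 + j)) (orb j \<xi>) \<le> limit_min + \<epsilon>)" for j
  proof (induction j)
    case 0
    show ?case using min_set_torsion i(2) by (auto simp: orb n1_def inj_on_def intro: less_imp_le)
  next
    case (Suc j)
    let ?n = "n1 + j"
    have card: "card (orb j ` min_set v) = c" using card_image[of "orb j" "min_set v"] Suc.IH by (simp add: c_def)
    have unb: "unbranched ?n (orb j ` min_set v)" using n1 Suc.IH card by (intro claim) auto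
    have p: "p ?n > 0" using digits[of ?n] by (simp add: residue_digits_def)
    have br: "branch ?n (orb j \<xi>) \<in> {0..<p ?n}" "mask_sq (p ?n) (D ?n) (pre ?n (orb j \<xi>)) = 1" if "\<xi> \<in> min_set v" for \<xi>
    proof -
      have "\<exists>l. l \<in> {0..<p ?n} \<and> mask_sq (p ?n) (D ?n) ((orb j \<xi> + of_int l) / of_int (p ?n)) = 1"
        using unb that unfolding unbranched_def by blast
      from someI_ex[OF this] show "branch ?n (orb j \<xi>) \<in> {0..<p ?n}" "mask_sq (p ?n) (D ?n) (pre ?n (orb j \<xi>)) = 1"
        unfolding pre_def branch_def by blast+
    qed
    have oE: "orb j \<xi> \<in> {0..<1}" if "\<xi> \<in> min_set v" for \<xi> using Suc.IH that by (auto simp: torsion_def)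
    have inj: "inj_on (orb (Suc j)) (min_set v)"
    proof (rule inj_onI)
      fix x y assume xy: "x \<in> min_set v" "y \<in> min_set v" "orb (Suc j) x = orb (Suc j) y"
      then have "orb j x = orb j y"
        using unique_preimage(1)[OF _ p oE[OF xy(1)] oE[OF xy(2)]] by (simp add: orb pre_def)
      then show "x = y" using Suc.IH xy by (auto simp: inj_on_def)
    qed
    have "orb (Suc j) \<xi> \<in> torsion" if "\<xi> \<in> min_set v" for \<xi>
      unfolding orb pre_def by (rule preimage_in_torsion[OF digits br(2)[OF that, unfolded pre_def] oE[OF that] br(1)[OF that]])
    moreover have "cos_poly M (h (n1 + Suc j)) (orb (Suc j) \<xi>) \<le> limit_min + \<epsilon>" if \<xi>: "\<xi> \<in> min_set v" for \<xi>
    proof -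
      let ?W = "\<lambda>l. mask_sq (p ?n) (D ?n) ((orb j \<xi> + of_int l) / of_int (p ?n))"
      let ?b = "branch ?n (orb j \<xi>)"
      \<comment> \<open>The weights sum to 1 and the chosen branch already has weight 1.\<close>
      have "(\<Sum>l\<in>{0..<p ?n} - {?b}. ?W l) = 0"
        using sum_mask_sq[OF digits, of ?n "orb j \<xi>"] br[OF \<xi>] by (simp add: sum.remove[of _ ?b] pre_def)
      then have 0: "?W l = 0" if "l \<in> {0..<p ?n} - {?b}" for l
        using that by (subst (asm) sum_nonneg_eq_0_iff) (auto intro: mask_sq_nonneg)
      have "cos_poly M (h ?n) (orb j \<xi>) = (\<Sum>l\<in>{0..<p ?n}. ?W l * cos_poly M (h (Suc ?n)) ((orb j \<xi> + of_int l) / of_int (p ?n)))"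
        by (rule cos_poly_transfer[OF digits law law step])
      also have "\<dots> = ?W ?b * cos_poly M (h (Suc ?n)) ((orb j \<xi> + of_int ?b) / of_int (p ?n))"
        using br(1)[OF \<xi>] 0 by (subst sum.remove[of _ ?b]) auto
      also have "\<dots> = cos_poly M (h (n1 + Suc j)) (orb (Suc j) \<xi>)"
        using br(2)[OF \<xi>] by (simp add: orb pre_def)
      finally have e: "cos_poly M (h ?n) (orb j \<xi>) = cos_poly M (h (n1 + Suc j)) (orb (Suc j) \<xi>)" .
      have "cos_poly M (h ?n) (orb j \<xi>) \<le> limit_min + \<epsilon>" using Suc.IH \<xi> by blast
      then show ?thesis unfolding e .
    qed
    ultimately show ?case using inj by (intro conjI image_subsetI ballI)
  qed
  have full: "mask_sq (p (n1 + j)) (D (n1 + j)) (orb (Suc j) \<xi>) = 1" if "\<xi> \<in> min_set v" for j \<xi>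
  proof -
    have "unbranched (n1 + j) (orb j ` min_set v)"
      using n1 inv[of j] card_image[of "orb j" "min_set v"] by (intro claim) (auto simp: c_def)
    then have "\<exists>l. l \<in> {0..<p (n1 + j)} \<and> mask_sq (p (n1 + j)) (D (n1 + j)) ((orb j \<xi> + of_int l) / of_int (p (n1 + j))) = 1"
      using that unfolding unbranched_def by blast
    from someI_ex[OF this] show ?thesis unfolding orb pre_def branch_def by blast
  qed
  obtain \<xi> where \<xi>: "\<xi> \<in> min_set v" using min_set_nonempty[OF v] by blast
  have descend: "of_int d * \<xi> \<in> \<int>" if "of_int d * orb j \<xi> \<in> \<int>" for d j
    using that
  proof (induction j)
    case (Suc j)
    have "p (n1 + j) > 0" using digits[of "n1 + j"] by (simp add: residue_digits_def)
    then have "of_int d * orb j \<xi> \<in> \<int>"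
      using Suc.prems unfolding orb pre_def by (rule Ints_of_preimage) simp
    then show ?case by (rule Suc.IH)
  qed (simp add: orb)
  have dI: "of_int d * \<xi> \<in> \<int>" if "j \<ge> n1" "d \<in> D j" for j d
    using descend[of d "Suc (j - n1)"] mask_sq_eq_1[OF digits full[OF \<xi>], of d "j - n1"] that by simp
  \<comment> \<open>At 0 the cosine polynomial of a law equals 1, which exceeds
    \<open>limit_min\<close>.\<close>
  have "\<xi> \<noteq> 0" using \<xi> cos_poly_0[OF limit_law_int_law[OF v]] lt by (auto simp: min_set_def)
  then show thesis using that[of \<xi> n1] dI \<xi> min_set_torsion by blast
qed

text \<open>The point that is followed for ever is a' / Q' in lowest terms, and integrality of d
  \<xi> means that Q' divides d. So Q' divides all late digits and is a unit, which leaves \<xi> = 0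
  only.\<close>

lemma limit_min_ge_1: "limit_min \<ge> 1"
proof (rule ccontr)
  assume "\<not> limit_min \<ge> 1"
  then obtain n1 \<xi> where \<xi>: "\<xi> \<in> torsion" "\<xi> \<noteq> 0" and dI: "\<And>j d. j \<ge> n1 \<Longrightarrow> d \<in> D j \<Longrightarrow> of_int d * \<xi> \<in> \<int>"
    using unbranched_forever by (metis not_le)
  obtain a :: int where a: "fact (nat B) * \<xi> = of_int a" using \<xi> by (auto simp: torsion_def elim!: Ints_cases)
  define Q :: int where "Q = fact (nat B)"
  have Q: "Q > 0" "\<xi> = of_int a / of_int Q" using a by (simp_all add: Q_def field_simps)
  obtain Q' a' where Q': "Q = Q' * gcd Q a" "a = a' * gcd Q a" "coprime Q' a'"
    using gcd_coprime_exists[of Q a] Q(1) by auto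
  have g: "gcd Q a \<noteq> 0" using Q(1) by simp
  have "Q' dvd d" if jd: "j \<ge> n1" "d \<in> D j" for j d
  proof -
    obtain m :: int where m: "of_int d * \<xi> = of_int m" using dI[OF jd] by (auto elim!: Ints_cases)
    then have "real_of_int (d * a) = of_int (m * Q)" using Q by (simp add: field_simps)
    then have "d * a = m * Q" by (simp only: of_int_eq_iff)
    then have "(d * a') * gcd Q a = (m * Q') * gcd Q a" using Q'(1,2) by (metis mult.assoc)
    then have "d * a' = m * Q'" using g by (metis mult_right_cancel)
    then have "Q' dvd d * a'" by simp
    then show ?thesis using Q'(3) by (simp add: coprime_dvd_mult_left_iff)
  qed
  then have "Q' dvd 1" using coprime[of n1 Q'] by blast
  then have "Q dvd a" using Q'(1,2) by (metis dvd_trans dvd_triv_right mult.commute mult_dvd_mono one_dvd mult_1)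
  then have "\<xi> \<in> \<int>" using Q by (auto simp: dvd_def)
  moreover have "\<xi> \<in> {0..<1}" using \<xi> by (simp add: torsion_def)
  ultimately show False using \<xi>(2) by (auto elim!: Ints_cases)
qed

theorem entrance_law_dirac: "h n k = (if k = 0 then 1 else 0)"
  using limit_min_ge_1 limit_min_le by (intro int_law_dirac[OF law M_nonneg]) (meson order_trans)

end

section \<open>Spectra of the tail measures\<close>

context residue_system
begin

text \<open>Level 0 of the chain is level N of the digits. \<open>enn2real\<close> sends \<infinity>
  to 0, so \<open>autocorr_finite\<close> is what makes the conversion faithful.\<close>

definition carry_law :: "nat \<Rightarrow> int \<Rightarrow> real" where
  "carry_law j k = enn2real (autocorr (N + j) k)"

sublocale carries: entrance_law "\<lambda>j. p (Suc (N + j))" "\<lambda>j. D (Suc (N + j))" carry_law "\<lceil>2 * C\<rceil>" B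
proof
  let ?M = "\<lceil>2 * C\<rceil>"
  show "?M \<ge> 0" using C_nonneg by simp
  have zero: "autocorr (N + j) k = 0" if "\<bar>k\<bar> > ?M" for j k
  proof (rule autocorr_eq_0)
    have "2 * C \<le> of_int ?M" by simp
    also have "\<dots> < of_int \<bar>k\<bar>" using that by (simp only: of_int_less_iff)
    finally show "\<bar>real_of_int k\<bar> > 2 * C" by simp
  qed simp
  have sum1: "(\<Sum>k\<in>{-?M..?M}. autocorr (N + j) k) = 1" for j
  proof -
    have "(\<integral>\<^sup>+k. autocorr (N + j) k \<partial>count_space UNIV) = (\<Sum>k\<in>{-?M..?M}. autocorr (N + j) k)"
      using zero by (intro nn_integral_count_space') (auto simp: abs_le_iff not_le)
    then show ?thesis using sum_autocorr[of "N + j"] by simp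
  qed
  have law: "autocorr (N + j) k = ennreal (carry_law j k)" "carry_law j k \<ge> 0" for j k
    using autocorr_finite[of "N + j" k] by (simp_all add: carry_law_def less_top)
  fix j
  show "residue_digits B (p (Suc (N + j))) (D (Suc (N + j)))" by (rule residues) simp
  have "ennreal (\<Sum>k\<in>{-?M..?M}. carry_law j k) = 1" using sum1[of j] law by (simp add: sum_ennreal)
  then have "(\<Sum>k\<in>{-?M..?M}. carry_law j k) = 1" by (simp add: law(2) sum_nonneg)
  then show "int_law ?M (carry_law j)" using law(2) zero by (simp add: int_law_def carry_law_def)
  show "carry_step (p (Suc (N + j))) (D (Suc (N + j))) (carry_law j) (carry_law (Suc j))"
    unfolding carry_step_def
  proof
    fix k
    let ?S = "\<Sum>d\<in>D (Suc (N + j)). \<Sum>d'\<in>D (Suc (N + j)). carry_law (Suc j) (p (Suc (N + j)) * k + d - d')"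
    have "ennreal (carry_law j k) = (\<Sum>d\<in>D (Suc (N + j)). \<Sum>d'\<in>D (Suc (N + j)). ennreal (carry_law (Suc j) (p (Suc (N + j)) * k + d - d'))) / ennreal (of_int (p (Suc (N + j))))"
      using autocorr_step[of "N + j" k] law(1)[of j] law(1)[of "Suc j"] by simp
    also have "\<dots> = ennreal ?S / ennreal (of_int (p (Suc (N + j))))"
      by (simp add: law(2) sum_nonneg)
    also have "\<dots> = ennreal (?S / of_int (p (Suc (N + j))))"
      using p_ge[of "Suc (N + j)"] by (intro divide_ennreal) (auto intro!: sum_nonneg law(2))
    finally show "carry_law j k = ?S / of_int (p (Suc (N + j)))"
      using p_ge[of "Suc (N + j)"] law(2) by (subst (asm) ennreal_inj) (auto intro!: divide_nonneg_nonneg sum_nonneg)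
  qed
  fix q :: int assume q: "\<And>i d. j \<le> i \<Longrightarrow> d \<in> D (Suc (N + i)) \<Longrightarrow> q dvd d"
  show "q dvd 1"
  proof (rule coprime_digits)
    show "N + j \<ge> N" by simp
    fix i d assume "i > N + j" "d \<in> D i"
    \<comment> \<open>As i > N, the digit index i is \<open>Suc (N + (i - Suc N))\<close>.\<close>
    then show "q dvd d" using q[of "i - Suc N" d] by simp
  qed
qed

lemma autocorr_offdiag:
  assumes n: "n \<ge> N" and k: "k \<noteq> 0" shows "autocorr n k = 0"
proof -
  have "enn2real (autocorr n k) = 0"
    using carries.entrance_law_dirac[of "n - N" k] n k by (simp add: carry_law_def)
  then show ?thesis using autocorr_finite[OF n, of k] by (simp add: enn2real_eq_0_iff)
qed

text \<open>A vanishing overlap means that almost no point has positive density both at itself and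
  at a given nonzero integer translate, and there are countably many translates. Two points of T
  with equal fractional parts would differ by such a translate.\<close>

lemma tail_tile:
  assumes n: "n \<ge> N"
  obtains T where "T \<in> sets borel" "AE x in tail n. x \<in> T" "inj_on frac T"
proof -
  let ?f = "tail_density n"
  define T where "T = {x. ?f x \<noteq> 0 \<and> (\<forall>k::int. k \<noteq> 0 \<longrightarrow> ?f (x + of_int k) = 0)}"
  show thesis
  proof
    show "T \<in> sets borel" unfolding T_def by measurable
    have "AE x in lborel. ?f x * ?f (x + of_int k) = 0" if "k \<noteq> 0" for k :: int
      using autocorr_offdiag[OF n that] unfolding autocorr_def by (subst (asm) nn_integral_0_iff_AE) simp_all
    then have "AE x in lborel. \<forall>k::int. k \<noteq> 0 \<longrightarrow> ?f x * ?f (x + of_int k) = 0"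
      by (simp add: AE_all_countable)
    then have "AE x in lborel. 0 < ?f x \<longrightarrow> x \<in> T"
      by eventually_elim (auto simp: T_def)
    then show "AE x in tail n. x \<in> T"
      unfolding density_tail_density[OF n, symmetric] by (subst AE_density) simp_all
    show "inj_on frac T"
    proof (rule inj_onI)
      fix x y assume xy: "x \<in> T" "y \<in> T" "frac x = frac y"
      then have y: "y = x + of_int (\<lfloor>y\<rfloor> - \<lfloor>x\<rfloor>)" by (simp add: frac_def)
      have "\<lfloor>y\<rfloor> - \<lfloor>x\<rfloor> = 0"
      proof (rule ccontr)
        assume "\<lfloor>y\<rfloor> - \<lfloor>x\<rfloor> \<noteq> 0"
        then have "?f (x + of_int (\<lfloor>y\<rfloor> - \<lfloor>x\<rfloor>)) = 0" using xy(1) unfolding T_def by blast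
        then have "?f y = 0" by (simp only: y[symmetric])
        then show False using xy(2) by (simp add: T_def)
      qed
      then show "x = y" using y by simp
    qed
  qed
qed

lemma exp_complete_tail: "n \<ge> N \<Longrightarrow> exp_complete (tail n) UNIV"
  using tail_tile exp_complete_of_inj_frac[OF sets_tail] by metis

text \<open>Downward induction from N, written with N - i; truncated subtraction makes the step
  trivial once i reaches N.\<close>

lemma tail_spectrum:
  assumes H: "\<And>n. n \<ge> 1 \<Longrightarrow> hadamard_triple (p n) (D n) (L n)"
  shows "absolutely_continuous lborel (tail 0) \<and> spectral_measure (tail 0)"
proof -
  have "absolutely_continuous lborel (tail (N - i)) \<and> (\<exists>\<Lambda>. exp_orthogonal (tail (N - i)) \<Lambda> \<and> exp_complete (tail (N - i)) \<Lambda>)" for i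
  proof (induction i)
    case 0
    show ?case using absolutely_continuous_tail[of N] exp_orthogonal_tail[of N] exp_complete_tail[of N] by auto
  next
    case (Suc i)
    show ?case
    proof (cases "i < N")
      case True
      then have S: "Suc (N - Suc i) = N - i" by simp
      obtain \<Lambda> where L: "exp_orthogonal (tail (N - i)) \<Lambda>" "exp_complete (tail (N - i)) \<Lambda>" using Suc.IH by blast
      have "hadamard_triple (p (Suc (N - Suc i))) (D (Suc (N - Suc i))) (L (Suc (N - Suc i)))" by (rule H) simp
      from spectrum_step[OF this, of \<Lambda>] absolutely_continuous_step[of "N - Suc i"] L Suc.IH
      show ?thesis unfolding S by blast
    qed (use Suc.IH in simp)
  qed
  from this[of N] show ?thesis using spectral_measureI[OF real_distribution_tail] by auto
qed

end

lemma inj_on_preimage: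
  fixes b :: "real \<Rightarrow> int" and p :: int
  assumes "p > 0" shows "inj_on (\<lambda>x. (x + of_int (b x)) / of_int p) {0..<1}"
  by (rule inj_onI) (use unique_preimage(1)[OF _ assms] in auto)

theorem theorem2p3:
  fixes p :: "nat \<Rightarrow> int" and D L :: "nat \<Rightarrow> int set"
  assumes hadamard: "\<And>n. n \<ge> 1 \<Longrightarrow> hadamard_triple (p n) (D n) (L n)"
    and zero_in: "\<And>n. n \<ge> 1 \<Longrightarrow> 0 \<in> D n"
    and nonneg: "\<And>n d. n \<ge> 1 \<Longrightarrow> d \<in> D n \<Longrightarrow> d \<ge> 0"
    and bdd_digits: "\<exists>C::real. \<forall>n\<ge>1. \<forall>d\<in>D n. real_of_int d / real_of_int (p n) \<le> C"
    and bdd_card: "\<exists>K::nat. \<forall>n\<ge>1. card (D n) \<le> K"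
    and eventually: "\<exists>N. \<forall>n\<ge>N. p n = int (card (D n)) \<and> Gcd {Gcd (D j) | j. j \<ge> n} = 1"
  shows "(\<exists>\<mu>. real_distribution \<mu> \<and> weak_conv_m (moran_partial p D) \<mu>) \<and>
         (\<forall>\<mu>. real_distribution \<mu> \<and> weak_conv_m (moran_partial p D) \<mu> \<longrightarrow>
              absolutely_continuous lborel \<mu> \<and> spectral_measure \<mu>)"
proof -
  obtain C :: real where C: "\<And>n d. n \<ge> 1 \<Longrightarrow> d \<in> D n \<Longrightarrow> real_of_int d / real_of_int (p n) \<le> C"
    using bdd_digits by blast
  obtain K where K: "\<And>n. n \<ge> 1 \<Longrightarrow> card (D n) \<le> K" using bdd_card by blast
  obtain N where N: "\<And>n. n \<ge> N \<Longrightarrow> p n = int (card (D n))" "\<And>n. n \<ge> N \<Longrightarrow> Gcd {Gcd (D j) | j. j \<ge> n} = 1"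
    using eventually by blast
  have p2: "p n \<ge> 2" and finD: "finite (D n)" if "n \<ge> 1" for n
    using hadamard[OF that] by (auto simp: hadamard_triple_def)
  have digit_le: "real_of_int d \<le> C * real_of_int (p n)" if "n \<ge> 1" "d \<in> D n" for n d
    using C[OF that] p2[OF that(1)] by (simp add: divide_le_eq)
  \<comment> \<open>From level N on this bounds both p n = card (D n) \<le> K and the digits d \<le>
    C p n \<le> C K.\<close>
  define B where "B = max (int K) \<lceil>C * real K\<rceil>"
  interpret digit_system p D C
    by unfold_locales (use p2 finD zero_in nonneg digit_le in blast)+
  interpret residue_system p D C N B
  proof
    fix n assume n: "n \<ge> N"
    have pn: "p (Suc n) = int (card (D (Suc n)))" using N(1) n by simp
    have "D (Suc n) \<subseteq> {0..B}"
    proof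
      fix d assume d: "d \<in> D (Suc n)"
      have "real_of_int d \<le> C * real_of_int (p (Suc n))" using digit_le d by simp
      also have "\<dots> \<le> C * real K" using K[of "Suc n"] C_nonneg by (intro mult_left_mono) (simp_all add: pn)
      also have "\<dots> \<le> of_int B" unfolding B_def by (meson le_of_int_ceiling max.cobounded2 of_int_le_iff order_trans)
      finally show "d \<in> {0..B}" using nonneg[of "Suc n" d] d by simp
    qed
    then show "residue_digits B (p (Suc n)) (D (Suc n))"
      using p2[of "Suc n"] K[of "Suc n"] zero_in[of "Suc n"] hadamard_inj_mod[OF hadamard[of "Suc n"]]
      by (auto simp: residue_digits_def pn B_def)
  next
    fix n q assume n: "n \<ge> N" and q: "\<And>j d. j > n \<Longrightarrow> d \<in> D j \<Longrightarrow> q dvd d"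
    have "q dvd Gcd (D j)" if "j \<ge> Suc n" for j
      by (rule Gcd_greatest) (use that q[of j] in auto)
    \<comment> \<open>The tail after n digits contains only digits of index at least
      \<open>Suc n\<close>, so the gcd hypothesis is used at \<open>Suc n\<close>.\<close>
    then have "q dvd Gcd {Gcd (D j) | j. j \<ge> Suc n}" by (intro Gcd_greatest) auto
    then show "q dvd 1" using N(2)[of "Suc n"] n by simp
  qed
  have "absolutely_continuous lborel (tail 0) \<and> spectral_measure (tail 0)"
    using hadamard by (rule tail_spectrum)
  then show ?thesis
    using real_distribution_tail[of 0] weak_conv_moran_tail weak_limit_unique by blast
qed

end
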